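(* Let $\downarrow^{\mathrm{eq}}$ be an independence relation on $\mathfrak C^{\mathrm{eq}}$ extending $\downarrow$. Let $M_P$ and $M'_P$ be two $\downarrow$-lovely pairs for $T$. Let $\bar a$ be a P-independent small tuple from $M^{\mathrm{eq}}$, and let $\bar a'$ be a P-independent tuple of the same length and the same sorts from $M'^{\mathrm{eq}}$. If $\bar a\equiv^1\bar a'$ and $\bar a$, $\bar a'$ have the same P-type, then $\bar a\equiv^2\bar a'$ (the $\mathcal L^2$-type of $\bar a$ computed in $M_P$ equals that of $\bar a'$ computed in $M'_P$).
   Context: $T$ is a complete first-order theory in a language $\mathcal L$ and $\mathfrak C$ is a monster model of $T$; "small" means of cardinality smaller than the monstrosity of $\mathfrak C$ (its degree of saturation and strong homogeneity); tuples have small length. Juxtaposition denotes union, and tuples are identified with their sets of entries. An independence relation on $\mathfrak C$ is a ternary relation $A\downarrow_C B$ on small subsets of $\mathfrak C$ such that for all small $A,B,C,D$: (Invariance) $A\downarrow_B C\Rightarrow\sigma(A)\downarrow_{\sigma(B)}\sigma(C)$ for $\sigma\in\mathrm{Aut}(\mathfrak C)$; (Normality) $A\downarrow_C B\Rightarrow AC\downarrow_C B$; (Symmetry) $A\downarrow_B C\Rightarrow C\downarrow_B A$; (Transitivity) if $B\subseteq C\subseteq D$, then $A\downarrow_B D$ iff $A\downarrow_B C$ and $A\downarrow_C D$; (Finite character) $A\downarrow_B C$ iff $A_0\downarrow_B C$ for all finite $A_0\subseteq A$; (Extension) there is $A'\equiv_B A$ with $A'\downarrow_B C$; (Local character) there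 is a small cardinal $\lambda$ depending only on $\downarrow$ such that for all small $A,C$ there is $C_0\subseteq C$ with $|C_0|<\lambda+|A|^+$ and $A\downarrow_{C_0}C$. Independence relations on $\mathfrak C^{\mathrm{eq}}$ are defined in the same way. Fix an independence relation $\downarrow$ on $\mathfrak C$. $\kappa_0$ is the least regular cardinal $\mu$ such that for every finite tuple $\bar a$ and small set $B$ there is $B_0\subseteq B$ with $|B_0|<\mu$ and $\bar a\downarrow_{B_0}B$. $\mathrm{cl}(A)=\{c\in\mathfrak C:c\downarrow_A c\}$ and $\mathrm{cl}^{\mathrm{eq}}(A)=\{c\in\mathfrak C^{\mathrm{eq}}:c\downarrow^{\mathrm{eq}}_A c\}$. $\mathcal L^2=\mathcal L\cup\{P\}$ with $P$ a new unary predicate; $T^2$ is the theory of all expansions of $T$ to $\mathcal L^2$. A superscript 1 (resp. 2) on a model-theoretic notion refers to $\mathcal L$ (resp. $\mathcal L^2$). Models of $T$ are elementary substructures of $\mathfrak C$; a model of $T^2$ is written $M_P=\langle M,P(M)\rangle$, and $P(A)=P(M)\cap A$ for $A\subseteq M$. For a complete type $q$ over $A\supseteq B$, $q\downarrow_B A$ means $c\downarrow_B A$ for a realization $c$ of $q$ in $\mathfrak C$. Fix a small cardinal $\kappa>\max(\kappa_0,|T|)$ (the same for all lovely pairs considered); a set or tuple is very small if its cardinality is $<\kappa$. $M_P\models T^2$ is a ($\downarrow$-)lovely pair if: (1) $M$ is a small model of $T$; (2) (Density property) for every very small $A\subset M$ and $q\in S^1_1(A)$ with $q\downarrow_{P(A)}A$,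 $q$ is realized in $P(M)$; (3) (Extension property) for every very small $A\subset M$ and $q\in S^1_1(A)$ there is $b\in M$ realizing $q$ with $b\downarrow_A P(M)$. In a lovely pair $P(M)$ is closed in $M$, i.e. $\mathrm{cl}(P(M))\cap M=P(M)$. For $A\subseteq M^{\mathrm{eq}}$ put $P(A)=\mathrm{cl}^{\mathrm{eq}}(P(M))\cap A$; $A$ is P-independent if $A\downarrow^{\mathrm{eq}}_{P(A)}P(M)$. The P-type of a possibly infinite tuple from $M^{\mathrm{eq}}$ is the information telling which of its members are in $P(M^{\mathrm{eq}})=\mathrm{cl}^{\mathrm{eq}}(P(M))\cap M^{\mathrm{eq}}$. *)

theory Defs
  imports Main
begin

unbundle cardinal_syntax

section \<open>Many-sorted first-order logic\<close>

text \<open>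
  The language of the theory is one-sorted; sorts are carried along so that the same notions of
  formula, satisfaction, type, automorphism and independence relation apply verbatim to the
  expansion by imaginaries. One-sorted languages use the sort type \<^typ>\<open>unit\<close>.
\<close>

datatype ('s, 'f) tm = Var 's nat | Fn 'f "('s, 'f) tm list"

datatype ('s, 'f, 'r) fm =
    Eq "('s, 'f) tm" "('s, 'f) tm"
  | Rel 'r "('s, 'f) tm list"
  | Neg "('s, 'f, 'r) fm"
  | Conj "('s, 'f, 'r) fm" "('s, 'f, 'r) fm"
  | Ex 's nat "('s, 'f, 'r) fm"

text \<open>Arities matter only for symbols in \<open>fsyms\<close> and \<open>rsyms\<close>.\<close>

record ('s, 'f, 'r) lang =
  sorts :: "'s set"
  fsyms :: "'f set"
  fdom :: "'f \<Rightarrow> 's list"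
  fcod :: "'f \<Rightarrow> 's"
  rsyms :: "'r set"
  rdom :: "'r \<Rightarrow> 's list"

record ('s, 'f, 'r, 'a) struct =
  univ :: "'s \<Rightarrow> 'a set"
  fint :: "'f \<Rightarrow> 'a list \<Rightarrow> 'a"
  rint :: "'r \<Rightarrow> 'a list \<Rightarrow> bool"

fun sort_of :: "('s, 'f, 'r) lang \<Rightarrow> ('s, 'f) tm \<Rightarrow> 's" where
  "sort_of L (Var s n) = s"
| "sort_of L (Fn f ts) = fcod L f"

fun wf_tm :: "('s, 'f, 'r) lang \<Rightarrow> ('s, 'f) tm \<Rightarrow> bool" where
  "wf_tm L (Var s n) \<longleftrightarrow> s \<in> sorts L"
| "wf_tm L (Fn f ts) \<longleftrightarrow>
     f \<in> fsyms L \<and> map (sort_of L) ts = fdom L f \<and> (\<forall>t\<in>set ts. wf_tm L t)"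

fun wf_fm :: "('s, 'f, 'r) lang \<Rightarrow> ('s, 'f, 'r) fm \<Rightarrow> bool" where
  "wf_fm L (Eq t u) \<longleftrightarrow> wf_tm L t \<and> wf_tm L u \<and> sort_of L t = sort_of L u"
| "wf_fm L (Rel r ts) \<longleftrightarrow>
     r \<in> rsyms L \<and> map (sort_of L) ts = rdom L r \<and> (\<forall>t\<in>set ts. wf_tm L t)"
| "wf_fm L (Neg \<phi>) \<longleftrightarrow> wf_fm L \<phi>"
| "wf_fm L (Conj \<phi> \<psi>) \<longleftrightarrow> wf_fm L \<phi> \<and> wf_fm L \<psi>"
| "wf_fm L (Ex s n \<phi>) \<longleftrightarrow> s \<in> sorts L \<and> wf_fm L \<phi>"

fun fv_tm :: "('s, 'f) tm \<Rightarrow> ('s \<times> nat) set" where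
  "fv_tm (Var s n) = {(s, n)}"
| "fv_tm (Fn f ts) = (\<Union>t\<in>set ts. fv_tm t)"

fun fv :: "('s, 'f, 'r) fm \<Rightarrow> ('s \<times> nat) set" where
  "fv (Eq t u) = fv_tm t \<union> fv_tm u"
| "fv (Rel r ts) = (\<Union>t\<in>set ts. fv_tm t)"
| "fv (Neg \<phi>) = fv \<phi>"
| "fv (Conj \<phi> \<psi>) = fv \<phi> \<union> fv \<psi>"
| "fv (Ex s n \<phi>) = fv \<phi> - {(s, n)}"

definition sentences :: "('s, 'f, 'r) lang \<Rightarrow> ('s, 'f, 'r) fm set" where
  "sentences L = {\<phi>. wf_fm L \<phi> \<and> fv \<phi> = {}}"

fun tm_val :: "('s, 'f, 'r, 'a) struct \<Rightarrow> ('s \<times> nat \<Rightarrow> 'a) \<Rightarrow> ('s, 'f) tm \<Rightarrow> 'a" where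
  "tm_val N v (Var s n) = v (s, n)"
| "tm_val N v (Fn f ts) = fint N f (map (tm_val N v) ts)"

fun sat :: "('s, 'f, 'r, 'a) struct \<Rightarrow> ('s \<times> nat \<Rightarrow> 'a) \<Rightarrow> ('s, 'f, 'r) fm \<Rightarrow> bool" where
  "sat N v (Eq t u) \<longleftrightarrow> tm_val N v t = tm_val N v u"
| "sat N v (Rel r ts) \<longleftrightarrow> rint N r (map (tm_val N v) ts)"
| "sat N v (Neg \<phi>) \<longleftrightarrow> \<not> sat N v \<phi>"
| "sat N v (Conj \<phi> \<psi>) \<longleftrightarrow> sat N v \<phi> \<and> sat N v \<psi>"
| "sat N v (Ex s n \<phi>) \<longleftrightarrow> (\<exists>x\<in>univ N s. sat N (v((s, n) := x)) \<phi>)"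

definition carrier :: "('s, 'f, 'r) lang \<Rightarrow> ('s, 'f, 'r, 'a) struct \<Rightarrow> 'a set" where
  "carrier L N = (\<Union>s\<in>sorts L. univ N s)"

definition is_struct :: "('s, 'f, 'r) lang \<Rightarrow> ('s, 'f, 'r, 'a) struct \<Rightarrow> bool" where
  "is_struct L N \<longleftrightarrow>
     (\<forall>s\<in>sorts L. univ N s \<noteq> {}) \<and>
     (\<forall>f\<in>fsyms L. \<forall>xs. list_all2 (\<lambda>x s. x \<in> univ N s) xs (fdom L f) \<longrightarrow>
        fint N f xs \<in> univ N (fcod L f))"

text \<open>
  A complete theory is identified with its (deductively closed) set of consequences, so
  that \<open>|T|\<close> is the number of formulas of the language. Consistency comes
  from the existence of a model.
\<close>

definition complete_theory :: "('s, 'f, 'r) lang \<Rightarrow> ('s, 'f, 'r) fm set \<Rightarrow> bool" where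
  "complete_theory L T \<longleftrightarrow>
     T \<subseteq> sentences L \<and> (\<forall>\<phi>\<in>sentences L. \<phi> \<in> T \<or> Neg \<phi> \<in> T)"

definition is_model ::
  "('s, 'f, 'r) lang \<Rightarrow> ('s, 'f, 'r) fm set \<Rightarrow> ('s, 'f, 'r, 'a) struct \<Rightarrow> bool" where
  "is_model L T N \<longleftrightarrow> is_struct L N \<and> (\<forall>\<phi>\<in>T. \<forall>v. sat N v \<phi>)"

text \<open>
  Tuples of arbitrary length are families indexed by a set \<open>I\<close>. In \<open>same_type\<close> the map \<open>\<eta>\<close>
  substitutes the variables of the type, which are indexed by \<open>I\<close>, for those of \<open>\<phi>\<close>.
\<close>

definition same_sorts ::
  "('s, 'f, 'r) lang \<Rightarrow> ('s, 'f, 'r, 'a) struct \<Rightarrow> ('s, 'f, 'r, 'b) struct \<Rightarrow>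
     'i set \<Rightarrow> ('i \<Rightarrow> 'a) \<Rightarrow> ('i \<Rightarrow> 'b) \<Rightarrow> bool" where
  "same_sorts L N N' I a a' \<longleftrightarrow>
     (\<forall>i\<in>I. \<forall>s\<in>sorts L. a i \<in> univ N s \<longleftrightarrow> a' i \<in> univ N' s)"

definition same_type ::
  "('s, 'f, 'r) lang \<Rightarrow> ('s, 'f, 'r, 'a) struct \<Rightarrow> ('s, 'f, 'r, 'b) struct \<Rightarrow>
     'i set \<Rightarrow> ('i \<Rightarrow> 'a) \<Rightarrow> ('i \<Rightarrow> 'b) \<Rightarrow> bool" where
  "same_type L N N' I a a' \<longleftrightarrow>
     same_sorts L N N' I a a' \<and>
     (\<forall>\<phi> \<eta>. wf_fm L \<phi> \<longrightarrow> (\<forall>(s, n)\<in>fv \<phi>. \<eta> (s, n) \<in> I \<and> a (\<eta> (s, n)) \<in> univ N s) \<longrightarrow>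
        (sat N (a \<circ> \<eta>) \<phi> \<longleftrightarrow> sat N' (a' \<circ> \<eta>) \<phi>))"

definition elementary_map ::
  "('s, 'f, 'r) lang \<Rightarrow> ('s, 'f, 'r, 'a) struct \<Rightarrow> 'a set \<Rightarrow> ('a \<Rightarrow> 'a) \<Rightarrow> bool" where
  "elementary_map L N A f \<longleftrightarrow> same_type L N N A id f"

definition equiv_over ::
  "('s, 'f, 'r) lang \<Rightarrow> ('s, 'f, 'r, 'a) struct \<Rightarrow> 'a set \<Rightarrow> 'a set \<Rightarrow> 'a set \<Rightarrow> bool" where
  "equiv_over L N B A A' \<longleftrightarrow>
     (\<exists>f. elementary_map L N (A \<union> B) f \<and> (\<forall>b\<in>B. f b = b) \<and> f ` A = A')"

definition automorphism ::
  "('s, 'f, 'r) lang \<Rightarrow> ('s, 'f, 'r, 'a) struct \<Rightarrow> ('a \<Rightarrow> 'a) \<Rightarrow> bool" where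
  "automorphism L N \<sigma> \<longleftrightarrow>
     bij_betw \<sigma> (carrier L N) (carrier L N) \<and>
     (\<forall>s\<in>sorts L. \<sigma> ` univ N s = univ N s) \<and>
     (\<forall>f\<in>fsyms L. \<forall>xs. list_all2 (\<lambda>x s. x \<in> univ N s) xs (fdom L f) \<longrightarrow>
        \<sigma> (fint N f xs) = fint N f (map \<sigma> xs)) \<and>
     (\<forall>r\<in>rsyms L. \<forall>xs. list_all2 (\<lambda>x s. x \<in> univ N s) xs (rdom L r) \<longrightarrow>
        (rint N r (map \<sigma> xs) \<longleftrightarrow> rint N r xs))"

definition substr :: "('s, 'f, 'r, 'a) struct \<Rightarrow> 'a set \<Rightarrow> ('s, 'f, 'r, 'a) struct" where
  "substr N M = N\<lparr>univ := \<lambda>s. univ N s \<inter> M\<rparr>"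

definition elementary_substructure ::
  "('s, 'f, 'r) lang \<Rightarrow> ('s, 'f, 'r, 'a) struct \<Rightarrow> 'a set \<Rightarrow> bool" where
  "elementary_substructure L N M \<longleftrightarrow>
     M \<subseteq> carrier L N \<and> is_struct L (substr N M) \<and>
     (\<forall>\<phi> v. wf_fm L \<phi> \<longrightarrow> (\<forall>(s, n)\<in>fv \<phi>. v (s, n) \<in> univ N s \<inter> M) \<longrightarrow>
        (sat (substr N M) v \<phi> \<longleftrightarrow> sat N v \<phi>))"

section \<open>One-types and the monster model\<close>

definition param_lang ::
  "(unit, 'f, 'r) lang \<Rightarrow> 'a set \<Rightarrow> (unit, 'f + 'a, 'r) lang" where
  "param_lang L A =
     \<lparr>sorts = sorts L,
      fsyms = Inl ` fsyms L \<union> Inr ` A,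
      fdom = case_sum (fdom L) (\<lambda>_. []),
      fcod = case_sum (fcod L) (\<lambda>_. ()),
      rsyms = rsyms L,
      rdom = rdom L\<rparr>"

definition param_struct ::
  "(unit, 'f, 'r, 'a) struct \<Rightarrow> (unit, 'f + 'a, 'r, 'a) struct" where
  "param_struct N =
     \<lparr>univ = univ N,
      fint = case_sum (fint N) (\<lambda>a _. a),
      rint = rint N\<rparr>"

definition forms1 ::
  "(unit, 'f, 'r) lang \<Rightarrow> 'a set \<Rightarrow> (unit, 'f + 'a, 'r) fm set" where
  "forms1 L A = {\<phi>. wf_fm (param_lang L A) \<phi> \<and> fv \<phi> \<subseteq> {((), 0)}}"

definition realizes ::
  "(unit, 'f, 'r, 'a) struct \<Rightarrow> 'a \<Rightarrow> (unit, 'f + 'a, 'r) fm set \<Rightarrow> bool" where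
  "realizes N c p \<longleftrightarrow> c \<in> univ N () \<and> (\<forall>\<phi>\<in>p. sat (param_struct N) (\<lambda>_. c) \<phi>)"

text \<open>The complete one-types over \<open>A\<close>, consistency being finite satisfiability in \<open>N\<close>.\<close>

definition S1 ::
  "(unit, 'f, 'r) lang \<Rightarrow> (unit, 'f, 'r, 'a) struct \<Rightarrow> 'a set \<Rightarrow>
     (unit, 'f + 'a, 'r) fm set set" where
  "S1 L N A =
     {p. p \<subseteq> forms1 L A \<and> (\<forall>\<phi>\<in>forms1 L A. \<phi> \<in> p \<or> Neg \<phi> \<in> p) \<and>
         (\<forall>p0. finite p0 \<and> p0 \<subseteq> p \<longrightarrow> (\<exists>c. realizes N c p0))}"

text \<open>Cardinals are the \<^const>\<open>Card_order\<close> relations; \<open>\<mu>\<close> is the monstrosity.\<close>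

definition small ::
  "('s, 'f, 'r) lang \<Rightarrow> ('s, 'f, 'r, 'a) struct \<Rightarrow> 'k rel \<Rightarrow> 'a set \<Rightarrow> bool" where
  "small L N \<mu> A \<longleftrightarrow> A \<subseteq> carrier L N \<and> |A| <o \<mu>"

definition saturated ::
  "(unit, 'f, 'r) lang \<Rightarrow> (unit, 'f, 'r, 'a) struct \<Rightarrow> 'k rel \<Rightarrow> bool" where
  "saturated L N \<mu> \<longleftrightarrow>
     (\<forall>A. small L N \<mu> A \<longrightarrow> (\<forall>p\<in>S1 L N A. \<exists>c. realizes N c p))"

definition strongly_homogeneous ::
  "(unit, 'f, 'r) lang \<Rightarrow> (unit, 'f, 'r, 'a) struct \<Rightarrow> 'k rel \<Rightarrow> bool" where
  "strongly_homogeneous L N \<mu> \<longleftrightarrow>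
     (\<forall>A f. small L N \<mu> A \<and> elementary_map L N A f \<longrightarrow>
        (\<exists>\<sigma>. automorphism L N \<sigma> \<and> (\<forall>a\<in>A. \<sigma> a = f a)))"

definition monster_model ::
  "(unit, 'f, 'r) lang \<Rightarrow> (unit, 'f, 'r) fm set \<Rightarrow> 'k rel \<Rightarrow>
     (unit, 'f, 'r, 'a) struct \<Rightarrow> bool" where
  "monster_model L T \<mu> N \<longleftrightarrow>
     is_model L T N \<and> Card_order \<mu> \<and> saturated L N \<mu> \<and> strongly_homogeneous L N \<mu>"

section \<open>Independence relations\<close>

text \<open>
  \<open>ind A C B\<close> stands for independence of \<open>A\<close> from \<open>B\<close> over \<open>C\<close>: the base is the middle argument.
  Only the values of \<open>ind\<close> on small subsets of the carrier are meaningful.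
\<close>

definition independence_relation ::
  "('s, 'f, 'r) lang \<Rightarrow> ('s, 'f, 'r, 'a) struct \<Rightarrow> 'k rel \<Rightarrow>
     ('a set \<Rightarrow> 'a set \<Rightarrow> 'a set \<Rightarrow> bool) \<Rightarrow> bool" where
  "independence_relation L N \<mu> ind \<longleftrightarrow>
     \<comment> \<open>invariance\<close>
     (\<forall>A B C \<sigma>. small L N \<mu> A \<and> small L N \<mu> B \<and> small L N \<mu> C \<and> automorphism L N \<sigma> \<longrightarrow>
        ind A B C \<longrightarrow> ind (\<sigma> ` A) (\<sigma> ` B) (\<sigma> ` C)) \<and>
     \<comment> \<open>normality\<close>
     (\<forall>A B C. small L N \<mu> A \<and> small L N \<mu> B \<and> small L N \<mu> C \<longrightarrow>
        ind A C B \<longrightarrow> ind (A \<union> C) C B) \<and>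
     \<comment> \<open>symmetry\<close>
     (\<forall>A B C. small L N \<mu> A \<and> small L N \<mu> B \<and> small L N \<mu> C \<longrightarrow>
        ind A B C \<longrightarrow> ind C B A) \<and>
     \<comment> \<open>transitivity\<close>
     (\<forall>A B C D. small L N \<mu> A \<and> small L N \<mu> B \<and> small L N \<mu> C \<and> small L N \<mu> D \<longrightarrow>
        B \<subseteq> C \<and> C \<subseteq> D \<longrightarrow> (ind A B D \<longleftrightarrow> ind A B C \<and> ind A C D)) \<and>
     \<comment> \<open>finite character\<close>
     (\<forall>A B C. small L N \<mu> A \<and> small L N \<mu> B \<and> small L N \<mu> C \<longrightarrow>
        (ind A B C \<longleftrightarrow> (\<forall>A0. finite A0 \<and> A0 \<subseteq> A \<longrightarrow> ind A0 B C))) \<and>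
     \<comment> \<open>extension\<close>
     (\<forall>A B C. small L N \<mu> A \<and> small L N \<mu> B \<and> small L N \<mu> C \<longrightarrow>
        (\<exists>A'. small L N \<mu> A' \<and> equiv_over L N B A A' \<and> ind A' B C)) \<and>
     \<comment> \<open>local character\<close>
     (\<exists>\<theta> :: 'k rel. Card_order \<theta> \<and> \<theta> <o \<mu> \<and>
        (\<forall>A C. small L N \<mu> A \<and> small L N \<mu> C \<longrightarrow>
           (\<exists>C0\<subseteq>C. |C0| <o \<theta> +c cardSuc |A| \<and> ind A C0 C)))"

definition closure_of ::
  "('s, 'f, 'r) lang \<Rightarrow> ('s, 'f, 'r, 'a) struct \<Rightarrow>
     ('a set \<Rightarrow> 'a set \<Rightarrow> 'a set \<Rightarrow> bool) \<Rightarrow> 'a set \<Rightarrow> 'a set" where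
  "closure_of L N ind A = {c \<in> carrier L N. ind {c} A {c}}"

definition finite_local_character ::
  "('s, 'f, 'r) lang \<Rightarrow> ('s, 'f, 'r, 'a) struct \<Rightarrow> 'k rel \<Rightarrow>
     ('a set \<Rightarrow> 'a set \<Rightarrow> 'a set \<Rightarrow> bool) \<Rightarrow> 'k rel \<Rightarrow> bool" where
  "finite_local_character L N \<mu> ind \<nu> \<longleftrightarrow>
     (\<forall>A B. finite A \<and> A \<subseteq> carrier L N \<and> small L N \<mu> B \<longrightarrow>
        (\<exists>B0\<subseteq>B. |B0| <o \<nu> \<and> ind A B0 B))"

text \<open>
  \<open>\<kappa>0\<close> is the least regular cardinal with \<open>finite_local_character\<close>. Every cardinal below \<open>\<mu>\<close> is
  represented on the type \<open>'k\<close>, so nothing is lost by comparing only with cardinals there.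
\<close>

definition is_kappa0 ::
  "('s, 'f, 'r) lang \<Rightarrow> ('s, 'f, 'r, 'a) struct \<Rightarrow> 'k rel \<Rightarrow>
     ('a set \<Rightarrow> 'a set \<Rightarrow> 'a set \<Rightarrow> bool) \<Rightarrow> 'k rel \<Rightarrow> bool" where
  "is_kappa0 L N \<mu> ind \<kappa>0 \<longleftrightarrow>
     Cinfinite \<kappa>0 \<and> regularCard \<kappa>0 \<and> finite_local_character L N \<mu> ind \<kappa>0 \<and>
     (\<forall>\<nu> :: 'k rel. Cinfinite \<nu> \<and> regularCard \<nu> \<and> finite_local_character L N \<mu> ind \<nu> \<longrightarrow>
        \<kappa>0 \<le>o \<nu>)"

section \<open>Lovely pairs\<close>

text \<open>
  A model \<open>\<langle>M, P(M)\<rangle>\<close> of the theory of all expansions of \<open>T\<close> by a unary predicate is a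
  model \<open>M\<close> of \<open>T\<close> with an arbitrary subset \<open>PM\<close> of it. For a complete type \<open>q\<close> over \<open>A\<close>, independence
  over \<open>B\<close> of \<open>q\<close> from \<open>A\<close> refers to a realization in the monster model \<open>N\<close>.
\<close>

definition is_pair ::
  "(unit, 'f, 'r) lang \<Rightarrow> (unit, 'f, 'r, 'a) struct \<Rightarrow> 'a set \<Rightarrow> 'a set \<Rightarrow> bool" where
  "is_pair L N M PM \<longleftrightarrow> elementary_substructure L N M \<and> PM \<subseteq> M"

definition type_indep ::
  "(unit, 'f, 'r, 'a) struct \<Rightarrow> ('a set \<Rightarrow> 'a set \<Rightarrow> 'a set \<Rightarrow> bool) \<Rightarrow>
     (unit, 'f + 'a, 'r) fm set \<Rightarrow> 'a set \<Rightarrow> 'a set \<Rightarrow> bool" where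
  "type_indep N ind q B A \<longleftrightarrow> (\<exists>c. realizes N c q \<and> ind {c} B A)"

definition lovely_pair ::
  "(unit, 'f, 'r) lang \<Rightarrow> (unit, 'f, 'r, 'a) struct \<Rightarrow> 'k rel \<Rightarrow>
     ('a set \<Rightarrow> 'a set \<Rightarrow> 'a set \<Rightarrow> bool) \<Rightarrow> 'k rel \<Rightarrow> 'a set \<Rightarrow> 'a set \<Rightarrow> bool" where
  "lovely_pair L N \<mu> ind \<kappa> M PM \<longleftrightarrow>
     is_pair L N M PM \<and> small L N \<mu> M \<and>
     (\<forall>A\<subseteq>M. |A| <o \<kappa> \<longrightarrow>
        (\<forall>q\<in>S1 L N A. type_indep N ind q (PM \<inter> A) A \<longrightarrow> (\<exists>b\<in>PM. realizes N b q))) \<and>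
     (\<forall>A\<subseteq>M. |A| <o \<kappa> \<longrightarrow>
        (\<forall>q\<in>S1 L N A. \<exists>b\<in>M. realizes N b q \<and> ind {b} A PM))"

section \<open>Imaginaries\<close>

text \<open>
  A sort \<open>Quot n E\<close> for every formula \<open>E(x\<^sub>1,\<dots>,x\<^sub>n,y\<^sub>1,\<dots>,y\<^sub>n)\<close> defining an equivalence relation
  on \<open>n\<close>-tuples of \<open>N\<close>, with the quotient map \<open>Proj n E\<close>. The variables \<open>0,\<dots>,n-1\<close> of \<open>E\<close> stand for
  the first tuple and \<open>n,\<dots>,2n-1\<close> for the second.
\<close>

datatype ('f, 'r) eq_sort = Home | Quot nat "(unit, 'f, 'r) fm"

datatype ('f, 'r) eq_fun = Old 'f | Proj nat "(unit, 'f, 'r) fm"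

datatype ('f, 'r, 'a) eq_elem = Elt (un_elt: 'a) | Imag nat "(unit, 'f, 'r) fm" "'a list set"

definition tuples :: "'a set \<Rightarrow> nat \<Rightarrow> 'a list set" where
  "tuples M n = {xs. length xs = n \<and> set xs \<subseteq> M}"

definition def_rel ::
  "(unit, 'f, 'r, 'a) struct \<Rightarrow> nat \<Rightarrow> (unit, 'f, 'r) fm \<Rightarrow> ('a list \<times> 'a list) set" where
  "def_rel N n E =
     {(xs, ys). xs \<in> tuples (univ N ()) n \<and> ys \<in> tuples (univ N ()) n \<and>
                sat N (\<lambda>(_, i). (xs @ ys) ! i) E}"

definition eq_formula ::
  "(unit, 'f, 'r) lang \<Rightarrow> (unit, 'f, 'r, 'a) struct \<Rightarrow> nat \<Rightarrow> (unit, 'f, 'r) fm \<Rightarrow> bool" where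
  "eq_formula L N n E \<longleftrightarrow>
     n > 0 \<and> wf_fm L E \<and> fv E \<subseteq> {()} \<times> {..<2 * n} \<and>
     equiv (tuples (univ N ()) n) (def_rel N n E)"

definition eq_lang ::
  "(unit, 'f, 'r) lang \<Rightarrow> (unit, 'f, 'r, 'a) struct \<Rightarrow>
     (('f, 'r) eq_sort, ('f, 'r) eq_fun, 'r) lang" where
  "eq_lang L N =
     \<lparr>sorts = insert Home {Quot n E |n E. eq_formula L N n E},
      fsyms = Old ` fsyms L \<union> {Proj n E |n E. eq_formula L N n E},
      fdom = case_eq_fun (\<lambda>f. map (\<lambda>_. Home) (fdom L f)) (\<lambda>n E. replicate n Home),
      fcod = case_eq_fun (\<lambda>f. Home) (\<lambda>n E. Quot n E),
      rsyms = rsyms L,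
      rdom = (\<lambda>r. map (\<lambda>_. Home) (rdom L r))\<rparr>"

definition eq_struct ::
  "(unit, 'f, 'r, 'a) struct \<Rightarrow>
     (('f, 'r) eq_sort, ('f, 'r) eq_fun, 'r, ('f, 'r, 'a) eq_elem) struct" where
  "eq_struct N =
     \<lparr>univ = case_eq_sort (Elt ` univ N ())
               (\<lambda>n E. Imag n E ` (tuples (univ N ()) n // def_rel N n E)),
      fint = case_eq_fun (\<lambda>f xs. Elt (fint N f (map un_elt xs)))
               (\<lambda>n E xs. Imag n E (def_rel N n E `` {map un_elt xs})),
      rint = (\<lambda>r xs. rint N r (map un_elt xs))\<rparr>"

text \<open>
  For an elementary substructure \<open>M\<close> of \<open>N\<close>, the imaginaries of \<open>M\<close> are those of \<open>N\<close> that have a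
  representative in \<open>M\<close>.
\<close>

definition eq_set ::
  "(unit, 'f, 'r) lang \<Rightarrow> (unit, 'f, 'r, 'a) struct \<Rightarrow> 'a set \<Rightarrow> ('f, 'r, 'a) eq_elem set" where
  "eq_set L N M =
     Elt ` M \<union> {Imag n E (def_rel N n E `` {xs}) |n E xs. eq_formula L N n E \<and> xs \<in> tuples M n}"

definition extends_to_eq ::
  "(unit, 'f, 'r) lang \<Rightarrow> (unit, 'f, 'r, 'a) struct \<Rightarrow> 'k rel \<Rightarrow>
     ('a set \<Rightarrow> 'a set \<Rightarrow> 'a set \<Rightarrow> bool) \<Rightarrow>
     (('f, 'r, 'a) eq_elem set \<Rightarrow> ('f, 'r, 'a) eq_elem set \<Rightarrow> ('f, 'r, 'a) eq_elem set \<Rightarrow> bool) \<Rightarrow>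
     bool" where
  "extends_to_eq L N \<mu> ind ind_eq \<longleftrightarrow>
     (\<forall>A B C. small L N \<mu> A \<and> small L N \<mu> B \<and> small L N \<mu> C \<longrightarrow>
        (ind_eq (Elt ` A) (Elt ` B) (Elt ` C) \<longleftrightarrow> ind A B C))"

section \<open>Types and independence in a pair\<close>

text \<open>\<open>P(A)\<close> for a set \<open>A\<close> of imaginaries of \<open>M\<close>.\<close>

definition P_part ::
  "(unit, 'f, 'r) lang \<Rightarrow> (unit, 'f, 'r, 'a) struct \<Rightarrow>
     (('f, 'r, 'a) eq_elem set \<Rightarrow> ('f, 'r, 'a) eq_elem set \<Rightarrow> ('f, 'r, 'a) eq_elem set \<Rightarrow> bool) \<Rightarrow>
     'a set \<Rightarrow> ('f, 'r, 'a) eq_elem set \<Rightarrow> ('f, 'r, 'a) eq_elem set" where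
  "P_part L N ind_eq PM A = closure_of (eq_lang L N) (eq_struct N) ind_eq (Elt ` PM) \<inter> A"

definition P_independent ::
  "(unit, 'f, 'r) lang \<Rightarrow> (unit, 'f, 'r, 'a) struct \<Rightarrow>
     (('f, 'r, 'a) eq_elem set \<Rightarrow> ('f, 'r, 'a) eq_elem set \<Rightarrow> ('f, 'r, 'a) eq_elem set \<Rightarrow> bool) \<Rightarrow>
     'a set \<Rightarrow> ('f, 'r, 'a) eq_elem set \<Rightarrow> bool" where
  "P_independent L N ind_eq PM A \<longleftrightarrow> ind_eq A (P_part L N ind_eq PM A) (Elt ` PM)"

text \<open>
  The expansion by a new unary predicate \<^const>\<open>None\<close> on the sort \<open>h\<close>. For tuples of imaginaries of
  \<open>M\<close>, the type in the language with \<open>P\<close> is computed in the structure of imaginaries of \<open>M\<close>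
  expanded by \<open>P(M)\<close> on the home sort.
\<close>

definition add_pred :: "('s, 'f, 'r) lang \<Rightarrow> 's \<Rightarrow> ('s, 'f, 'r option) lang" where
  "add_pred L h =
     \<lparr>sorts = sorts L,
      fsyms = fsyms L,
      fdom = fdom L,
      fcod = fcod L,
      rsyms = insert None (Some ` rsyms L),
      rdom = case_option [h] (rdom L)\<rparr>"

definition expand :: "('s, 'f, 'r, 'a) struct \<Rightarrow> 'a set \<Rightarrow> ('s, 'f, 'r option, 'a) struct" where
  "expand N Q =
     \<lparr>univ = univ N,
      fint = fint N,
      rint = case_option (\<lambda>xs. \<exists>x\<in>Q. xs = [x]) (rint N)\<rparr>"

definition pair_eq_struct ::
  "(unit, 'f, 'r) lang \<Rightarrow> (unit, 'f, 'r, 'a) struct \<Rightarrow> 'a set \<Rightarrow> 'a set \<Rightarrow>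
     (('f, 'r) eq_sort, ('f, 'r) eq_fun, 'r option, ('f, 'r, 'a) eq_elem) struct" where
  "pair_eq_struct L N M PM = expand (substr (eq_struct N) (eq_set L N M)) (Elt ` PM)"

definition same_type1 ::
  "(unit, 'f, 'r) lang \<Rightarrow> (unit, 'f, 'r, 'a) struct \<Rightarrow> 'i set \<Rightarrow>
     ('i \<Rightarrow> ('f, 'r, 'a) eq_elem) \<Rightarrow> ('i \<Rightarrow> ('f, 'r, 'a) eq_elem) \<Rightarrow> bool" where
  "same_type1 L N I a a' \<longleftrightarrow> same_type (eq_lang L N) (eq_struct N) (eq_struct N) I a a'"

definition same_type2 ::
  "(unit, 'f, 'r) lang \<Rightarrow> (unit, 'f, 'r, 'a) struct \<Rightarrow>
     'a set \<Rightarrow> 'a set \<Rightarrow> 'a set \<Rightarrow> 'a set \<Rightarrow> 'i set \<Rightarrow>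
     ('i \<Rightarrow> ('f, 'r, 'a) eq_elem) \<Rightarrow> ('i \<Rightarrow> ('f, 'r, 'a) eq_elem) \<Rightarrow> bool" where
  "same_type2 L N M PM M' PM' I a a' \<longleftrightarrow>
     same_type (add_pred (eq_lang L N) Home)
       (pair_eq_struct L N M PM) (pair_eq_struct L N M' PM') I a a'"

definition same_P_type ::
  "(unit, 'f, 'r) lang \<Rightarrow> (unit, 'f, 'r, 'a) struct \<Rightarrow>
     (('f, 'r, 'a) eq_elem set \<Rightarrow> ('f, 'r, 'a) eq_elem set \<Rightarrow> ('f, 'r, 'a) eq_elem set \<Rightarrow> bool) \<Rightarrow>
     'a set \<Rightarrow> 'a set \<Rightarrow> 'a set \<Rightarrow> 'a set \<Rightarrow> 'i set \<Rightarrow>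
     ('i \<Rightarrow> ('f, 'r, 'a) eq_elem) \<Rightarrow> ('i \<Rightarrow> ('f, 'r, 'a) eq_elem) \<Rightarrow> bool" where
  "same_P_type L N ind_eq M PM M' PM' I a a' \<longleftrightarrow>
     (\<forall>i\<in>I. a i \<in> P_part L N ind_eq PM (eq_set L N M) \<longleftrightarrow>
             a' i \<in> P_part L N ind_eq PM' (eq_set L N M'))"

end

theory Submission
  imports Defs
begin

text \<open>
  The theorem is proved by a back-and-forth argument. A small map (\<open>small_map\<close>) is a partial map
  between the imaginaries of the two models that has fewer than \<open>\<kappa>\<close> points, is induced by an
  automorphism of the monster model, preserves P, and has a P-independent domain and range. Small
  maps extend to any further imaginary on either side (\<open>small_map_forth\<close>, \<open>small_map_sym\<close>), hence
  preserve all formulas of the language of pairs (\<open>small_map_sat\<close>).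

  To add an element \<open>d\<close> of the home sort, choose a very small part \<open>A\<close> of P over which \<open>d\<close>, together
  with the domain, is independent of P. The density property gives an image for \<open>A\<close>
  (\<open>small_map_P\<close>), after which \<open>d\<close> and the domain are P-independent and the extension property gives
  an image for \<open>d\<close> (\<open>small_map_home\<close>). An imaginary is added after a representative of it. That
  the new points agree on P follows since, over the P-part of a P-independent set, membership in
  P is membership in the closure of this P-part, which automorphisms preserve.

  The two tuples need not be very small, and P-independence does not pass to subtuples. A formula
  involves a finite subtuple \<open>F\<close> only; local character gives a very small subset \<open>E0\<close> of the P-part
  of the tuple such that \<open>F\<close> is independent of P over \<open>E0\<close>, and then \<open>F \<union> E0\<close> is the domain of a
  small map.

  Three facts on imaginaries carry this argument. Small partial elementary maps between imaginaries
  are induced by automorphisms of the home sort (\<open>eq_homogeneous\<close>), because formulas on imaginaries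
  translate into formulas on representatives (\<open>translate_fm\<close>) to which saturation applies. An
  imaginary of the model in the closure of P has a representative in P (\<open>P_eq_set\<close>). Finally, the
  cardinal \<open>\<kappa>0\<close> bounds bases on the home sort only; bases consisting of imaginaries are bounded
  (\<open>local_character_eq\<close>) by passing to representatives that are generic over them.
\<close>

section \<open>Terms and formulas\<close>

lemma finite_fv_tm: "finite (fv_tm t)"
  by (induction t) auto

lemma finite_fv: "finite (fv \<phi>)"
  by (induction \<phi>) (auto simp: finite_fv_tm)

lemma tm_val_cong:
  "(\<And>x. x \<in> fv_tm t \<Longrightarrow> v x = w x) \<Longrightarrow> tm_val N v t = tm_val N w t"
proof (induction t)
  case (Fn f ts)
  then have "map (tm_val N v) ts = map (tm_val N w) ts" by auto
  then show ?case by (simp only: tm_val.simps)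
qed auto

lemma sat_cong:
  "(\<And>x. x \<in> fv \<phi> \<Longrightarrow> v x = w x) \<Longrightarrow> sat N v \<phi> \<longleftrightarrow> sat N w \<phi>"
proof (induction \<phi> arbitrary: v w)
  case (Eq t u)
  then show ?case using tm_val_cong[of t v w N] tm_val_cong[of u v w N] by auto
next
  case (Rel r ts)
  then have "map (tm_val N v) ts = map (tm_val N w) ts"
    by (auto intro!: tm_val_cong)
  then show ?case by (simp only: sat.simps)
next
  case (Conj \<phi> \<psi>)
  have "sat N v \<phi> \<longleftrightarrow> sat N w \<phi>" "sat N v \<psi> \<longleftrightarrow> sat N w \<psi>"
    by (rule Conj.IH; simp add: Conj.prems)+
  then show ?case by simp
next
  case (Neg \<phi>)
  have "sat N v \<phi> \<longleftrightarrow> sat N w \<phi>" by (rule Neg.IH) (simp add: Neg.prems)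
  then show ?case by simp
next
  case (Ex s n \<phi>)
  have "sat N (v((s, n) := x)) \<phi> \<longleftrightarrow> sat N (w((s, n) := x)) \<phi>" for x
    by (rule Ex.IH) (simp add: Ex.prems)
  then show ?case by simp
qed

lemma list_all2_map_sorts:
  "map f ts = ds \<Longrightarrow> (\<And>t. t \<in> set ts \<Longrightarrow> P (g t) (f t)) \<Longrightarrow> list_all2 P (map g ts) ds"
  by (auto simp: list_all2_conv_all_nth)

lemma tm_val_univ:
  assumes "is_struct L N" "wf_tm L t" "\<And>s n. (s, n) \<in> fv_tm t \<Longrightarrow> v (s, n) \<in> univ N s"
  shows "tm_val N v t \<in> univ N (sort_of L t)"
  using assms(2,3)
proof (induction t)
  case (Fn f ts)
  have "list_all2 (\<lambda>x s. x \<in> univ N s) (map (tm_val N v) ts) (fdom L f)"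
    by (rule list_all2_map_sorts[of "sort_of L"]) (use Fn in auto)
  then show ?case using assms(1) Fn.prems(1) by (simp add: is_struct_def)
qed auto

text \<open>
  Well-formedness of a language does not ask the value sort of a function symbol to be one of the
  sorts; the preservation of equations by automorphisms needs it.
\<close>

definition fcod_sorted :: "('s, 'f, 'r) lang \<Rightarrow> bool" where
  "fcod_sorted L \<longleftrightarrow> (\<forall>f\<in>fsyms L. fcod L f \<in> sorts L)"

lemma sort_of_sorts: "fcod_sorted L \<Longrightarrow> wf_tm L t \<Longrightarrow> sort_of L t \<in> sorts L"
  by (cases t) (auto simp: fcod_sorted_def)

lemma automorphism_tm_val:
  assumes "is_struct L N" "automorphism L N \<sigma>" "wf_tm L t"
    "\<And>s n. (s, n) \<in> fv_tm t \<Longrightarrow> v (s, n) \<in> univ N s"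
  shows "tm_val N (\<lambda>x. \<sigma> (v x)) t = \<sigma> (tm_val N v t)"
  using assms(3,4)
proof (induction t)
  case (Fn f ts)
  have *: "list_all2 (\<lambda>x s. x \<in> univ N s) (map (tm_val N v) ts) (fdom L f)"
    by (rule list_all2_map_sorts[of "sort_of L"])
      (use Fn.prems in \<open>auto intro!: tm_val_univ[OF assms(1)]\<close>)
  have "map (tm_val N (\<lambda>x. \<sigma> (v x))) ts = map \<sigma> (map (tm_val N v) ts)"
    using Fn by auto
  moreover have "\<sigma> (fint N f (map (tm_val N v) ts)) = fint N f (map \<sigma> (map (tm_val N v) ts))"
    using * assms(2) Fn.prems(1) by (simp only: automorphism_def wf_tm.simps)
  ultimately show ?case by (simp only: tm_val.simps)
qed auto

lemma automorphism_sat: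
  assumes "is_struct L N" "fcod_sorted L" "automorphism L N \<sigma>"
  shows "wf_fm L \<phi> \<Longrightarrow> (\<And>s n. (s, n) \<in> fv \<phi> \<Longrightarrow> v (s, n) \<in> univ N s) \<Longrightarrow>
    sat N (\<lambda>x. \<sigma> (v x)) \<phi> \<longleftrightarrow> sat N v \<phi>"
proof (induction \<phi> arbitrary: v)
  case (Eq t u)
  have tu: "tm_val N v t \<in> carrier L N" "tm_val N v u \<in> carrier L N"
    using Eq.prems tm_val_univ[OF assms(1), of t v] tm_val_univ[OF assms(1), of u v]
      sort_of_sorts[OF assms(2)] by (auto simp: carrier_def)
  have "tm_val N (\<lambda>x. \<sigma> (v x)) t = \<sigma> (tm_val N v t)" "tm_val N (\<lambda>x. \<sigma> (v x)) u = \<sigma> (tm_val N v u)"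
    using Eq.prems by (auto intro!: automorphism_tm_val[OF assms(1,3)])
  moreover have "inj_on \<sigma> (carrier L N)"
    using assms(3) by (simp add: automorphism_def bij_betw_def)
  ultimately show ?case using tu by (auto dest: inj_onD)
next
  case (Rel r ts)
  have *: "list_all2 (\<lambda>x s. x \<in> univ N s) (map (tm_val N v) ts) (rdom L r)"
    by (rule list_all2_map_sorts[of "sort_of L"])
      (use Rel.prems in \<open>auto intro!: tm_val_univ[OF assms(1)]\<close>)
  have "map (tm_val N (\<lambda>x. \<sigma> (v x))) ts = map \<sigma> (map (tm_val N v) ts)"
    using Rel by (auto intro!: automorphism_tm_val[OF assms(1,3)])
  moreover have "rint N r (map \<sigma> (map (tm_val N v) ts)) \<longleftrightarrow> rint N r (map (tm_val N v) ts)"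
    using * assms(3) Rel.prems(1) by (simp only: automorphism_def wf_fm.simps)
  ultimately show ?case by (simp only: sat.simps)
next
  case (Ex s n \<phi>)
  have "\<sigma> ` univ N s = univ N s"
    using assms(3) Ex.prems(1) by (simp add: automorphism_def)
  moreover have x_iff: "sat N ((\<lambda>x. \<sigma> (v x))((s, n) := \<sigma> x)) \<phi> \<longleftrightarrow> sat N (v((s, n) := x)) \<phi>"
    if "x \<in> univ N s" for x
  proof -
    have "(\<lambda>x. \<sigma> (v x))((s, n) := \<sigma> x) = (\<lambda>y. \<sigma> ((v((s, n) := x)) y))" by auto
    moreover have "sat N (\<lambda>y. \<sigma> ((v((s, n) := x)) y)) \<phi> \<longleftrightarrow> sat N (v((s, n) := x)) \<phi>"
      by (rule Ex.IH) (use Ex.prems that in auto)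
    ultimately show ?thesis by (simp only:)
  qed
  ultimately have "(\<exists>y\<in>univ N s. sat N ((\<lambda>x. \<sigma> (v x))((s, n) := y)) \<phi>) \<longleftrightarrow>
      (\<exists>x\<in>univ N s. sat N ((\<lambda>x. \<sigma> (v x))((s, n) := \<sigma> x)) \<phi>)"
    by (metis (no_types, lifting) image_iff)
  then show ?case by (auto simp: x_iff)
qed (auto)

section \<open>Partial elementary maps as graphs\<close>

text \<open>
  The relation \<open>H\<close> is the graph of a partial elementary map of \<open>N\<close>. With graphs instead of
  functions, unions of chains and extensions by one pair are plain set operations; a graph on the
  carrier is single-valued because it preserves equations.
\<close>

definition elem_rel ::
  "('s, 'f, 'r) lang \<Rightarrow> ('s, 'f, 'r, 'a) struct \<Rightarrow> ('a \<times> 'a) set \<Rightarrow> bool" where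
  "elem_rel L N H \<longleftrightarrow>
     (\<forall>(x, y)\<in>H. \<forall>s\<in>sorts L. x \<in> univ N s \<longleftrightarrow> y \<in> univ N s) \<and>
     (\<forall>\<phi> w w'. wf_fm L \<phi> \<longrightarrow>
        (\<forall>(s, n)\<in>fv \<phi>. (w (s, n), w' (s, n)) \<in> H \<and> w (s, n) \<in> univ N s) \<longrightarrow>
        (sat N w \<phi> \<longleftrightarrow> sat N w' \<phi>))"

lemma same_type_iff_elem_rel:
  "same_type L N N I a a' \<longleftrightarrow> elem_rel L N ((\<lambda>i. (a i, a' i)) ` I)" (is "?l \<longleftrightarrow> ?r")
proof
  assume l: ?l
  have "sat N w \<phi> \<longleftrightarrow> sat N w' \<phi>" if "wf_fm L \<phi>" and
    h: "\<forall>(s, n)\<in>fv \<phi>. (w (s, n), w' (s, n)) \<in> (\<lambda>i. (a i, a' i)) ` I \<and> w (s, n) \<in> univ N s"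
    for \<phi> w w'
  proof -
    have "\<forall>x. \<exists>i. x \<in> fv \<phi> \<longrightarrow> i \<in> I \<and> w x = a i \<and> w' x = a' i"
      using h by (auto simp: image_iff)
    then obtain \<eta> where \<eta>: "\<And>x. x \<in> fv \<phi> \<Longrightarrow> \<eta> x \<in> I \<and> w x = a (\<eta> x) \<and> w' x = a' (\<eta> x)"
      by metis
    have "sat N (a \<circ> \<eta>) \<phi> \<longleftrightarrow> sat N (a' \<circ> \<eta>) \<phi>"
      using l that(1) h \<eta> unfolding same_type_def by fastforce
    moreover have "sat N (a \<circ> \<eta>) \<phi> \<longleftrightarrow> sat N w \<phi>" "sat N (a' \<circ> \<eta>) \<phi> \<longleftrightarrow> sat N w' \<phi>"
      by (rule sat_cong; simp add: \<eta>)+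
    ultimately show ?thesis by simp
  qed
  moreover have "\<forall>(x, y)\<in>(\<lambda>i. (a i, a' i)) ` I. \<forall>s\<in>sorts L. x \<in> univ N s \<longleftrightarrow> y \<in> univ N s"
    using l by (auto simp: same_type_def same_sorts_def)
  ultimately show ?r unfolding elem_rel_def by blast
next
  assume r: ?r
  have "sat N (a \<circ> \<eta>) \<phi> \<longleftrightarrow> sat N (a' \<circ> \<eta>) \<phi>"
    if "wf_fm L \<phi>" "\<forall>(s, n)\<in>fv \<phi>. \<eta> (s, n) \<in> I \<and> a (\<eta> (s, n)) \<in> univ N s" for \<phi> \<eta>
    using r that unfolding elem_rel_def by (auto simp: split_beta)
  then show ?l using r by (auto simp: same_type_def same_sorts_def elem_rel_def)
qed

lemma elem_rel_sat:
  assumes "elem_rel L N H" "wf_fm L \<phi>"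
    "\<And>s n. (s, n) \<in> fv \<phi> \<Longrightarrow> (w (s, n), w' (s, n)) \<in> H \<and> w (s, n) \<in> univ N s"
  shows "sat N w \<phi> \<longleftrightarrow> sat N w' \<phi>"
proof -
  have "\<forall>(s, n)\<in>fv \<phi>. (w (s, n), w' (s, n)) \<in> H \<and> w (s, n) \<in> univ N s"
    using assms(3) by auto
  then show ?thesis using assms(1,2) unfolding elem_rel_def by blast
qed

lemma elem_rel_sort: "elem_rel L N H \<Longrightarrow> (x, y) \<in> H \<Longrightarrow> s \<in> sorts L \<Longrightarrow> x \<in> univ N s \<longleftrightarrow> y \<in> univ N s"
  by (auto simp: elem_rel_def)

lemma elem_rel_mono: "elem_rel L N H \<Longrightarrow> H' \<subseteq> H \<Longrightarrow> elem_rel L N H'"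
  unfolding elem_rel_def by (intro conjI allI impI) (blast, fast)

lemma automorphism_univ:
  assumes "automorphism L N \<sigma>" "s \<in> sorts L" "x \<in> carrier L N"
  shows "\<sigma> x \<in> univ N s \<longleftrightarrow> x \<in> univ N s"
proof
  assume "\<sigma> x \<in> univ N s"
  then have "\<sigma> x \<in> \<sigma> ` univ N s" using assms(1,2) by (simp add: automorphism_def)
  then obtain y where y: "y \<in> univ N s" "\<sigma> y = \<sigma> x" by (metis image_iff)
  then have "y \<in> carrier L N" using assms(2) by (auto simp: carrier_def)
  then have "y = x"
    using y assms(1,3) by (auto simp: automorphism_def bij_betw_def dest: inj_onD)
  then show "x \<in> univ N s" using y by simp
qed (use assms in \<open>auto simp: automorphism_def\<close>)

lemma elem_rel_automorphism:
  assumes "is_struct L N" "fcod_sorted L" "automorphism L N \<sigma>"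
    "\<And>x y. (x, y) \<in> H \<Longrightarrow> x \<in> carrier L N \<and> y = \<sigma> x"
  shows "elem_rel L N H"
  unfolding elem_rel_def
proof (intro conjI allI impI)
  fix \<phi> w w'
  assume wf: "wf_fm L \<phi>" and
    h: "\<forall>(s, n)\<in>fv \<phi>. (w (s, n), w' (s, n)) \<in> H \<and> w (s, n) \<in> univ N s"
  have "sat N (\<lambda>x. \<sigma> (w x)) \<phi> \<longleftrightarrow> sat N w \<phi>"
    by (rule automorphism_sat[OF assms(1-3) wf]) (use h in auto)
  moreover have "sat N w' \<phi> \<longleftrightarrow> sat N (\<lambda>x. \<sigma> (w x)) \<phi>"
    by (rule sat_cong) (use h assms(4) in fastforce)
  ultimately show "sat N w \<phi> \<longleftrightarrow> sat N w' \<phi>" by simp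
next
  show "\<forall>(x, y)\<in>H. \<forall>s\<in>sorts L. x \<in> univ N s \<longleftrightarrow> y \<in> univ N s"
    using assms(4) automorphism_univ[OF assms(3)] by blast
qed

lemma finite_subset_chain:
  assumes "subset.chain \<A> c" "finite F" "F \<subseteq> \<Union>c" "F \<noteq> {}"
  shows "\<exists>X\<in>c. F \<subseteq> X"
  using assms(2-4)
proof (induction F rule: finite_induct)
  case (insert x F)
  show ?case
  proof (cases "F = {}")
    case False
    then obtain X where X: "X \<in> c" "F \<subseteq> X" using insert by auto
    obtain Y where Y: "Y \<in> c" "x \<in> Y" using insert by auto
    have "X \<subseteq> Y \<or> Y \<subseteq> X"
      using assms(1) X(1) Y(1) unfolding subset.chain_def by blast
    then show ?thesis
    proof
      assume "X \<subseteq> Y"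
      then show ?thesis using X Y by (intro bexI[of _ Y]) auto
    next
      assume "Y \<subseteq> X"
      then show ?thesis using X Y by (intro bexI[of _ X]) auto
    qed
  qed (use insert in auto)
qed simp

lemma elem_rel_Union_chain:
  assumes "subset.chain \<A> c" "c \<noteq> {}" "\<And>H. H \<in> c \<Longrightarrow> elem_rel L N H"
  shows "elem_rel L N (\<Union>c)"
  unfolding elem_rel_def
proof (intro conjI allI impI)
  fix \<phi> w w'
  assume wf: "wf_fm L \<phi>" and
    h: "\<forall>(s, n)\<in>fv \<phi>. (w (s, n), w' (s, n)) \<in> \<Union>c \<and> w (s, n) \<in> univ N s"
  have "\<exists>X\<in>c. (\<lambda>x. (w x, w' x)) ` fv \<phi> \<subseteq> X"
  proof (cases "fv \<phi> = {}")
    case False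
    then show ?thesis
      by (intro finite_subset_chain[OF assms(1)]) (use h finite_fv in auto)
  qed (use assms(2) in auto)
  then obtain X where X: "X \<in> c" "(\<lambda>x. (w x, w' x)) ` fv \<phi> \<subseteq> X" by auto
  show "sat N w \<phi> \<longleftrightarrow> sat N w' \<phi>"
    by (rule elem_rel_sat[OF assms(3)[OF X(1)] wf]) (use X(2) h in auto)
next
  show "\<forall>(x, y)\<in>\<Union>c. \<forall>s\<in>sorts L. x \<in> univ N s \<longleftrightarrow> y \<in> univ N s"
    using assms(3) by (force dest: elem_rel_sort)
qed

section \<open>Renaming variables and substituting parameters\<close>

text \<open>
  Renaming of variables inside each sort: \<open>e\<close> acts on the free variables and \<open>K\<close> on the bound
  ones. The values of \<open>e\<close> outside the range of \<open>K\<close> are never captured and may coincide, so that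
  several free variables can be identified with each other.
\<close>

fun rn_tm :: "('s \<times> nat \<Rightarrow> nat) \<Rightarrow> ('s, 'f) tm \<Rightarrow> ('s, 'f) tm" where
  "rn_tm e (Var s n) = Var s (e (s, n))"
| "rn_tm e (Fn f ts) = Fn f (map (rn_tm e) ts)"

fun rn :: "(nat \<Rightarrow> nat) \<Rightarrow> ('s \<times> nat \<Rightarrow> nat) \<Rightarrow> ('s, 'f, 'r) fm \<Rightarrow> ('s, 'f, 'r) fm" where
  "rn K e (Eq t u) = Eq (rn_tm e t) (rn_tm e u)"
| "rn K e (Rel r ts) = Rel r (map (rn_tm e) ts)"
| "rn K e (Neg \<phi>) = Neg (rn K e \<phi>)"
| "rn K e (Conj \<phi> \<psi>) = Conj (rn K e \<phi>) (rn K e \<psi>)"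
| "rn K e (Ex s n \<phi>) = Ex s (K n) (rn K (e((s, n) := K n)) \<phi>)"

lemma tm_val_rn: "tm_val N u (rn_tm e t) = tm_val N (\<lambda>(s, n). u (s, e (s, n))) t"
proof (induction t)
  case (Fn f ts)
  then have "map (tm_val N u \<circ> rn_tm e) ts = map (tm_val N (\<lambda>(s, n). u (s, e (s, n)))) ts" by auto
  then show ?case by (simp only: tm_val.simps rn_tm.simps map_map)
qed simp

lemma sat_rn:
  assumes "inj K"
  shows "(\<And>s n. e (s, n) = K n \<or> e (s, n) \<notin> range K) \<Longrightarrow>
    sat N u (rn K e \<phi>) \<longleftrightarrow> sat N (\<lambda>(s, n). u (s, e (s, n))) \<phi>"
proof (induction \<phi> arbitrary: u e)
  case (Rel r ts)
  have "map (tm_val N u \<circ> rn_tm e) ts = map (tm_val N (\<lambda>(s, n). u (s, e (s, n)))) ts"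
    by (auto simp: tm_val_rn)
  then show ?case by (simp only: sat.simps rn.simps map_map)
next
  case (Ex s n \<phi>)
  have "sat N (u((s, K n) := x)) (rn K (e((s, n) := K n)) \<phi>) \<longleftrightarrow>
      sat N ((\<lambda>(s, n). u (s, e (s, n)))((s, n) := x)) \<phi>" for x
  proof -
    have "(\<lambda>(s', n'). (u((s, K n) := x)) (s', (e((s, n) := K n)) (s', n'))) =
       (\<lambda>(s, n). u (s, e (s, n)))((s, n) := x)"
    proof (rule ext, clarify)
      fix s' n'
      have "n' \<noteq> n \<Longrightarrow> e (s', n') \<noteq> K n"
        using Ex.prems[of s' n'] injD[OF assms, of n' n] by auto
      then show "(u((s, K n) := x)) (s', (e((s, n) := K n)) (s', n')) =
        ((\<lambda>(s, n). u (s, e (s, n)))((s, n) := x)) (s', n')" by auto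
    qed
    moreover have "sat N (u((s, K n) := x)) (rn K (e((s, n) := K n)) \<phi>) \<longleftrightarrow>
      sat N (\<lambda>(s', n'). (u((s, K n) := x)) (s', (e((s, n) := K n)) (s', n'))) \<phi>"
      by (rule Ex.IH) (use Ex.prems in auto)
    ultimately show ?thesis by (simp only:)
  qed
  then show ?case by simp
next
  case (Neg \<phi>)
  show ?case using Neg.IH[OF Neg.prems] by simp
next
  case (Conj \<phi> \<psi>)
  show ?case using Conj.IH(1)[OF Conj.prems] Conj.IH(2)[OF Conj.prems] by simp
qed (simp add: tm_val_rn)

lemma sort_of_rn: "sort_of L (rn_tm e t) = sort_of L t"
  by (cases t) auto

lemma wf_rn_tm: "wf_tm L (rn_tm e t) \<longleftrightarrow> wf_tm L t"
proof (induction t)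
  case (Fn f ts)
  moreover have "map (sort_of L \<circ> rn_tm e) ts = map (sort_of L) ts" by (auto simp: sort_of_rn)
  ultimately show ?case by (simp add: sort_of_rn cong: map_cong)
qed auto

lemma wf_rn: "wf_fm L (rn K e \<phi>) \<longleftrightarrow> wf_fm L \<phi>"
proof (induction \<phi> arbitrary: e)
  case (Rel r ts)
  have "map (sort_of L \<circ> rn_tm e) ts = map (sort_of L) ts" by (auto simp: sort_of_rn)
  then show ?case by (simp add: wf_rn_tm sort_of_rn cong: map_cong)
qed (auto simp: wf_rn_tm sort_of_rn)

lemma fv_rn_tm: "fv_tm (rn_tm e t) = (\<lambda>(s, n). (s, e (s, n))) ` fv_tm t"
  by (induction t) auto

lemma fv_rn: "fv (rn K e \<phi>) \<subseteq> (\<lambda>(s, n). (s, e (s, n))) ` fv \<phi>"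
proof (induction \<phi> arbitrary: e)
  case (Ex s n \<phi>)
  show ?case
  proof
    fix x assume x: "x \<in> fv (rn K e (Ex s n \<phi>))"
    then have "x \<in> (\<lambda>(s', m). (s', (e((s, n) := K n)) (s', m))) ` fv \<phi>" "x \<noteq> (s, K n)"
      using subsetD[OF Ex.IH[of "e((s, n) := K n)"], of x]
      by (simp_all only: rn.simps fv.simps Diff_iff singleton_iff) blast+
    then obtain s' m where *: "(s', m) \<in> fv \<phi>" "x = (s', (e((s, n) := K n)) (s', m))" by auto
    have "(s', m) \<noteq> (s, n)" using * \<open>x \<noteq> (s, K n)\<close> by auto
    then have "(s', m) \<in> fv (Ex s n \<phi>)" "x = (\<lambda>(s, n). (s, e (s, n))) (s', m)" using * by auto
    then show "x \<in> (\<lambda>(s, n). (s, e (s, n))) ` fv (Ex s n \<phi>)" by (rule rev_image_eqI)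
  qed
next
  case (Conj \<phi> \<psi>)
  show ?case using Conj.IH(1)[of e] Conj.IH(2)[of e] by (simp add: image_Un) blast
qed (auto simp: fv_rn_tm)

text \<open>
  Substitution of parameters, or of the variable \<open>0\<close>, for the free variables of a formula of a one-sorted language.
  Bound variables are shifted by one to keep the variable \<open>0\<close> from being captured.
\<close>

fun psub_tm :: "(nat \<Rightarrow> (unit, 'f + 'a) tm) \<Rightarrow> (unit, 'f) tm \<Rightarrow> (unit, 'f + 'a) tm" where
  "psub_tm e (Var s n) = e n"
| "psub_tm e (Fn f ts) = Fn (Inl f) (map (psub_tm e) ts)"

fun psub :: "(nat \<Rightarrow> (unit, 'f + 'a) tm) \<Rightarrow> (unit, 'f, 'r) fm \<Rightarrow> (unit, 'f + 'a, 'r) fm" where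
  "psub e (Eq t u) = Eq (psub_tm e t) (psub_tm e u)"
| "psub e (Rel r ts) = Rel r (map (psub_tm e) ts)"
| "psub e (Neg \<phi>) = Neg (psub e \<phi>)"
| "psub e (Conj \<phi> \<psi>) = Conj (psub e \<phi>) (psub e \<psi>)"
| "psub e (Ex s n \<phi>) = Ex s (Suc n) (psub (e(n := Var () (Suc n))) \<phi>)"

lemma tm_val_psub:
  "tm_val (param_struct N) u (psub_tm e t) = tm_val N (\<lambda>(_, n). tm_val (param_struct N) u (e n)) t"
proof (induction t)
  case (Fn f ts)
  then have "map (tm_val (param_struct N) u \<circ> psub_tm e) ts =
    map (tm_val N (\<lambda>(_, n). tm_val (param_struct N) u (e n))) ts" by auto
  moreover have "fint (param_struct N) (Inl f) = fint N f" by (simp add: param_struct_def)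
  ultimately show ?case by (simp only: tm_val.simps psub_tm.simps map_map)
qed simp

lemma sat_psub:
  "(\<And>n. e n \<in> {Var () 0, Var () (Suc n)} \<union> (\<lambda>c. Fn (Inr c) []) ` UNIV) \<Longrightarrow>
    sat (param_struct N) u (psub e \<phi>) \<longleftrightarrow> sat N (\<lambda>(_, n). tm_val (param_struct N) u (e n)) \<phi>"
proof (induction \<phi> arbitrary: u e)
  case (Rel r ts)
  have "map (tm_val (param_struct N) u \<circ> psub_tm e) ts =
    map (tm_val N (\<lambda>(_, n). tm_val (param_struct N) u (e n))) ts"
    by (auto simp: tm_val_psub)
  moreover have "rint (param_struct N) r = rint N r" by (simp add: param_struct_def)
  ultimately show ?case by (simp only: sat.simps psub.simps map_map)
next
  case (Ex s n \<phi>)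
  have "sat (param_struct N) (u((s, Suc n) := x)) (psub (e(n := Var () (Suc n))) \<phi>) \<longleftrightarrow>
      sat N ((\<lambda>(_, n). tm_val (param_struct N) u (e n))((s, n) := x)) \<phi>" for x
  proof -
    have "(\<lambda>(_ :: unit, m). tm_val (param_struct N) (u((s, Suc n) := x)) ((e(n := Var () (Suc n))) m)) =
       (\<lambda>(_, n). tm_val (param_struct N) u (e n))((s, n) := x)"
    proof
      fix p :: "unit \<times> nat"
      obtain m where "p = ((), m)" by (cases p) auto
      then show "(\<lambda>(_ :: unit, m). tm_val (param_struct N) (u((s, Suc n) := x)) ((e(n := Var () (Suc n))) m)) p =
        ((\<lambda>(_, n). tm_val (param_struct N) u (e n))((s, n) := x)) p"
        using Ex.prems[of m] by auto
    qed
    moreover have inv: "(e(n := Var () (Suc n))) m \<in> {Var () 0, Var () (Suc m)} \<union> (\<lambda>c. Fn (Inr c) []) ` UNIV" for m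
      using Ex.prems[of m] by (cases "m = n") auto
    moreover have "sat (param_struct N) (u((s, Suc n) := x)) (psub (e(n := Var () (Suc n))) \<phi>) \<longleftrightarrow>
      sat N (\<lambda>(_, m). tm_val (param_struct N) (u((s, Suc n) := x)) ((e(n := Var () (Suc n))) m)) \<phi>"
      by (rule Ex.IH) (rule inv)
    ultimately show ?thesis by (simp only:)
  qed
  then show ?case by (simp add: param_struct_def)
next
  case (Neg \<phi>)
  show ?case using Neg.IH[OF Neg.prems] by simp
next
  case (Conj \<phi> \<psi>)
  show ?case using Conj.IH(1)[OF Conj.prems] Conj.IH(2)[OF Conj.prems] by simp
qed (simp add: tm_val_psub)

lemma fv_psub_tm: "fv_tm (psub_tm e t) \<subseteq> (\<Union>(s, n)\<in>fv_tm t. fv_tm (e n))"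
  by (induction t) fastforce+

lemma fv_psub: "fv (psub e \<phi>) \<subseteq> (\<Union>(s, n)\<in>fv \<phi>. fv_tm (e n))"
proof (induction \<phi> arbitrary: e)
  case (Eq t u)
  then show ?case using fv_psub_tm[of e t] fv_psub_tm[of e u] by auto
next
  case (Rel r ts)
  then show ?case using fv_psub_tm[of e] by fastforce
next
  case (Conj \<phi> \<psi>)
  show ?case using Conj.IH(1)[of e] Conj.IH(2)[of e] by auto
next
  case (Ex s n \<phi>)
  show ?case
  proof
    fix x assume "x \<in> fv (psub e (Ex s n \<phi>))"
    then obtain s' m where *: "(s', m) \<in> fv \<phi>" "x \<in> fv_tm ((e(n := Var () (Suc n))) m)" "x \<noteq> (s, Suc n)"
      using subsetD[OF Ex.IH[of "e(n := Var () (Suc n))"], of x]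
      by (simp only: psub.simps fv.simps) blast
    then have "m \<noteq> n" by auto
    then show "x \<in> (\<Union>(s, n)\<in>fv (Ex s n \<phi>). fv_tm (e n))" using * by auto
  qed
qed auto

lemma sort_of_psub: "map (sort_of (param_lang L B)) (map (psub_tm e) ts) = map (sort_of L) ts"
  by auto

lemma wf_psub_tm:
  assumes "\<And>s n. (s, n) \<in> fv_tm t \<Longrightarrow> wf_tm (param_lang L B) (e n)"
  shows "wf_tm L t \<Longrightarrow> wf_tm (param_lang L B) (psub_tm e t)"
  using assms
proof (induction t)
  case (Fn f ts)
  have "Inl f \<in> fsyms (param_lang L B)" "fdom (param_lang L B) (Inl f) = fdom L f"
    using Fn.prems(1) by (auto simp: param_lang_def)
  moreover have "\<forall>t\<in>set ts. wf_tm (param_lang L B) (psub_tm e t)"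
    using Fn by auto
  ultimately show ?case
    using Fn.prems(1) sort_of_psub[of L B e ts] by (simp only: wf_tm.simps psub_tm.simps) auto
qed auto

lemma wf_psub:
  "wf_fm L \<phi> \<Longrightarrow> (\<And>s n. (s, n) \<in> fv \<phi> \<Longrightarrow> wf_tm (param_lang L B) (e n)) \<Longrightarrow>
    wf_fm (param_lang L B) (psub e \<phi>)"
proof (induction \<phi> arbitrary: e)
  case (Eq t u)
  then show ?case using wf_psub_tm[of t L B e] wf_psub_tm[of u L B e] by auto
next
  case (Rel r ts)
  have "\<forall>t\<in>set ts. wf_tm (param_lang L B) (psub_tm e t)"
    using Rel by (auto intro!: wf_psub_tm) blast
  moreover have "r \<in> rsyms (param_lang L B)" "rdom (param_lang L B) r = rdom L r"
    using Rel.prems(1) by (auto simp: param_lang_def)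
  ultimately show ?case
    using Rel.prems(1) sort_of_psub[of L B e ts] by (simp only: wf_fm.simps psub.simps) auto
next
  case (Ex s n \<phi>)
  have "wf_fm (param_lang L B) (psub (e(n := Var () (Suc n))) \<phi>)"
  proof (rule Ex.IH)
    show "wf_fm L \<phi>" using Ex.prems(1) by simp
    show "wf_tm (param_lang L B) ((e(n := Var () (Suc n))) m)" if "(s', m) \<in> fv \<phi>" for s' m
      using that Ex.prems by (cases "m = n") (auto simp: param_lang_def)
  qed
  then show ?case using Ex.prems(1) by (simp add: param_lang_def)
qed auto

section \<open>Complete one-types\<close>

text \<open>
  The complete type of \<open>c\<close> over \<open>B\<close>.
\<close>

definition tp ::
  "(unit, 'f, 'r) lang \<Rightarrow> (unit, 'f, 'r, 'a) struct \<Rightarrow> 'a set \<Rightarrow> 'a \<Rightarrow> (unit, 'f + 'a, 'r) fm set" where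
  "tp L N B c = {\<phi> \<in> forms1 L B. sat (param_struct N) (\<lambda>_. c) \<phi>}"

lemma realizes_tp: "c \<in> univ N () \<Longrightarrow> realizes N c (tp L N B c)"
  by (simp add: realizes_def tp_def)

lemma Neg_forms1: "Neg \<phi> \<in> forms1 L B \<longleftrightarrow> \<phi> \<in> forms1 L B"
  by (simp add: forms1_def)

lemma tp_S1:
  assumes "c \<in> univ N ()"
  shows "tp L N B c \<in> S1 L N B"
proof -
  have "\<exists>c. realizes N c p0" if "p0 \<subseteq> tp L N B c" for p0
    using realizes_tp[OF assms, of L B] that by (auto simp: realizes_def)
  then show ?thesis by (auto simp: S1_def tp_def Neg_forms1)
qed

lemma realizes_tp_iff:
  assumes "realizes N b (tp L N B c)" "\<phi> \<in> forms1 L B"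
  shows "sat (param_struct N) (\<lambda>_. b) \<phi> \<longleftrightarrow> sat (param_struct N) (\<lambda>_. c) \<phi>"
proof (cases "sat (param_struct N) (\<lambda>_. c) \<phi>")
  case True
  then show ?thesis using assms by (auto simp: realizes_def tp_def)
next
  case False
  then have "Neg \<phi> \<in> tp L N B c" using assms(2) by (simp add: tp_def Neg_forms1)
  then have "sat (param_struct N) (\<lambda>_. b) (Neg \<phi>)" using assms(1) by (auto simp: realizes_def)
  then show ?thesis using False by simp
qed

lemma elem_rel_realizes_tp:
  fixes L :: "(unit, 'f, 'r) lang" and N :: "(unit, 'f, 'r, 'a) struct"
  assumes L: "sorts L = {()}" and B: "B \<subseteq> univ N ()" and c: "c \<in> univ N ()"
    and b: "realizes N b (tp L N B c)"
  shows "elem_rel L N (insert (c, b) (Id_on B))"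
  unfolding elem_rel_def
proof (intro conjI allI impI)
  show "\<forall>(x, y)\<in>insert (c, b) (Id_on B). \<forall>s\<in>sorts L. x \<in> univ N s \<longleftrightarrow> y \<in> univ N s"
    using b c L by (auto simp: realizes_def)
next
  fix \<phi> w w'
  assume wf: "wf_fm L \<phi>" and
    h: "\<forall>(s, n)\<in>fv \<phi>. (w (s, n), w' (s, n)) \<in> insert (c, b) (Id_on B) \<and> w (s, n) \<in> univ N s"
  \<comment> \<open>Variables taking the value \<open>c\<close> become the type variable, the others become parameters.\<close>
  define e :: "nat \<Rightarrow> (unit, 'f + 'a) tm" where
    "e n = (if ((), n) \<in> fv \<phi> \<and> (w ((), n), w' ((), n)) \<noteq> (c, b) then Fn (Inr (w ((), n))) [] else Var () 0)" for n
  have e: "e n \<in> {Var () 0, Var () (Suc n)} \<union> (\<lambda>c. Fn (Inr c) []) ` UNIV" for n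
    by (auto simp: e_def)
  have wB: "w ((), n) \<in> B \<and> w' ((), n) = w ((), n)"
    if "((), n) \<in> fv \<phi>" "(w ((), n), w' ((), n)) \<noteq> (c, b)" for n
    using h that by (force simp: Id_on_def)
  have "wf_fm (param_lang L B) (psub e \<phi>)"
  proof (rule wf_psub[OF wf])
    show "wf_tm (param_lang L B) (e n)" if "(s, n) \<in> fv \<phi>" for s n
      using that wB L by (auto simp: e_def param_lang_def)
  qed
  moreover have "fv (psub e \<phi>) \<subseteq> {((), 0)}"
    using fv_psub[of e \<phi>] by (auto simp: e_def split: if_splits)
  ultimately have f: "psub e \<phi> \<in> forms1 L B" by (simp add: forms1_def)
  have "sat (param_struct N) (\<lambda>_. c) (psub e \<phi>) \<longleftrightarrow> sat N w \<phi>"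
    unfolding sat_psub[OF e]
    by (rule sat_cong) (auto simp: e_def param_struct_def)
  moreover have "sat (param_struct N) (\<lambda>_. b) (psub e \<phi>) \<longleftrightarrow> sat N w' \<phi>"
    unfolding sat_psub[OF e]
  proof (rule sat_cong)
    fix x assume x: "x \<in> fv \<phi>"
    obtain n where n: "x = ((), n)" by (cases x) auto
    show "(case x of (_, n) \<Rightarrow> tm_val (param_struct N) (\<lambda>_. b) (e n)) = w' x"
    proof (cases "(w x, w' x) = (c, b)")
      case False
      then show ?thesis using x n wB[of n] by (simp add: e_def param_struct_def)
    qed (use n in \<open>simp add: e_def\<close>)
  qed
  ultimately show "sat N w \<phi> \<longleftrightarrow> sat N w' \<phi>" using realizes_tp_iff[OF b f] by simp
qed

lemma finitely_satisfiable_extends_S1: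
  assumes sub: "\<Sigma> \<subseteq> forms1 L B"
    and fs: "\<And>p0. finite p0 \<Longrightarrow> p0 \<subseteq> \<Sigma> \<Longrightarrow> \<exists>c. realizes N c p0"
  shows "\<exists>p\<in>S1 L N B. \<Sigma> \<subseteq> p"
proof -
  define \<A> where "\<A> = {p. \<Sigma> \<subseteq> p \<and> p \<subseteq> forms1 L B \<and>
    (\<forall>p0. finite p0 \<and> p0 \<subseteq> p \<longrightarrow> (\<exists>c. realizes N c p0))}"
  have "\<exists>p\<in>\<A>. \<forall>X\<in>\<A>. p \<subseteq> X \<longrightarrow> X = p"
  proof (rule subset_Zorn_nonempty)
    have "\<Sigma> \<in> \<A>" using sub fs unfolding \<A>_def by blast
    then show "\<A> \<noteq> {}" by blast
    fix \<C> assume \<C>: "\<C> \<noteq> {}" "subset.chain \<A> \<C>"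
    have "\<exists>c. realizes N c p0" if p0: "finite p0" "p0 \<subseteq> \<Union>\<C>" for p0
    proof -
      obtain X where "X \<in> \<C>" "p0 \<subseteq> X"
        using finite_subset_chain[OF \<C>(2) p0] \<C>(1) by (cases "p0 = {}") blast+
      moreover have "\<C> \<subseteq> \<A>" using \<C>(2) by (auto simp: subset.chain_def)
      ultimately show ?thesis using p0(1) unfolding \<A>_def by blast
    qed
    moreover have "\<Sigma> \<subseteq> X \<and> X \<subseteq> forms1 L B" if "X \<in> \<C>" for X
      using \<C>(2) that by (auto simp: \<A>_def subset.chain_def)
    then have "\<Sigma> \<subseteq> \<Union>\<C>" "\<Union>\<C> \<subseteq> forms1 L B" using \<C>(1) by blast+
    ultimately show "\<Union>\<C> \<in> \<A>" unfolding \<A>_def by blast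
  qed
  then obtain p where p: "p \<in> \<A>" and max: "\<And>X. X \<in> \<A> \<Longrightarrow> p \<subseteq> X \<Longrightarrow> X = p" by blast
  have incons: "\<exists>p0. finite p0 \<and> p0 \<subseteq> p \<and> (\<forall>c. \<not> realizes N c (insert \<phi> p0))"
    if "\<phi> \<in> forms1 L B" "\<phi> \<notin> p" for \<phi>
  proof -
    have "insert \<phi> p \<notin> \<A>" using max[of "insert \<phi> p"] that(2) by blast
    moreover have "\<Sigma> \<subseteq> insert \<phi> p" "insert \<phi> p \<subseteq> forms1 L B"
      using p that(1) unfolding \<A>_def by blast+
    ultimately have "\<not> (\<forall>p0. finite p0 \<and> p0 \<subseteq> insert \<phi> p \<longrightarrow> (\<exists>c. realizes N c p0))"
      unfolding \<A>_def by simp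
    then obtain p1 where p1: "finite p1" "p1 \<subseteq> insert \<phi> p" "\<forall>c. \<not> realizes N c p1" by blast
    have "\<not> realizes N c (insert \<phi> (p1 - {\<phi>}))" for c
    proof
      assume "realizes N c (insert \<phi> (p1 - {\<phi>}))"
      then have "realizes N c p1" unfolding realizes_def by blast
      then show False using p1(3) by blast
    qed
    moreover have "finite (p1 - {\<phi>})" "p1 - {\<phi>} \<subseteq> p" using p1(1,2) by auto
    ultimately show ?thesis by blast
  qed
  have "\<phi> \<in> p \<or> Neg \<phi> \<in> p" if \<phi>: "\<phi> \<in> forms1 L B" for \<phi>
  proof (rule ccontr)
    assume "\<not> ?thesis"
    then have n: "\<phi> \<notin> p" "Neg \<phi> \<notin> p" by auto
    obtain p0 where 0: "finite p0" "p0 \<subseteq> p" "\<forall>c. \<not> realizes N c (insert \<phi> p0)"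
      using incons[OF \<phi> n(1)] by blast
    have "Neg \<phi> \<in> forms1 L B" using \<phi> by (simp add: Neg_forms1)
    then obtain p1 where 1: "finite p1" "p1 \<subseteq> p" "\<forall>c. \<not> realizes N c (insert (Neg \<phi>) p1)"
      using incons[OF _ n(2)] by blast
    note * = 0 1
    have "finite (p0 \<union> p1)" "p0 \<union> p1 \<subseteq> p" using * by auto
    then obtain c where "realizes N c (p0 \<union> p1)" using p unfolding \<A>_def by blast
    then have "realizes N c (insert \<phi> p0) \<or> realizes N c (insert (Neg \<phi>) p1)"
      unfolding realizes_def sat.simps ball_simps by blast
    then show False using *(3,6) by blast
  qed
  then have "p \<in> S1 L N B" using p unfolding S1_def \<A>_def by blast
  then show ?thesis using p unfolding \<A>_def by blast
qed

section \<open>Imaginaries\<close>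

text \<open>
  The number of coordinates of a representative of an element of a sort, the element represented
  by a tuple, and the action on imaginaries of a map of the home sort.
\<close>

fun arity :: "('f, 'r) eq_sort \<Rightarrow> nat" where
  "arity Home = 1"
| "arity (Quot n E) = n"

fun cls :: "(unit, 'f, 'r, 'a) struct \<Rightarrow> ('f, 'r) eq_sort \<Rightarrow> 'a list \<Rightarrow> ('f, 'r, 'a) eq_elem" where
  "cls N Home xs = Elt (hd xs)"
| "cls N (Quot n E) xs = Imag n E (def_rel N n E `` {xs})"

fun eq_map :: "('a \<Rightarrow> 'a) \<Rightarrow> ('f, 'r, 'a) eq_elem \<Rightarrow> ('f, 'r, 'a) eq_elem" where
  "eq_map \<sigma> (Elt x) = Elt (\<sigma> x)"
| "eq_map \<sigma> (Imag n E S) = Imag n E (map \<sigma> ` S)"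

lemma tuples_1: "tuples U (Suc 0) = (\<lambda>x. [x]) ` U"
  by (auto simp: tuples_def length_Suc_conv)

lemma eq_map_Elt_image: "eq_map \<sigma> ` Elt ` A = Elt ` \<sigma> ` A"
  by (auto simp: image_iff)

lemma subset_image_map: "set ys \<subseteq> f ` A \<Longrightarrow> \<exists>xs. set xs \<subseteq> A \<and> ys = map f xs"
proof (induction ys)
  case (Cons y ys)
  then obtain xs x where "set xs \<subseteq> A" "ys = map f xs" "x \<in> A" "y = f x" by auto
  then show ?case by (intro exI[of _ "x # xs"]) auto
qed simp

text \<open>
  A structure \<open>N\<close> for a one-sorted language; \<open>U\<close> is its universe, \<open>Le\<close> and \<open>Ne\<close> are the
  expansions by imaginaries, and \<open>Ue\<close> is the set of all elements of \<open>Ne\<close>.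
\<close>

locale one_sorted =
  fixes L :: "(unit, 'f, 'r) lang" and N :: "(unit, 'f, 'r, 'a) struct"
  assumes sorts_L: "sorts L = {()}" and is_struct_N: "is_struct L N"
begin

abbreviation U where "U \<equiv> univ N ()"
abbreviation Le where "Le \<equiv> eq_lang L N"
abbreviation Ne where "Ne \<equiv> eq_struct N"
abbreviation Ue where "Ue \<equiv> carrier Le Ne"

lemma carrier_L: "carrier L N = U"
  by (simp add: carrier_def sorts_L)

lemma U_nonempty: "U \<noteq> {}"
  using is_struct_N sorts_L by (simp add: is_struct_def)

lemma fcod_sorted_L: "fcod_sorted L"
  by (simp add: fcod_sorted_def sorts_L)

lemma fcod_sorted_Le: "fcod_sorted Le"
  by (auto simp: fcod_sorted_def eq_lang_def)

lemma Home_sort: "Home \<in> sorts Le"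
  by (simp add: eq_lang_def)

lemma Quot_sort: "Quot n E \<in> sorts Le \<longleftrightarrow> eq_formula L N n E"
  by (simp add: eq_lang_def)

lemma equiv_def_rel: "eq_formula L N n E \<Longrightarrow> equiv (tuples U n) (def_rel N n E)"
  by (simp add: eq_formula_def)

lemma univ_Ne_Home: "univ Ne Home = Elt ` U"
  by (simp add: eq_struct_def)

lemma univ_Ne: "s \<in> sorts Le \<Longrightarrow> univ Ne s = cls N s ` tuples U (arity s)"
  by (cases s) (auto simp: eq_struct_def tuples_1 quotient_def image_image)

lemma eq_set_cls: "eq_set L N M = (\<Union>s\<in>sorts Le. cls N s ` tuples M (arity s))"
proof -
  have "(\<Union>s\<in>sorts Le. cls N s ` tuples M (arity s)) =
    cls N Home ` tuples M 1 \<union> (\<Union>s\<in>{Quot n E |n E. eq_formula L N n E}. cls N s ` tuples M (arity s))"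
    by (simp add: eq_lang_def)
  also have "cls N Home ` tuples M 1 = Elt ` M" by (simp add: tuples_1 image_image)
  also have "(\<Union>s\<in>{Quot n E |n E. eq_formula L N n E}. cls N s ` tuples M (arity s)) =
    {Imag n E (def_rel N n E `` {xs}) |n E xs. eq_formula L N n E \<and> xs \<in> tuples M n}"
    by (rule set_eqI) (auto simp: image_iff, force)
  finally show ?thesis by (simp add: eq_set_def)
qed

lemma carrier_Le: "Ue = eq_set L N U"
  by (simp add: carrier_def eq_set_cls univ_Ne)

lemma eq_set_mono: "A \<subseteq> B \<Longrightarrow> eq_set L N A \<subseteq> eq_set L N B"
  unfolding eq_set_cls by (intro UN_mono image_mono order_refl) (auto simp: tuples_def)

lemma Elt_in_eq_set: "Elt x \<in> eq_set L N A \<longleftrightarrow> x \<in> A"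
  by (auto simp: eq_set_def)

lemma Elt_Ue: "Elt x \<in> Ue \<longleftrightarrow> x \<in> U"
  by (simp add: carrier_Le Elt_in_eq_set)

text \<open>Representatives \<open>xs\<close> and \<open>ys\<close> of the same element of the sort \<open>s\<close>.\<close>

definition eqv :: "('f, 'r) eq_sort \<Rightarrow> 'a list \<Rightarrow> 'a list \<Rightarrow> bool" where
  "eqv s xs ys \<longleftrightarrow> (case s of Home \<Rightarrow> hd xs = hd ys | Quot n E \<Rightarrow> (xs, ys) \<in> def_rel N n E)"

lemma cls_eq_iff:
  assumes "s \<in> sorts Le" "xs \<in> tuples U (arity s)" "ys \<in> tuples U (arity s')"
  shows "cls N s xs = cls N s' ys \<longleftrightarrow> s = s' \<and> eqv s xs ys"
proof (cases s)
  case Home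
  then show ?thesis by (cases s') (auto simp: eqv_def)
next
  case (Quot n E)
  then have E: "eq_formula L N n E" and xs: "xs \<in> tuples U n"
    using assms(1,2) by (simp_all add: Quot_sort)
  show ?thesis
  proof (cases "s = s'")
    case True
    then have "s' = Quot n E" using Quot by simp
    then have "ys \<in> tuples U n" using assms(3) by simp
    from eq_equiv_class_iff[OF equiv_def_rel[OF E] xs this] show ?thesis
      unfolding True[symmetric] Quot by (simp add: eqv_def)
  next
    case False
    then show ?thesis using Quot by (cases s') auto
  qed
qed

lemma sort_unique:
  assumes "x \<in> univ Ne s" "x \<in> univ Ne s'" "s \<in> sorts Le" "s' \<in> sorts Le"
  shows "s = s'"
proof -
  obtain xs where xs: "x = cls N s xs" "xs \<in> tuples U (arity s)"
    using assms(1) unfolding univ_Ne[OF assms(3)] by (rule imageE)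
  obtain ys where ys: "x = cls N s' ys" "ys \<in> tuples U (arity s')"
    using assms(2) unfolding univ_Ne[OF assms(4)] by (rule imageE)
  have "cls N s xs = cls N s' ys" using xs(1) ys(1) by (rule subst)
  then show ?thesis unfolding cls_eq_iff[OF assms(3) xs(2) ys(2)] ..
qed

lemma is_struct_Ne: "is_struct Le Ne"
proof -
  obtain u where u: "u \<in> U" using U_nonempty by auto
  have "univ Ne s \<noteq> {}" if "s \<in> sorts Le" for s
  proof -
    have "replicate (arity s) u \<in> tuples U (arity s)" using u by (auto simp: tuples_def)
    then show ?thesis using that by (auto simp: univ_Ne)
  qed
  moreover have "fint Ne f xs \<in> univ Ne (fcod Le f)"
    if f: "f \<in> fsyms Le" and xs: "list_all2 (\<lambda>x s. x \<in> univ Ne s) xs (fdom Le f)" for f xs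
  proof (cases f)
    case (Old g)
    then have "list_all2 (\<lambda>x s. x \<in> univ N s) (map un_elt xs) (fdom L g)"
      using xs by (force simp: eq_lang_def univ_Ne_Home list_all2_conv_all_nth)
    moreover have "g \<in> fsyms L" using f Old by (auto simp: eq_lang_def)
    ultimately have "fint N g (map un_elt xs) \<in> univ N (fcod L g)"
      using is_struct_N unfolding is_struct_def by blast
    then have "fint Ne f xs \<in> Elt ` U" using Old by (simp add: eq_struct_def)
    then show ?thesis using Old by (simp add: eq_lang_def univ_Ne_Home)
  next
    case (Proj n E)
    have E: "eq_formula L N n E" using f Proj by (auto simp: eq_lang_def)
    have "map un_elt xs \<in> tuples U n"
      using xs Proj by (force simp: eq_lang_def univ_Ne_Home list_all2_conv_all_nth tuples_def in_set_conv_nth)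
    then have "fint Ne f xs \<in> univ Ne (Quot n E)"
      using Proj E univ_Ne[of "Quot n E"] by (auto simp: Quot_sort eq_struct_def)
    then show ?thesis using Proj by (simp add: eq_lang_def)
  qed
  ultimately show ?thesis by (simp add: is_struct_def)
qed

subsection \<open>Automorphisms and imaginaries\<close>

lemma aut_bij: "automorphism L N \<sigma> \<Longrightarrow> bij_betw \<sigma> U U"
  by (simp add: automorphism_def carrier_L)

lemma aut_image_U: "automorphism L N \<sigma> \<Longrightarrow> \<sigma> ` U = U"
  using aut_bij by (simp add: bij_betw_def)

lemma aut_inj: "automorphism L N \<sigma> \<Longrightarrow> inj_on \<sigma> U"
  using aut_bij by (simp add: bij_betw_def)

lemma aut_U: "automorphism L N \<sigma> \<Longrightarrow> x \<in> U \<Longrightarrow> \<sigma> x \<in> U"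
  using aut_image_U by blast

lemma aut_tuples: "automorphism L N \<sigma> \<Longrightarrow> xs \<in> tuples U n \<Longrightarrow> map \<sigma> xs \<in> tuples U n"
  by (auto simp: tuples_def dest: aut_U)

lemma map_tuples: "map \<sigma> ` tuples A n = tuples (\<sigma> ` A) n"
proof
  show "tuples (\<sigma> ` A) n \<subseteq> map \<sigma> ` tuples A n"
  proof
    fix ys assume "ys \<in> tuples (\<sigma> ` A) n"
    then have ys: "set ys \<subseteq> \<sigma> ` A" "length ys = n" by (auto simp: tuples_def)
    then obtain xs where "set xs \<subseteq> A" "ys = map \<sigma> xs"
      using subset_image_map[OF ys(1)] by blast
    then show "ys \<in> map \<sigma> ` tuples A n" using ys by (auto simp: tuples_def)
  qed
  show "map \<sigma> ` tuples A n \<subseteq> tuples (\<sigma> ` A) n"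
    unfolding tuples_def by (simp add: image_subset_iff image_mono) blast
qed

lemma aut_def_rel:
  assumes "automorphism L N \<sigma>" "eq_formula L N n E" "xs \<in> tuples U n" "ys \<in> tuples U n"
  shows "(map \<sigma> xs, map \<sigma> ys) \<in> def_rel N n E \<longleftrightarrow> (xs, ys) \<in> def_rel N n E"
proof -
  define v :: "unit \<times> nat \<Rightarrow> 'a" where "v = (\<lambda>(_, i). (xs @ ys) ! i)"
  have len: "length xs = n" "length ys = n" using assms by (auto simp: tuples_def)
  have E: "wf_fm L E" "fv E \<subseteq> {()} \<times> {..<2 * n}" using assms(2) by (auto simp: eq_formula_def)
  have "sat N (\<lambda>x. \<sigma> (v x)) E \<longleftrightarrow> sat N v E"
  proof (rule automorphism_sat[OF is_struct_N fcod_sorted_L assms(1) E(1)])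
    fix s k assume "(s, k) \<in> fv E"
    then have "k < length (xs @ ys)" using E(2) len by auto
    then have "(xs @ ys) ! k \<in> set (xs @ ys)" by (rule nth_mem)
    then show "v (s, k) \<in> univ N s" using assms(3,4) by (auto simp: v_def tuples_def)
  qed
  moreover have "sat N (\<lambda>(_, i). (map \<sigma> xs @ map \<sigma> ys) ! i) E \<longleftrightarrow> sat N (\<lambda>x. \<sigma> (v x)) E"
  proof (rule sat_cong)
    fix x assume "x \<in> fv E"
    then have "snd x < length (xs @ ys)" using E(2) len by auto
    then have "map \<sigma> (xs @ ys) ! snd x = \<sigma> ((xs @ ys) ! snd x)" by (rule nth_map)
    then show "(case x of (_, i) \<Rightarrow> (map \<sigma> xs @ map \<sigma> ys) ! i) = \<sigma> (v x)"
      by (simp add: v_def split_beta)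
  qed
  ultimately show ?thesis
    using assms(3,4) aut_tuples[OF assms(1)] by (simp add: def_rel_def v_def)
qed

lemma eq_map_cls:
  assumes \<sigma>: "automorphism L N \<sigma>" and s: "s \<in> sorts Le" and xs: "xs \<in> tuples U (arity s)"
  shows "eq_map \<sigma> (cls N s xs) = cls N s (map \<sigma> xs)"
proof (cases s)
  case Home
  then show ?thesis using xs by (auto simp: tuples_1)
next
  case (Quot n E)
  then have E: "eq_formula L N n E" and xs': "xs \<in> tuples U n" using s xs by (auto simp: Quot_sort)
  have sub: "def_rel N n E \<subseteq> tuples U n \<times> tuples U n" by (auto simp: def_rel_def)
  have "map \<sigma> ` (def_rel N n E `` {xs}) = def_rel N n E `` {map \<sigma> xs}"
  proof
    show "map \<sigma> ` (def_rel N n E `` {xs}) \<subseteq> def_rel N n E `` {map \<sigma> xs}"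
      using aut_def_rel[OF \<sigma> E xs'] sub by auto
    show "def_rel N n E `` {map \<sigma> xs} \<subseteq> map \<sigma> ` (def_rel N n E `` {xs})"
    proof
      fix ys assume ys: "ys \<in> def_rel N n E `` {map \<sigma> xs}"
      then have "ys \<in> map \<sigma> ` tuples U n"
        using sub by (auto simp: map_tuples aut_image_U[OF \<sigma>])
      then obtain zs where "zs \<in> tuples U n" "ys = map \<sigma> zs" by blast
      then show "ys \<in> map \<sigma> ` (def_rel N n E `` {xs})"
        using aut_def_rel[OF \<sigma> E xs'] ys by auto
    qed
  qed
  then show ?thesis using Quot by simp
qed

lemma eqv_map:
  assumes "automorphism L N \<sigma>" "s \<in> sorts Le" "xs \<in> tuples U (arity s)" "ys \<in> tuples U (arity s)"
  shows "eqv s (map \<sigma> xs) (map \<sigma> ys) \<longleftrightarrow> eqv s xs ys"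
proof (cases s)
  case Home
  then show ?thesis using assms aut_inj[OF assms(1)]
    by (auto simp: eqv_def tuples_1 dest: inj_onD)
next
  case (Quot n E)
  then show ?thesis using assms aut_def_rel[OF assms(1)] by (simp add: eqv_def Quot_sort)
qed

lemma eq_map_eq_set:
  assumes "automorphism L N \<sigma>" "A \<subseteq> U"
  shows "eq_map \<sigma> ` eq_set L N A = eq_set L N (\<sigma> ` A)"
proof -
  have "eq_map \<sigma> ` cls N s ` tuples A (arity s) = cls N s ` tuples (\<sigma> ` A) (arity s)"
    if s: "s \<in> sorts Le" for s
  proof -
    have *: "xs \<in> tuples U n" if "xs \<in> tuples A n" for xs n
      using that assms(2) by (auto simp: tuples_def)
    have "eq_map \<sigma> ` cls N s ` tuples A (arity s) = cls N s ` map \<sigma> ` tuples A (arity s)"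
      unfolding image_image by (rule image_cong) (use eq_map_cls[OF assms(1) s *] in auto)
    then show ?thesis by (simp add: map_tuples)
  qed
  then show ?thesis unfolding eq_set_cls image_UN by (rule SUP_cong[OF refl])
qed

lemma eq_map_automorphism:
  assumes \<sigma>: "automorphism L N \<sigma>"
  shows "automorphism Le Ne (eq_map \<sigma>)"
  unfolding automorphism_def
proof (intro conjI ballI allI impI)
  have "inj_on (eq_map \<sigma>) Ue"
  proof (rule inj_onI)
    fix x y assume "x \<in> Ue" "y \<in> Ue" and eq: "eq_map \<sigma> x = eq_map \<sigma> y"
    then obtain s xs t ys where *: "s \<in> sorts Le" "xs \<in> tuples U (arity s)" "x = cls N s xs"
      "t \<in> sorts Le" "ys \<in> tuples U (arity t)" "y = cls N t ys"
      by (auto simp: carrier_Le eq_set_cls)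
    then have "cls N s (map \<sigma> xs) = cls N t (map \<sigma> ys)" using eq by (simp add: eq_map_cls[OF \<sigma>])
    then have "s = t \<and> eqv s (map \<sigma> xs) (map \<sigma> ys)"
      using cls_eq_iff[of s "map \<sigma> xs" "map \<sigma> ys" t] * aut_tuples[OF \<sigma>] by blast
    then show "x = y" using * eqv_map[OF \<sigma>] cls_eq_iff by blast
  qed
  moreover have "eq_map \<sigma> ` Ue = Ue"
    using eq_map_eq_set[OF \<sigma> order_refl] aut_image_U[OF \<sigma>] by (simp add: carrier_Le)
  ultimately show "bij_betw (eq_map \<sigma>) Ue Ue" by (simp add: bij_betw_def)
next
  fix s assume s: "s \<in> sorts Le"
  have "eq_map \<sigma> ` cls N s ` tuples U (arity s) = cls N s ` map \<sigma> ` tuples U (arity s)"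
    unfolding image_image by (rule image_cong) (use eq_map_cls[OF \<sigma> s] in auto)
  then show "eq_map \<sigma> ` univ Ne s = univ Ne s"
    using s by (simp add: univ_Ne map_tuples aut_image_U[OF \<sigma>])
next
  fix f xs assume f: "f \<in> fsyms Le" and xs: "list_all2 (\<lambda>x s. x \<in> univ Ne s) xs (fdom Le f)"
  have "set xs \<subseteq> Elt ` U"
    using xs by (cases f) (auto simp: eq_lang_def univ_Ne_Home list_all2_conv_all_nth in_set_conv_nth)
  then obtain ys where ys: "set ys \<subseteq> U" "xs = map Elt ys" using subset_image_map by metis
  have m: "map un_elt (map (eq_map \<sigma>) xs) = map \<sigma> ys" "map un_elt xs = ys"
    using ys by (auto simp: comp_def)
  show "eq_map \<sigma> (fint Ne f xs) = fint Ne f (map (eq_map \<sigma>) xs)"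
  proof (cases f)
    case (Old g)
    then have "g \<in> fsyms L" "list_all2 (\<lambda>x s. x \<in> univ N s) ys (fdom L g)"
      using f xs ys(2) by (auto simp: eq_lang_def univ_Ne_Home list_all2_conv_all_nth)
    then have "\<sigma> (fint N g ys) = fint N g (map \<sigma> ys)"
      using \<sigma> unfolding automorphism_def by blast
    then have "eq_map \<sigma> (Elt (fint N g (map un_elt xs))) = Elt (fint N g (map un_elt (map (eq_map \<sigma>) xs)))"
      unfolding m by simp
    then show ?thesis using Old by (simp add: eq_struct_def)
  next
    case (Proj n E)
    have E: "Quot n E \<in> sorts Le" using f Proj by (auto simp: eq_lang_def)
    have "length xs = n" using xs Proj by (auto simp: eq_lang_def list_all2_conv_all_nth)
    then have "ys \<in> tuples U (arity (Quot n E))" using ys by (auto simp: tuples_def)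
    from eq_map_cls[OF \<sigma> E this]
    have "eq_map \<sigma> (cls N (Quot n E) (map un_elt xs)) = cls N (Quot n E) (map un_elt (map (eq_map \<sigma>) xs))"
      unfolding m .
    then show ?thesis using Proj by (simp add: eq_struct_def)
  qed
next
  fix r xs assume r: "r \<in> rsyms Le" and xs: "list_all2 (\<lambda>x s. x \<in> univ Ne s) xs (rdom Le r)"
  have "set xs \<subseteq> Elt ` U"
    using xs by (auto simp: eq_lang_def univ_Ne_Home list_all2_conv_all_nth in_set_conv_nth)
  then obtain ys where ys: "set ys \<subseteq> U" "xs = map Elt ys" using subset_image_map by metis
  have m: "map un_elt (map (eq_map \<sigma>) xs) = map \<sigma> ys" "map un_elt xs = ys"
    using ys by (auto simp: comp_def)
  have "r \<in> rsyms L" "list_all2 (\<lambda>x s. x \<in> univ N s) ys (rdom L r)"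
    using r xs ys(2) by (auto simp: eq_lang_def univ_Ne_Home list_all2_conv_all_nth)
  then have "rint N r (map \<sigma> ys) \<longleftrightarrow> rint N r ys"
    using \<sigma> unfolding automorphism_def by blast
  then have "rint N r (map un_elt (map (eq_map \<sigma>) xs)) \<longleftrightarrow> rint N r (map un_elt xs)"
    unfolding m .
  then show "rint Ne r (map (eq_map \<sigma>) xs) \<longleftrightarrow> rint Ne r xs" by (simp add: eq_struct_def)
qed

lemma elem_rel_eq_map:
  assumes "automorphism L N \<sigma>" "\<And>x y. (x, y) \<in> H \<Longrightarrow> x \<in> Ue \<and> y = eq_map \<sigma> x"
  shows "elem_rel Le Ne H"
  by (rule elem_rel_automorphism[OF is_struct_Ne fcod_sorted_Le eq_map_automorphism[OF assms(1)]])
    (use assms(2) in auto)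

end

subsection \<open>Formulas with imaginary variables\<close>

text \<open>Formulas of the language as formulas on the home sort.\<close>

fun emb_tm :: "(unit, 'f) tm \<Rightarrow> (('f, 'r) eq_sort, ('f, 'r) eq_fun) tm" where
  "emb_tm (Var s n) = Var Home n"
| "emb_tm (Fn f ts) = Fn (Old f) (map emb_tm ts)"

fun emb :: "(unit, 'f, 'r) fm \<Rightarrow> (('f, 'r) eq_sort, ('f, 'r) eq_fun, 'r) fm" where
  "emb (Eq t u) = Eq (emb_tm t) (emb_tm u)"
| "emb (Rel r ts) = Rel r (map emb_tm ts)"
| "emb (Neg \<phi>) = Neg (emb \<phi>)"
| "emb (Conj \<phi> \<psi>) = Conj (emb \<phi>) (emb \<psi>)"
| "emb (Ex s n \<phi>) = Ex Home n (emb \<phi>)"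

text \<open>
  Existential quantification over the \<open>n\<close> variables starting with \<open>m\<close>; substitution of the terms
  \<open>ts\<close> for the variables starting with \<open>m\<close>, which must not occur in \<open>ts\<close>; and the update of a
  valuation by a list of values for the variables starting with \<open>m\<close>.
\<close>

fun exs :: "nat \<Rightarrow> nat \<Rightarrow> (unit, 'f, 'r) fm \<Rightarrow> (unit, 'f, 'r) fm" where
  "exs m 0 \<psi> = \<psi>"
| "exs m (Suc n) \<psi> = Ex () m (exs (Suc m) n \<psi>)"

fun tsub :: "nat \<Rightarrow> (unit, 'f) tm list \<Rightarrow> (unit, 'f, 'r) fm \<Rightarrow> (unit, 'f, 'r) fm" where
  "tsub m [] \<psi> = \<psi>"
| "tsub m (t # ts) \<psi> = Ex () m (Conj (Eq (Var () m) t) (tsub (Suc m) ts \<psi>))"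

definition upd_block :: "(unit \<times> nat \<Rightarrow> 'a) \<Rightarrow> nat \<Rightarrow> 'a list \<Rightarrow> unit \<times> nat \<Rightarrow> 'a" where
  "upd_block v m xs = (\<lambda>(s, i). if m \<le> i \<and> i < m + length xs then xs ! (i - m) else v (s, i))"

lemma upd_block_Nil: "upd_block v m [] = v"
  by (auto simp: upd_block_def fun_eq_iff)

lemma upd_block_Cons: "upd_block (v(((), m) := x)) (Suc m) xs = upd_block v m (x # xs)"
  by (auto simp: upd_block_def fun_eq_iff nth_Cons')

lemma length_eq_of_map: "map f xs = ys \<Longrightarrow> length xs = length ys"
  by auto

context one_sorted
begin

lemma Le_simps:
  "fdom Le (Old f) = map (\<lambda>_. Home) (fdom L f)" "fdom Le (Proj n E) = replicate n Home"
  "fcod Le (Old f) = Home" "fcod Le (Proj n E) = Quot n E"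
  "Old f \<in> fsyms Le \<longleftrightarrow> f \<in> fsyms L" "Proj n E \<in> fsyms Le \<longleftrightarrow> eq_formula L N n E"
  "rsyms Le = rsyms L" "rdom Le r = map (\<lambda>_. Home) (rdom L r)"
  by (auto simp: eq_lang_def)

lemma tm_val_emb: "tm_val Ne (\<lambda>(s, n). Elt (v ((), n))) (emb_tm t) = Elt (tm_val N v t)"
proof (induction t)
  case (Fn f ts)
  then have "map un_elt (map (tm_val Ne (\<lambda>(s, n). Elt (v ((), n)))) (map emb_tm ts)) = map (tm_val N v) ts"
    by auto
  then have "fint Ne (Old f) (map (tm_val Ne (\<lambda>(s, n). Elt (v ((), n)))) (map emb_tm ts)) =
    Elt (fint N f (map (tm_val N v) ts))"
    unfolding eq_struct_def by (simp only: struct.simps eq_fun.case)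
  then show ?case by (simp only: emb_tm.simps tm_val.simps)
qed simp

lemma sat_emb: "sat Ne (\<lambda>(s, n). Elt (v ((), n))) (emb \<phi>) \<longleftrightarrow> sat N v \<phi>"
proof (induction \<phi> arbitrary: v)
  case (Rel r ts)
  have "map un_elt (map (tm_val Ne (\<lambda>(s, n). Elt (v ((), n)))) (map emb_tm ts)) = map (tm_val N v) ts"
    by (auto simp: tm_val_emb)
  then have "rint Ne r (map (tm_val Ne (\<lambda>(s, n). Elt (v ((), n)))) (map emb_tm ts)) =
    rint N r (map (tm_val N v) ts)"
    unfolding eq_struct_def by (simp only: struct.simps)
  then show ?case by (simp only: emb.simps sat.simps)
next
  case (Ex s n \<phi>)
  have "sat Ne ((\<lambda>(s, n). Elt (v ((), n)))((Home, n) := Elt x)) (emb \<phi>) \<longleftrightarrow> sat N (v((s, n) := x)) \<phi>" for x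
  proof -
    have "sat Ne ((\<lambda>(s, n). Elt (v ((), n)))((Home, n) := Elt x)) (emb \<phi>) \<longleftrightarrow>
      sat Ne (\<lambda>(s', k). Elt ((v((s, n) := x)) ((), k))) (emb \<phi>)"
    proof (rule sat_cong)
      have fvt: "fv_tm (emb_tm t) \<subseteq> {Home} \<times> UNIV" for t :: "(unit, 'f) tm"
        by (induction t) auto
      have "fv (emb \<phi>) \<subseteq> {Home} \<times> UNIV" for \<phi> :: "(unit, 'f, 'r) fm"
        by (induction \<phi>) (use fvt in fastforce)+
      then show "((\<lambda>(s, n). Elt (v ((), n)))((Home, n) := Elt x)) y =
        (case y of (s', k) \<Rightarrow> Elt ((v((s, n) := x)) ((), k)))" if y: "y \<in> fv (emb \<phi>)" for y
      proof -
        have "y \<in> {Home} \<times> UNIV" by (rule subsetD[OF _ y]) fact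
        then obtain k where "y = (Home, k)" by blast
        then show ?thesis by simp
      qed
    qed
    then show ?thesis using Ex.IH by (simp only:)
  qed
  then show ?case by (auto simp: univ_Ne_Home)
qed (simp_all add: tm_val_emb)

lemma fv_emb_tm: "fv_tm (emb_tm t) = (\<lambda>(s, n). (Home, n)) ` fv_tm t"
  by (induction t) auto

lemma fv_emb: "fv (emb \<phi>) = (\<lambda>(s, n). (Home, n)) ` fv \<phi>"
  by (induction \<phi>) (auto simp: fv_emb_tm)

lemma sort_of_emb: "sort_of Le (emb_tm t) = Home"
  by (cases t) (auto simp: Le_simps)

lemma wf_emb_tm: "wf_tm L t \<Longrightarrow> wf_tm Le (emb_tm t)"
proof (induction t)
  case (Fn f ts)
  have "map (sort_of Le) (map emb_tm ts) = map (\<lambda>_. Home) ts" by (simp add: sort_of_emb)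
  moreover have "length ts = length (fdom L f)"
    using Fn.prems by (intro length_eq_of_map[of "sort_of L"]) simp
  then have "map (\<lambda>_. Home) ts = map (\<lambda>_. Home) (fdom L f)" by (simp add: map_replicate_const)
  ultimately have "map (sort_of Le) (map emb_tm ts) = fdom Le (Old f)" by (simp only: Le_simps)
  moreover have "Old f \<in> fsyms Le" using Fn.prems by (simp add: Le_simps)
  moreover have "\<forall>t\<in>set (map emb_tm ts). wf_tm Le t" using Fn by auto
  ultimately show ?case by (simp only: emb_tm.simps wf_tm.simps)
qed (simp add: Home_sort)

lemma wf_emb: "wf_fm L \<phi> \<Longrightarrow> wf_fm Le (emb \<phi>)"
proof (induction \<phi>)
  case (Rel r ts)
  have "map (sort_of Le) (map emb_tm ts) = map (\<lambda>_. Home) ts" by (simp add: sort_of_emb)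
  moreover have "length ts = length (rdom L r)"
    using Rel.prems by (intro length_eq_of_map[of "sort_of L"]) simp
  then have "map (\<lambda>_. Home) ts = map (\<lambda>_. Home) (rdom L r)" by (simp add: map_replicate_const)
  ultimately have "map (sort_of Le) (map emb_tm ts) = rdom Le r" by (simp only: Le_simps)
  moreover have "r \<in> rsyms Le" using Rel.prems by (simp add: Le_simps)
  moreover have "\<forall>t\<in>set (map emb_tm ts). wf_tm Le t" using Rel wf_emb_tm by auto
  ultimately show ?case by (simp only: emb.simps wf_fm.simps)
qed (auto simp: wf_emb_tm sort_of_emb Home_sort)

lemma elem_rel_home:
  assumes "elem_rel Le Ne H"
  shows "elem_rel L N {(x, y). (Elt x, Elt y) \<in> H}"
  unfolding elem_rel_def
proof (intro conjI allI impI)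
  show "\<forall>(x, y)\<in>{(x, y). (Elt x, Elt y) \<in> H}. \<forall>s\<in>sorts L. x \<in> univ N s \<longleftrightarrow> y \<in> univ N s"
    using elem_rel_sort[OF assms _ Home_sort] by (auto simp: sorts_L univ_Ne_Home)
next
  fix \<phi> w w'
  assume wf: "wf_fm L \<phi>" and
    h: "\<forall>(s, n)\<in>fv \<phi>. (w (s, n), w' (s, n)) \<in> {(x, y). (Elt x, Elt y) \<in> H} \<and> w (s, n) \<in> univ N s"
  have "sat Ne (\<lambda>(s, n). Elt (w ((), n))) (emb \<phi>) \<longleftrightarrow> sat Ne (\<lambda>(s, n). Elt (w' ((), n))) (emb \<phi>)"
    by (rule elem_rel_sat[OF assms wf_emb[OF wf]]) (use h in \<open>auto simp: fv_emb univ_Ne_Home\<close>)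
  then show "sat N w \<phi> \<longleftrightarrow> sat N w' \<phi>" by (simp only: sat_emb)
qed

lemma wf_exs: "wf_fm L (exs m n \<psi>) \<longleftrightarrow> wf_fm L \<psi>"
  by (induction n arbitrary: m) (auto simp: sorts_L)

lemma wf_tsub: "wf_fm L \<psi> \<Longrightarrow> (\<And>t. t \<in> set ts \<Longrightarrow> wf_tm L t) \<Longrightarrow> wf_fm L (tsub m ts \<psi>)"
  by (induction m ts \<psi> rule: tsub.induct) (auto simp: sorts_L)

lemma sat_exs: "sat N v (exs m n \<psi>) \<longleftrightarrow> (\<exists>xs\<in>tuples U n. sat N (upd_block v m xs) \<psi>)"
proof (induction n arbitrary: m v)
  case (Suc n)
  have "tuples U (Suc n) = (\<lambda>(x, xs). x # xs) ` (U \<times> tuples U n)"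
    by (auto simp: tuples_def length_Suc_conv image_iff)
  moreover have "sat N v (exs m (Suc n) \<psi>) \<longleftrightarrow>
      (\<exists>x\<in>U. \<exists>xs\<in>tuples U n. sat N (upd_block v m (x # xs)) \<psi>)"
    by (simp only: exs.simps sat.simps Suc upd_block_Cons)
  ultimately show ?case by auto
qed (simp add: tuples_def upd_block_Nil)

lemma tm_val_L_U: "wf_tm L t \<Longrightarrow> (\<And>x. v x \<in> U) \<Longrightarrow> tm_val N v t \<in> U"
  using tm_val_univ[OF is_struct_N, of t v] by simp

lemma sat_tsub:
  assumes "\<And>t x. t \<in> set ts \<Longrightarrow> x \<in> fv_tm t \<Longrightarrow> snd x < m" "\<And>t. t \<in> set ts \<Longrightarrow> wf_tm L t" "\<And>x. v x \<in> U"
  shows "sat N v (tsub m ts \<psi>) \<longleftrightarrow> sat N (upd_block v m (map (tm_val N v) ts)) \<psi>"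
  using assms
proof (induction ts arbitrary: m v)
  case Nil
  then show ?case by (simp add: upd_block_Nil)
next
  case (Cons t ts)
  define y where "y = tm_val N v t"
  have y: "y \<in> U" using Cons.prems(2,3) by (simp add: y_def tm_val_L_U)
  have same: "tm_val N (v(((), m) := x)) u = tm_val N v u" if "u \<in> set (t # ts)" for u x
  proof (rule tm_val_cong)
    fix y assume "y \<in> fv_tm u"
    then have "snd y < m" by (rule Cons.prems(1)[OF that])
    then have "y \<noteq> ((), m)" by auto
    then show "(v(((), m) := x)) y = v y" by simp
  qed
  have "sat N (v(((), m) := y)) (tsub (Suc m) ts \<psi>) \<longleftrightarrow>
    sat N (upd_block (v(((), m) := y)) (Suc m) (map (tm_val N (v(((), m) := y))) ts)) \<psi>"
  proof (rule Cons.IH)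
    show "snd x < Suc m" if "u \<in> set ts" "x \<in> fv_tm u" for u x
      using Cons.prems(1)[of u x] that by simp
  qed (use Cons.prems(2,3) y in auto)
  also have "map (tm_val N (v(((), m) := y))) ts = map (tm_val N v) ts"
    using same by auto
  finally have *: "sat N (v(((), m) := y)) (tsub (Suc m) ts \<psi>) \<longleftrightarrow>
    sat N (upd_block v m (map (tm_val N v) (t # ts))) \<psi>"
    by (simp only: upd_block_Cons y_def list.map)
  have "sat N v (tsub m (t # ts) \<psi>) \<longleftrightarrow> (\<exists>x\<in>U. x = y \<and> sat N (v(((), m) := x)) (tsub (Suc m) ts \<psi>))"
    using same[of t] by (auto simp: y_def)
  then show ?case using y * by auto
qed

text \<open>
  Shifting the variables of \<open>\<psi>\<close> beyond those of \<open>ts\<close> avoids all captures.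
\<close>

lemma subst_terms:
  assumes "wf_fm L \<psi>" "fv \<psi> \<subseteq> {()} \<times> {..<length ts}" "\<And>t. t \<in> set ts \<Longrightarrow> wf_tm L t"
  shows "\<exists>\<chi>. wf_fm L \<chi> \<and> (\<forall>v. (\<forall>x. v x \<in> U) \<longrightarrow>
    (sat N v \<chi> \<longleftrightarrow> sat N (\<lambda>(_, i). map (tm_val N v) ts ! i) \<psi>))"
proof -
  have "finite (\<Union>t\<in>set ts. snd ` fv_tm t)" by (simp add: finite_fv_tm)
  then have "\<exists>m. \<forall>k\<in>(\<Union>t\<in>set ts. snd ` fv_tm t). k < m"
    by (simp only: finite_nat_set_iff_bounded)
  then obtain m where m: "\<And>k. k \<in> (\<Union>t\<in>set ts. snd ` fv_tm t) \<Longrightarrow> k < m" by blast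
  define K where "K n = n + m" for n :: nat
  define \<chi> where "\<chi> = tsub m ts (rn K (\<lambda>(_, n). K n) \<psi>)"
  have "wf_fm L \<chi>" unfolding \<chi>_def by (rule wf_tsub) (use assms in \<open>auto simp: wf_rn\<close>)
  moreover have "sat N v \<chi> \<longleftrightarrow> sat N (\<lambda>(_, i). map (tm_val N v) ts ! i) \<psi>" if v: "\<forall>x. v x \<in> U" for v
  proof -
    have "sat N v \<chi> \<longleftrightarrow> sat N (upd_block v m (map (tm_val N v) ts)) (rn K (\<lambda>(_, n). K n) \<psi>)"
      unfolding \<chi>_def
    proof (rule sat_tsub)
      show "snd x < m" if "t \<in> set ts" "x \<in> fv_tm t" for t x
        by (rule m) (use that in blast)
    qed (use v assms(3) in auto)
    also have "\<dots> \<longleftrightarrow> sat N (\<lambda>(s, n). upd_block v m (map (tm_val N v) ts) (s, (\<lambda>(_, n). K n) (s, n))) \<psi>"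
      by (rule sat_rn) (auto simp: K_def inj_def)
    also have "\<dots> \<longleftrightarrow> sat N (\<lambda>(_, i). map (tm_val N v) ts ! i) \<psi>"
    proof (rule sat_cong)
      fix x assume "x \<in> fv \<psi>"
      then have "snd x < length ts" using assms(2) by auto
      then show "(\<lambda>(s, n). upd_block v m (map (tm_val N v) ts) (s, (\<lambda>(_, n). K n) (s, n))) x =
        (\<lambda>(_, i). map (tm_val N v) ts ! i) x"
        by (simp add: upd_block_def K_def split_beta)
    qed
    finally show ?thesis .
  qed
  ultimately show ?thesis by blast
qed

text \<open>
  \<open>\<rho>\<close> assigns to an imaginary variable a list of home variables for its representative;
  \<open>represents \<rho> v w V\<close> says that on the variables in \<open>V\<close>, the values of \<open>w\<close> are the classes of those of \<open>v\<close>.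
\<close>

definition represents where
  "represents \<rho> v w V \<longleftrightarrow> (\<forall>x. v x \<in> U) \<and>
     (\<forall>x\<in>V. w x = cls N (fst x) (map (\<lambda>i. v ((), i)) (\<rho> x)))"

lemma represents_mono: "represents \<rho> v w V \<Longrightarrow> V' \<subseteq> V \<Longrightarrow> represents \<rho> v w V'"
  by (auto simp: represents_def)

lemma represents_U: "represents \<rho> v w V \<Longrightarrow> v x \<in> U"
  by (simp only: represents_def)

lemma translate_tm:
  assumes "wf_tm Le t" "\<And>x. x \<in> fv_tm t \<Longrightarrow> length (\<rho> x) = arity (fst x)"
  shows "\<exists>ts. length ts = arity (sort_of Le t) \<and> (\<forall>u\<in>set ts. wf_tm L u) \<and>
    (\<forall>v w. represents \<rho> v w (fv_tm t) \<longrightarrow>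
       tm_val Ne w t = cls N (sort_of Le t) (map (tm_val N v) ts))"
  using assms
proof (induction t)
  case (Var s n)
  then show ?case
    by (intro exI[of _ "map (Var ()) (\<rho> (s, n))"]) (auto simp: sorts_L represents_def comp_def)
next
  case (Fn f ts)
  have Hs: "sort_of Le t = Home" if "t \<in> set ts" for t
  proof -
    have "sort_of Le t \<in> set (fdom Le f)" using that Fn.prems(1) by (metis image_eqI list.set_map wf_tm.simps(2))
    then show ?thesis by (cases f) (auto simp: Le_simps split: if_splits)
  qed
  have "\<exists>u. wf_tm L u \<and> (\<forall>v w. represents \<rho> v w (fv_tm t) \<longrightarrow> tm_val Ne w t = Elt (tm_val N v u))"
    if t: "t \<in> set ts" for t
  proof -
    have "wf_tm Le t" "\<And>x. x \<in> fv_tm t \<Longrightarrow> length (\<rho> x) = arity (fst x)" using Fn.prems t by auto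
    from Fn.IH[OF t this] obtain us where us: "length us = 1" "\<forall>u\<in>set us. wf_tm L u"
      "\<And>v w. represents \<rho> v w (fv_tm t) \<Longrightarrow> tm_val Ne w t = Elt (hd (map (tm_val N v) us))"
      using Hs[OF t] by auto
    then obtain u where "us = [u]" by (auto simp: length_Suc_conv)
    then show ?thesis using us(2,3) by (intro exI[of _ u]) simp
  qed
  then obtain g where g: "\<And>t. t \<in> set ts \<Longrightarrow> wf_tm L (g t)"
    "\<And>t v w. t \<in> set ts \<Longrightarrow> represents \<rho> v w (fv_tm t) \<Longrightarrow> tm_val Ne w t = Elt (tm_val N v (g t))"
    by metis
  have vals: "map un_elt (map (tm_val Ne w) ts) = map (tm_val N v) (map g ts)"
    if "represents \<rho> v w (fv_tm (Fn f ts))" for v w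
  proof -
    have "tm_val Ne w t = Elt (tm_val N v (g t))" if "t \<in> set ts" for t
      using represents_mono[OF \<open>represents \<rho> v w (fv_tm (Fn f ts))\<close>, of "fv_tm t"] g(2)[OF that] that by auto
    then show ?thesis by auto
  qed
  show ?case
  proof (cases f)
    case (Old f0)
    have "wf_tm L (Fn f0 (map g ts))"
    proof -
      have "f0 \<in> fsyms L" using Fn.prems(1) Old by (auto simp: Le_simps)
      moreover have "length ts = length (fdom L f0)"
        using Fn.prems(1) Old length_eq_of_map[of "sort_of Le" ts "fdom Le f"] by (simp add: Le_simps)
      then have "map (sort_of L) (map g ts) = fdom L f0"
        by (simp add: list_eq_iff_nth_eq)
      moreover have "\<forall>t\<in>set (map g ts). wf_tm L t" using g(1) by auto
      ultimately show ?thesis by (simp only: wf_tm.simps)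
    qed
    moreover have "sort_of Le (Fn f ts) = Home" using Old by (simp add: Le_simps)
    moreover have "tm_val Ne w (Fn f ts) = Elt (tm_val N v (Fn f0 (map g ts)))"
      if "represents \<rho> v w (fv_tm (Fn f ts))" for v w
    proof -
      have "fint Ne (Old f0) xs = Elt (fint N f0 (map un_elt xs))" for xs by (simp add: eq_struct_def)
      then show ?thesis using vals[OF that] Old by (simp only: tm_val.simps)
    qed
    ultimately show ?thesis by (intro exI[of _ "[Fn f0 (map g ts)]"]) simp
  next
    case (Proj n E)
    have "sort_of Le (Fn f ts) = Quot n E" using Proj by (simp add: Le_simps)
    moreover have "length ts = n"
      using Fn.prems(1) Proj length_eq_of_map[of "sort_of Le" ts "fdom Le f"] by (simp add: Le_simps)
    moreover have "tm_val Ne w (Fn f ts) = cls N (Quot n E) (map (tm_val N v) (map g ts))"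
      if "represents \<rho> v w (fv_tm (Fn f ts))" for v w
    proof -
      have "fint Ne (Proj n E) xs = cls N (Quot n E) (map un_elt xs)" for xs by (simp add: eq_struct_def)
      then show ?thesis using vals[OF that] Proj by (simp only: tm_val.simps)
    qed
    ultimately show ?thesis using g(1) by (intro exI[of _ "map g ts"]) (simp del: cls.simps map_map)
  qed
qed

lemma cls_eq_definable:
  assumes "s \<in> sorts Le" "length ts = arity s" "length us = arity s"
    "\<And>t. t \<in> set ts \<union> set us \<Longrightarrow> wf_tm L t"
  shows "\<exists>\<chi>. wf_fm L \<chi> \<and> (\<forall>v. (\<forall>x. v x \<in> U) \<longrightarrow>
    (sat N v \<chi> \<longleftrightarrow> cls N s (map (tm_val N v) ts) = cls N s (map (tm_val N v) us)))"
proof -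
  have tup: "map (tm_val N v) ts \<in> tuples U (arity s)" "map (tm_val N v) us \<in> tuples U (arity s)"
    if "\<forall>x. v x \<in> U" for v
    using assms(2-4) tm_val_L_U that by (auto simp: tuples_def)
  show ?thesis
  proof (cases s)
    case Home
    then obtain t u where "ts = [t]" "us = [u]" using assms(2,3) by (auto simp: length_Suc_conv)
    then show ?thesis using Home assms(4) by (intro exI[of _ "Eq t u"]) auto
  next
    case (Quot n E)
    then have E: "wf_fm L E" "fv E \<subseteq> {()} \<times> {..<length (ts @ us)}"
      using assms(1-3) by (auto simp: Quot_sort eq_formula_def mult_2)
    obtain \<chi> where \<chi>: "wf_fm L \<chi>" "\<And>v. \<forall>x. v x \<in> U \<Longrightarrow>
      sat N v \<chi> \<longleftrightarrow> sat N (\<lambda>(_, i). map (tm_val N v) (ts @ us) ! i) E"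
      using subst_terms[OF E] assms(4) by auto
    have "sat N v \<chi> \<longleftrightarrow> cls N s (map (tm_val N v) ts) = cls N s (map (tm_val N v) us)"
      if v: "\<forall>x. v x \<in> U" for v
      using cls_eq_iff[OF assms(1) tup[OF v]] tup[OF v] \<chi>(2)[OF v] Quot
      by (simp add: eqv_def def_rel_def)
    then show ?thesis using \<chi>(1) by blast
  qed
qed

text \<open>
  A formula about imaginaries is equivalent to one about their representatives. The lists \<open>\<rho> x\<close>
  need not be disjoint; in the quantifier step, fresh variables are chosen for the representative
  of the quantified imaginary.
\<close>

lemma translate_fm:
  assumes "wf_fm Le \<phi>" "\<And>x. x \<in> fv \<phi> \<Longrightarrow> length (\<rho> x) = arity (fst x)"
  shows "\<exists>\<psi>. wf_fm L \<psi> \<and> (\<forall>v w. represents \<rho> v w (fv \<phi>) \<longrightarrow> (sat Ne w \<phi> \<longleftrightarrow> sat N v \<psi>))"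
  using assms
proof (induction \<phi> arbitrary: \<rho>)
  case (Eq t u)
  define s where "s = sort_of Le t"
  have wf: "wf_tm Le t" "wf_tm Le u" "sort_of Le u = s" using Eq.prems(1) by (auto simp: s_def)
  have s: "s \<in> sorts Le" using sort_of_sorts[OF fcod_sorted_Le wf(1)] by (simp add: s_def)
  obtain ts where ts: "length ts = arity s" "\<forall>u\<in>set ts. wf_tm L u"
    "\<And>v w. represents \<rho> v w (fv_tm t) \<Longrightarrow> tm_val Ne w t = cls N s (map (tm_val N v) ts)"
    using translate_tm[OF wf(1), of \<rho>] Eq.prems(2) by (auto simp: s_def)
  obtain us where us: "length us = arity s" "\<forall>u\<in>set us. wf_tm L u"
    "\<And>v w. represents \<rho> v w (fv_tm u) \<Longrightarrow> tm_val Ne w u = cls N s (map (tm_val N v) us)"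
    using translate_tm[OF wf(2), of \<rho>] Eq.prems(2) by (auto simp: wf(3))
  obtain \<chi> where \<chi>: "wf_fm L \<chi>" "\<And>v. \<forall>x. v x \<in> U \<Longrightarrow>
    sat N v \<chi> \<longleftrightarrow> cls N s (map (tm_val N v) ts) = cls N s (map (tm_val N v) us)"
    using cls_eq_definable[OF s ts(1) us(1)] ts(2) us(2) by auto
  have "sat Ne w (Eq t u) \<longleftrightarrow> sat N v \<chi>" if r: "represents \<rho> v w (fv (Eq t u))" for v w
    using ts(3)[OF represents_mono[OF r]] us(3)[OF represents_mono[OF r]] \<chi>(2)[of v] represents_U[OF r]
    by simp
  then show ?case using \<chi>(1) by blast
next
  case (Rel r ts)
  have Hs: "sort_of Le t = Home" if "t \<in> set ts" for t
  proof -
    have "sort_of Le t \<in> set (rdom Le r)" using that Rel.prems(1) by (metis image_eqI list.set_map wf_fm.simps(2))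
    then show ?thesis by (auto simp: Le_simps)
  qed
  have "\<exists>u. wf_tm L u \<and> (\<forall>v w. represents \<rho> v w (fv_tm t) \<longrightarrow> tm_val Ne w t = Elt (tm_val N v u))"
    if t: "t \<in> set ts" for t
  proof -
    have "wf_tm Le t" "\<And>x. x \<in> fv_tm t \<Longrightarrow> length (\<rho> x) = arity (fst x)" using Rel.prems t by auto
    from translate_tm[OF this] obtain us where us: "length us = 1" "\<forall>u\<in>set us. wf_tm L u"
      "\<And>v w. represents \<rho> v w (fv_tm t) \<Longrightarrow> tm_val Ne w t = Elt (hd (map (tm_val N v) us))"
      using Hs[OF t] by auto
    then obtain u where "us = [u]" by (auto simp: length_Suc_conv)
    then show ?thesis using us(2,3) by (intro exI[of _ u]) simp
  qed
  then obtain g where g: "\<And>t. t \<in> set ts \<Longrightarrow> wf_tm L (g t)"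
    "\<And>t v w. t \<in> set ts \<Longrightarrow> represents \<rho> v w (fv_tm t) \<Longrightarrow> tm_val Ne w t = Elt (tm_val N v (g t))"
    by metis
  have "wf_fm L (Rel r (map g ts))"
  proof -
    have "r \<in> rsyms L" using Rel.prems(1) by (auto simp: Le_simps)
    moreover have "length ts = length (rdom L r)"
      using Rel.prems(1) length_eq_of_map[of "sort_of Le" ts "rdom Le r"] by (simp add: Le_simps)
    then have "map (sort_of L) (map g ts) = rdom L r"
      by (simp add: list_eq_iff_nth_eq)
    moreover have "\<forall>t\<in>set (map g ts). wf_tm L t" using g(1) by auto
    ultimately show ?thesis by (simp only: wf_fm.simps)
  qed
  moreover have "sat Ne w (Rel r ts) \<longleftrightarrow> sat N v (Rel r (map g ts))"
    if h: "represents \<rho> v w (fv (Rel r ts))" for v w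
  proof -
    have "tm_val Ne w t = Elt (tm_val N v (g t))" if "t \<in> set ts" for t
      using represents_mono[OF h, of "fv_tm t"] g(2)[OF that] that by auto
    then have "map un_elt (map (tm_val Ne w) ts) = map (tm_val N v) (map g ts)" by auto
    moreover have "rint Ne r xs \<longleftrightarrow> rint N r (map un_elt xs)" for xs by (simp add: eq_struct_def)
    ultimately show ?thesis by (simp only: sat.simps)
  qed
  ultimately show ?case by blast
next
  case (Neg \<phi>)
  then obtain \<psi> where "wf_fm L \<psi>"
    "\<And>v w. represents \<rho> v w (fv \<phi>) \<Longrightarrow> sat Ne w \<phi> \<longleftrightarrow> sat N v \<psi>" by auto blast
  then show ?case by (intro exI[of _ "Neg \<psi>"]) simp
next
  case (Conj \<phi>1 \<phi>2)
  obtain \<psi>1 where 1: "wf_fm L \<psi>1" "\<And>v w. represents \<rho> v w (fv \<phi>1) \<Longrightarrow> sat Ne w \<phi>1 \<longleftrightarrow> sat N v \<psi>1"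
    using Conj.IH(1)[of \<rho>] Conj.prems by auto
  obtain \<psi>2 where 2: "wf_fm L \<psi>2" "\<And>v w. represents \<rho> v w (fv \<phi>2) \<Longrightarrow> sat Ne w \<phi>2 \<longleftrightarrow> sat N v \<psi>2"
    using Conj.IH(2)[of \<rho>] Conj.prems by auto
  have "sat Ne w (Conj \<phi>1 \<phi>2) \<longleftrightarrow> sat N v (Conj \<psi>1 \<psi>2)" if "represents \<rho> v w (fv (Conj \<phi>1 \<phi>2))" for v w
    using 1(2)[OF represents_mono[OF that]] 2(2)[OF represents_mono[OF that]] by simp
  then show ?case using 1(1) 2(1) by (intro exI[of _ "Conj \<psi>1 \<psi>2"]) simp
next
  case (Ex s k \<phi>)
  have s: "s \<in> sorts Le" using Ex.prems(1) by simp
  define n where "n = arity s"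
  have "finite (\<Union>x\<in>fv \<phi> - {(s, k)}. set (\<rho> x))" by (simp add: finite_fv)
  then have "\<exists>m. \<forall>i\<in>(\<Union>x\<in>fv \<phi> - {(s, k)}. set (\<rho> x)). i < m"
    by (simp only: finite_nat_set_iff_bounded)
  then obtain m where m: "\<And>i. i \<in> (\<Union>x\<in>fv \<phi> - {(s, k)}. set (\<rho> x)) \<Longrightarrow> i < m" by blast
  define \<rho>' where "\<rho>' = \<rho>((s, k) := [m..<m + n])"
  have "length (\<rho>' x) = arity (fst x)" if "x \<in> fv \<phi>" for x
    using Ex.prems(2)[of x] that by (auto simp: \<rho>'_def n_def)
  with Ex.IH[of \<rho>'] Ex.prems(1) obtain \<psi> where \<psi>: "wf_fm L \<psi>"
    "\<And>v w. represents \<rho>' v w (fv \<phi>) \<Longrightarrow> sat Ne w \<phi> \<longleftrightarrow> sat N v \<psi>" by auto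
  have "sat Ne w (Ex s k \<phi>) \<longleftrightarrow> sat N v (exs m n \<psi>)" if r: "represents \<rho> v w (fv (Ex s k \<phi>))" for v w
  proof -
    have "sat Ne (w((s, k) := cls N s xs)) \<phi> \<longleftrightarrow> sat N (upd_block v m xs) \<psi>" if xs: "xs \<in> tuples U n" for xs
    proof (rule \<psi>(2))
      have len: "length xs = n" "set xs \<subseteq> U" using xs by (auto simp: tuples_def)
      have "upd_block v m xs x \<in> U" for x
      proof (cases "m \<le> snd x \<and> snd x < m + length xs")
        case True
        then have "xs ! (snd x - m) \<in> set xs" by (intro nth_mem) auto
        then show ?thesis using True len by (auto simp: upd_block_def split_beta)
      qed (use represents_U[OF r] in \<open>auto simp: upd_block_def split_beta\<close>)
      moreover have "(w((s, k) := cls N s xs)) x = cls N (fst x) (map (\<lambda>i. upd_block v m xs ((), i)) (\<rho>' x))"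
        if x: "x \<in> fv \<phi>" for x
      proof (cases "x = (s, k)")
        case True
        have "map (\<lambda>i. upd_block v m xs ((), i)) [m..<m + n] = xs"
          using len by (auto simp: upd_block_def intro: nth_equalityI)
        then show ?thesis using True by (simp add: \<rho>'_def del: cls.simps)
      next
        case False
        then have "map (\<lambda>i. upd_block v m xs ((), i)) (\<rho> x) = map (\<lambda>i. v ((), i)) (\<rho> x)"
          using m x by (fastforce simp: upd_block_def)
        moreover have "w x = cls N (fst x) (map (\<lambda>i. v ((), i)) (\<rho> x))"
          using r False x by (auto simp: represents_def)
        ultimately show ?thesis using False by (simp only: \<rho>'_def fun_upd_apply if_False)
      qed
      ultimately show "represents \<rho>' (upd_block v m xs) (w((s, k) := cls N s xs)) (fv \<phi>)"
        unfolding represents_def by blast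
    qed
    then show ?thesis using s by (simp add: univ_Ne sat_exs n_def del: cls.simps)
  qed
  then show ?case using \<psi>(1) by (intro exI[of _ "exs m n \<psi>"]) (simp add: wf_exs)
qed

end

section \<open>Cardinalities\<close>

lemma card_UN_ordLess:
  assumes "Card_order r" "Cinfinite c" "c <o r" "|A| <o r" "\<And>x. x \<in> A \<Longrightarrow> |F x| \<le>o c"
  shows "|\<Union>x\<in>A. F x| <o r"
proof (cases "|A| \<le>o c")
  case True
  have "|\<Union>x\<in>A. F x| \<le>o c"
    by (rule card_of_UNION_ordLeq_infinite_Field[OF _ _ True])
      (use assms(2,5) in \<open>auto simp: cinfinite_def\<close>)
  then show ?thesis using assms(3) by (rule ordLeq_ordLess_trans)
next
  case False
  have "Well_order c" using assms(2) by (simp add: card_order_on_well_order_on)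
  then have cA: "c \<le>o |A|" using False card_of_Well_order[of A]
    by (metis ordLeq_total)
  then have "infinite A"
    using assms(2) cinfinite_mono[OF cA] by (simp add: cinfinite_def Field_card_of)
  moreover have "\<forall>x\<in>A. |F x| \<le>o |A|" using assms(5) cA ordLeq_transitive by blast
  ultimately have "|\<Union>x\<in>A. F x| \<le>o |A|"
    using card_of_UNION_ordLeq_infinite[of A A F] ordLeq_refl[OF card_of_Card_order] by blast
  then show ?thesis using assms(4) by (rule ordLeq_ordLess_trans)
qed

lemma card_UN_finite_ordLess:
  assumes "Card_order r" "natLeq <o r" "|A| <o r" "\<And>x. x \<in> A \<Longrightarrow> finite (F x)"
  shows "|\<Union>x\<in>A. F x| <o r"
proof (rule card_UN_ordLess[OF assms(1) natLeq_Cinfinite assms(2,3)])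
  show "|F x| \<le>o natLeq" if "x \<in> A" for x
    using assms(4)[OF that] finite_iff_ordLess_natLeq ordLess_imp_ordLeq by blast
qed

lemma card_Un_ordLess:
  assumes "Card_order r" "natLeq <o r" "|A| <o r" "|B| <o r"
  shows "|A \<union> B| <o r"
proof -
  have "infinite (Field r)"
    using assms(1,2) by (metis cinfinite_def cinfinite_mono natLeq_cinfinite ordLess_imp_ordLeq)
  then show ?thesis using card_of_Un_ordLess_infinite_Field[OF _ assms(1,3,4)] by simp
qed

lemma card_finite_ordLess: "natLeq <o r \<Longrightarrow> finite A \<Longrightarrow> |A| <o r"
  using finite_iff_ordLess_natLeq ordLess_transitive by blast

lemma card_subset_ordLess: "|B| <o r \<Longrightarrow> A \<subseteq> B \<Longrightarrow> |A| <o r"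
  using card_of_mono1 ordLeq_ordLess_trans by blast

lemma card_image_ordLess: "|A| <o r \<Longrightarrow> |f ` A| <o r"
  using card_of_image ordLeq_ordLess_trans by blast

lemma card_inj_on_ordLess: "|f ` A| <o r \<Longrightarrow> inj_on f A \<Longrightarrow> |A| <o r"
  using card_of_ordLeqI[of f A "f ` A"] ordLeq_ordLess_trans by blast

section \<open>Homogeneity for imaginaries\<close>

lemma elem_rel_functional:
  assumes H: "elem_rel L N H" and xy: "(x, y) \<in> H" "(x, z) \<in> H" and x: "x \<in> carrier L N"
  shows "y = z"
proof -
  obtain s where s: "s \<in> sorts L" "x \<in> univ N s" using x by (auto simp: carrier_def)
  have "sat N (\<lambda>_. x) (Eq (Var s 0) (Var s 1)) \<longleftrightarrow>
    sat N (\<lambda>(s, n). if n = 0 then y else z) (Eq (Var s 0) (Var s 1))"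
    by (rule elem_rel_sat[OF H]) (use s xy in auto)
  then show ?thesis by simp
qed

lemma Int_Collect_restrict:
  "A = {c \<in> D. P c} \<Longrightarrow> B = {c \<in> D. Q c} \<Longrightarrow> A \<inter> B = {c \<in> D. P c \<and> Q c}"
  by auto

context one_sorted
begin

text \<open>
  A set of elements of the home sort that is defined by a formula with imaginary parameters is
  definable over any set \<open>D\<close> containing representatives of the parameters. The variables in \<open>V\<close>
  all stand for the element.
\<close>

lemma definable_over:
  assumes \<phi>: "wf_fm Le \<phi>" and V: "V \<subseteq> {Home} \<times> UNIV" and D: "D \<subseteq> U"
    and w: "\<And>x. x \<in> fv \<phi> - V \<Longrightarrow> \<exists>xs\<in>tuples D (arity (fst x)). w x = cls N (fst x) xs"
  shows "\<exists>\<chi>\<in>forms1 L D. \<forall>c\<in>U. sat (param_struct N) (\<lambda>_. c) \<chi> \<longleftrightarrow>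
    sat Ne (\<lambda>x. if x \<in> V then Elt c else w x) \<phi>"
proof -
  have rex: "\<forall>x\<in>fv \<phi> - V. \<exists>xs. xs \<in> tuples D (arity (fst x)) \<and> w x = cls N (fst x) xs"
    using w by (auto simp del: cls.simps simp: Bex_def)
  obtain r where r': "\<forall>x\<in>fv \<phi> - V. r x \<in> tuples D (arity (fst x)) \<and> w x = cls N (fst x) (r x)"
    using bchoice[OF rex] ..
  have r: "r x \<in> tuples D (arity (fst x)) \<and> w x = cls N (fst x) (r x)" if "x \<in> fv \<phi> - V" for x
    using r' that by (rule bspec)
  have fin: "finite (\<Union>x\<in>fv \<phi> - V. set (r x))" by (simp add: finite_fv)
  obtain ds where ds: "set ds = (\<Union>x\<in>fv \<phi> - V. set (r x))" using finite_list[OF fin] ..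
  have dsD: "set ds \<subseteq> D"
    unfolding ds
  proof (rule UN_least)
    show "set (r x) \<subseteq> D" if "x \<in> fv \<phi> - V" for x using r[OF that] by (simp add: tuples_def)
  qed
  have "\<forall>a\<in>set ds. \<exists>i. i < length ds \<and> ds ! i = a" by (simp add: in_set_conv_nth)
  from bchoice[OF this] obtain idx where idx': "\<forall>a\<in>set ds. idx a < length ds \<and> ds ! idx a = a" ..
  have idx: "idx a < length ds \<and> ds ! idx a = a" if "a \<in> set ds" for a
    using idx' that by (rule bspec)
  \<comment> \<open>The variable \<open>0\<close> is the type variable and \<open>Suc i\<close> stands for the parameter \<open>ds ! i\<close>.\<close>
  define \<rho> where "\<rho> x = (if x \<in> V then [0] else map (\<lambda>a. Suc (idx a)) (r x))" for x
  define e :: "nat \<Rightarrow> (unit, 'f + 'a) tm" where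
    "e n = (if 0 < n \<and> n - 1 < length ds then Fn (Inr (ds ! (n - 1))) [] else Var () 0)" for n
  define v where "v c = (\<lambda>(_ :: unit, n). tm_val (param_struct N) (\<lambda>_. c) (e n))" for c
  have "length (\<rho> x) = arity (fst x)" if "x \<in> fv \<phi>" for x
  proof (cases "x \<in> V")
    case True
    then have "fst x = Home" using V by auto
    then show ?thesis using True by (simp add: \<rho>_def)
  next
    case False
    then show ?thesis using r[of x] that by (simp add: \<rho>_def tuples_def)
  qed
  from translate_fm[of \<phi> \<rho>, OF \<phi> this] obtain \<psi> where \<psi>: "wf_fm L \<psi>"
    "\<And>v w. represents \<rho> v w (fv \<phi>) \<Longrightarrow> sat Ne w \<phi> \<longleftrightarrow> sat N v \<psi>" by blast
  have e: "e n \<in> {Var () 0, Var () (Suc n)} \<union> (\<lambda>c. Fn (Inr c) []) ` UNIV" for n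
    by (auto simp: e_def)
  have ds_nth: "ds ! k \<in> D" if "k < length ds" for k
    using dsD nth_mem[OF that] by blast
  have "wf_tm (param_lang L D) (e n)" for n
    using ds_nth by (auto simp: e_def param_lang_def sorts_L)
  then have "wf_fm (param_lang L D) (psub e \<psi>)" using wf_psub[OF \<psi>(1)] by blast
  moreover have "fv (psub e \<psi>) \<subseteq> {((), 0)}"
    using fv_psub[of e \<psi>] by (auto simp: e_def split: if_splits)
  moreover have "sat (param_struct N) (\<lambda>_. c) (psub e \<psi>) \<longleftrightarrow>
    sat Ne (\<lambda>x. if x \<in> V then Elt c else w x) \<phi>" if c: "c \<in> U" for c
  proof -
    have "represents \<rho> (v c) (\<lambda>x. if x \<in> V then Elt c else w x) (fv \<phi>)"
      unfolding represents_def
    proof (intro conjI allI ballI)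
      fix x show "v c x \<in> U"
        using c subsetD[OF D ds_nth] by (auto simp: v_def e_def param_struct_def split_beta)
    next
      fix x assume x: "x \<in> fv \<phi>"
      show "(if x \<in> V then Elt c else w x) = cls N (fst x) (map (\<lambda>i. v c ((), i)) (\<rho> x))"
      proof (cases "x \<in> V")
        case True
        then have "fst x = Home" using V by auto
        then show ?thesis using True by (simp add: \<rho>_def v_def e_def)
      next
        case False
        have "v c ((), Suc (idx a)) = a" if "a \<in> set (r x)" for a
        proof -
          have "a \<in> set ds" using that x False ds by auto
          then show ?thesis using idx[of a] by (simp add: v_def e_def param_struct_def)
        qed
        then have "map (\<lambda>i. v c ((), i)) (\<rho> x) = r x"
          using False by (simp add: \<rho>_def map_idI)
        then show ?thesis using False r[of x] x by simp
      qed
    qed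
    then show ?thesis using \<psi>(2) sat_psub[OF e, of N "\<lambda>_. c" \<psi>] by (simp add: v_def)
  qed
  ultimately show ?thesis by (intro bexI[of _ "psub e \<psi>"]) (auto simp: forms1_def)
qed

text \<open>
  The set \<open>C\<close> is defined by the formula \<open>\<phi>\<close> with parameters given by \<open>w\<close>, the variables in \<open>V\<close>
  being identified; \<open>C\<close> and \<open>C'\<close> are twins if they are defined by the same formula with parameters
  from the domain of \<open>H\<close> and the corresponding ones from its range.
\<close>

definition carves where
  "carves C \<phi> V w \<longleftrightarrow> C = {c \<in> U. sat Ne (\<lambda>x. if x \<in> V then Elt c else w x) \<phi>}"

definition twins where
  "twins H C C' \<longleftrightarrow> (\<exists>\<phi> V w w'. wf_fm Le \<phi> \<and> V \<subseteq> {Home} \<times> UNIV \<and>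
     (\<forall>x\<in>fv \<phi> - V. (w x, w' x) \<in> H \<and> w x \<in> univ Ne (fst x)) \<and> carves C \<phi> V w \<and> carves C' \<phi> V w')"

lemma twinsI:
  assumes "wf_fm Le \<phi>" "V \<subseteq> {Home} \<times> UNIV"
    "\<And>x. x \<in> fv \<phi> - V \<Longrightarrow> (w x, w' x) \<in> H \<and> w x \<in> univ Ne (fst x)"
    "carves C \<phi> V w" "carves C' \<phi> V w'"
  shows "twins H C C'"
  unfolding twins_def
  by (rule exI[of _ \<phi>], rule exI[of _ V], rule exI[of _ w], rule exI[of _ w'])
    (intro conjI ballI assms)

lemma twinsE:
  assumes "twins H C C'"
  obtains \<phi> V w w' where "wf_fm Le \<phi>" "V \<subseteq> {Home} \<times> UNIV"
    "\<forall>x\<in>fv \<phi> - V. (w x, w' x) \<in> H \<and> w x \<in> univ Ne (fst x)"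
    "carves C \<phi> V w" "carves C' \<phi> V w'"
  using assms unfolding twins_def by (elim exE conjE) (rule that)

lemma carves_Int:
  assumes "carves A \<alpha> V w" "carves B \<beta> V w"
  shows "carves (A \<inter> B) (Conj \<alpha> \<beta>) V w"
  unfolding carves_def sat.simps
  by (rule Int_Collect_restrict[OF assms(1)[unfolded carves_def] assms(2)[unfolded carves_def]])

lemma carves_rn:
  assumes K: "inj K" "0 \<notin> range K" and V: "V \<subseteq> {Home} \<times> UNIV" and C: "carves C \<phi> V w"
    and u: "\<And>s n. (s, n) \<in> fv \<phi> - V \<Longrightarrow> u (s, K n) = w (s, n)"
  shows "carves C (rn K (\<lambda>(s, n). if (s, n) \<in> V then 0 else K n) \<phi>) {(Home, 0)} u"
proof -
  define e where "e = (\<lambda>(s, n). if (s, n) \<in> V then 0 else K n)"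
  have "sat Ne (\<lambda>x. if x \<in> {(Home, 0)} then Elt c else u x) (rn K e \<phi>) \<longleftrightarrow>
    sat Ne (\<lambda>x. if x \<in> V then Elt c else w x) \<phi>" for c
  proof -
    have "sat Ne (\<lambda>x. if x \<in> {(Home, 0)} then Elt c else u x) (rn K e \<phi>) \<longleftrightarrow>
      sat Ne (\<lambda>(s, n). if (s, e (s, n)) \<in> {(Home, 0)} then Elt c else u (s, e (s, n))) \<phi>"
      by (rule sat_rn[OF K(1)]) (use K(2) in \<open>auto simp: e_def\<close>)
    also have "\<dots> \<longleftrightarrow> sat Ne (\<lambda>x. if x \<in> V then Elt c else w x) \<phi>"
    proof (rule sat_cong)
      fix x assume x: "x \<in> fv \<phi>"
      obtain s n where sn: "x = (s, n)" by (cases x)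
      have "K n \<noteq> 0" using K(2) by (metis rangeI)
      then show "(case x of (s, n) \<Rightarrow> if (s, e (s, n)) \<in> {(Home, 0)} then Elt c else u (s, e (s, n))) =
        (if x \<in> V then Elt c else w x)"
        using V x sn u[of s n] by (auto simp: e_def)
    qed
    finally show ?thesis .
  qed
  then show ?thesis using C by (simp add: carves_def e_def)
qed

lemma fv_rn_collapse:
  "fv (rn K (\<lambda>(s, n). if (s, n) \<in> V then 0 else K n) \<phi>) - {(Home, 0)} \<subseteq>
     (\<lambda>(s, n). (s, K n)) ` (fv \<phi> - V)" if "V \<subseteq> {Home} \<times> UNIV"
proof
  fix x assume x: "x \<in> fv (rn K (\<lambda>(s, n). if (s, n) \<in> V then 0 else K n) \<phi>) - {(Home, 0)}"
  then obtain s n where sn: "(s, n) \<in> fv \<phi>" "x = (s, if (s, n) \<in> V then 0 else K n)"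
    using subsetD[OF fv_rn, of x K "\<lambda>(s, n). if (s, n) \<in> V then 0 else K n" \<phi>] by auto
  then have "(s, n) \<notin> V" using x that by auto
  then show "x \<in> (\<lambda>(s, n). (s, K n)) ` (fv \<phi> - V)" using sn by force
qed

lemma twins_nonempty:
  assumes H: "elem_rel Le Ne H" and t: "twins H C C'" and c: "c \<in> C"
  shows "C' \<noteq> {}"
proof -
  obtain \<phi> V w w' where \<phi>: "wf_fm Le \<phi>" and V: "V \<subseteq> {Home} \<times> UNIV"
    and ww: "\<And>x. x \<in> fv \<phi> - V \<Longrightarrow> (w x, w' x) \<in> H \<and> w x \<in> univ Ne (fst x)"
    and C: "carves C \<phi> V w" and C': "carves C' \<phi> V w'"
    using t unfolding twins_def by blast
  define \<psi> where "\<psi> = rn Suc (\<lambda>(s, n). if (s, n) \<in> V then 0 else Suc n) \<phi>"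
  define u where "u z = (\<lambda>(s, n). z (s, n - 1))" for z :: "('f, 'r) eq_sort \<times> nat \<Rightarrow> ('f, 'r, 'a) eq_elem"
  have d: "carves C \<psi> {(Home, 0)} (u w)" "carves C' \<psi> {(Home, 0)} (u w')"
    unfolding \<psi>_def by (rule carves_rn[OF _ _ V C] carves_rn[OF _ _ V C']; auto simp: u_def)+
  have upd: "(\<lambda>x. if x \<in> {(Home, 0)} then Elt c else z x) = z((Home, 0) := Elt c)"
    for c and z :: "('f, 'r) eq_sort \<times> nat \<Rightarrow> ('f, 'r, 'a) eq_elem" by auto
  have "sat Ne (u w) (Ex Home 0 \<psi>) \<longleftrightarrow> sat Ne (u w') (Ex Home 0 \<psi>)"
  proof (rule elem_rel_sat[OF H])
    show "wf_fm Le (Ex Home 0 \<psi>)" using \<phi> by (simp add: \<psi>_def wf_rn Home_sort)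
    show "(u w (s, n), u w' (s, n)) \<in> H \<and> u w (s, n) \<in> univ Ne s" if "(s, n) \<in> fv (Ex Home 0 \<psi>)" for s n
    proof -
      have "(s, n) \<in> (\<lambda>(s, n). (s, Suc n)) ` (fv \<phi> - V)"
        using that subsetD[OF fv_rn_collapse[OF V, of Suc \<phi>], of "(s, n)"] by (simp add: \<psi>_def)
      then obtain m where "n = Suc m" "(s, m) \<in> fv \<phi> - V" by auto
      then show ?thesis using ww[of "(s, m)"] by (simp add: u_def)
    qed
  qed
  moreover have "sat Ne (u w) (Ex Home 0 \<psi>) \<longleftrightarrow> C \<noteq> {}" "sat Ne (u w') (Ex Home 0 \<psi>) \<longleftrightarrow> C' \<noteq> {}"
    using d unfolding carves_def upd by (auto simp: univ_Ne_Home)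
  ultimately show ?thesis using c by blast
qed

lemma twins_Int:
  assumes "twins H C1 C1'" "twins H C2 C2'"
  shows "twins H (C1 \<inter> C2) (C1' \<inter> C2')"
proof -
  obtain \<phi>1 V1 w1 w1' where \<phi>1: "wf_fm Le \<phi>1" and V1: "V1 \<subseteq> {Home} \<times> UNIV"
    and ww1: "\<And>x. x \<in> fv \<phi>1 - V1 \<Longrightarrow> (w1 x, w1' x) \<in> H \<and> w1 x \<in> univ Ne (fst x)"
    and C1: "carves C1 \<phi>1 V1 w1" and C1': "carves C1' \<phi>1 V1 w1'"
    using assms(1) unfolding twins_def by blast
  obtain \<phi>2 V2 w2 w2' where \<phi>2: "wf_fm Le \<phi>2" and V2: "V2 \<subseteq> {Home} \<times> UNIV"
    and ww2: "\<And>x. x \<in> fv \<phi>2 - V2 \<Longrightarrow> (w2 x, w2' x) \<in> H \<and> w2 x \<in> univ Ne (fst x)"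
    and C2: "carves C2 \<phi>2 V2 w2" and C2': "carves C2' \<phi>2 V2 w2'"
    using assms(2) unfolding twins_def by blast
  define K1 K2 where "K1 n = 2 * n + 1" and "K2 n = 2 * n + 2" for n :: nat
  have K: "inj K1" "inj K2" "0 \<notin> range K1" "0 \<notin> range K2" by (auto simp: K1_def K2_def inj_def)
  define \<psi>1 where "\<psi>1 = rn K1 (\<lambda>(s, n). if (s, n) \<in> V1 then 0 else K1 n) \<phi>1"
  define \<psi>2 where "\<psi>2 = rn K2 (\<lambda>(s, n). if (s, n) \<in> V2 then 0 else K2 n) \<phi>2"
  define u where "u z1 z2 = (\<lambda>(s, n). if odd n then z1 (s, n div 2) else z2 (s, n div 2 - 1))"
    for z1 z2 :: "('f, 'r) eq_sort \<times> nat \<Rightarrow> ('f, 'r, 'a) eq_elem"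
  have uK: "u z1 z2 (s, K1 n) = z1 (s, n)" "u z1 z2 (s, K2 n) = z2 (s, n)" for z1 z2 s n
    by (auto simp: u_def K1_def K2_def)
  have d: "carves C1 \<psi>1 {(Home, 0)} (u w1 w2)" "carves C1' \<psi>1 {(Home, 0)} (u w1' w2')"
    "carves C2 \<psi>2 {(Home, 0)} (u w1 w2)" "carves C2' \<psi>2 {(Home, 0)} (u w1' w2')"
    unfolding \<psi>1_def \<psi>2_def using uK
    by (auto intro!: carves_rn[OF K(1,3) V1 C1] carves_rn[OF K(1,3) V1 C1']
      carves_rn[OF K(2,4) V2 C2] carves_rn[OF K(2,4) V2 C2'])
  have 1: "(u w1 w2 x, u w1' w2' x) \<in> H \<and> u w1 w2 x \<in> univ Ne (fst x)" if "x \<in> fv \<psi>1 - {(Home, 0)}" for x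
  proof -
    have "x \<in> (\<lambda>(s, n). (s, K1 n)) ` (fv \<phi>1 - V1)"
      using that fv_rn_collapse[OF V1, of K1 \<phi>1] unfolding \<psi>1_def by blast
    then obtain s m where "x = (s, K1 m)" "(s, m) \<in> fv \<phi>1 - V1" by auto
    then show ?thesis using ww1[of "(s, m)"] by (simp add: uK)
  qed
  have 2: "(u w1 w2 x, u w1' w2' x) \<in> H \<and> u w1 w2 x \<in> univ Ne (fst x)" if "x \<in> fv \<psi>2 - {(Home, 0)}" for x
  proof -
    have "x \<in> (\<lambda>(s, n). (s, K2 n)) ` (fv \<phi>2 - V2)"
      using that fv_rn_collapse[OF V2, of K2 \<phi>2] unfolding \<psi>2_def by blast
    then obtain s m where "x = (s, K2 m)" "(s, m) \<in> fv \<phi>2 - V2" by auto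
    then show ?thesis using ww2[of "(s, m)"] by (simp add: uK)
  qed
  have "carves (C1 \<inter> C2) (Conj \<psi>1 \<psi>2) {(Home, 0)} (u w1 w2)"
    "carves (C1' \<inter> C2') (Conj \<psi>1 \<psi>2) {(Home, 0)} (u w1' w2')"
    by (rule carves_Int[OF d(1,3)], rule carves_Int[OF d(2,4)])
  then show ?thesis
  proof (rule twinsI[rotated 3])
    show "wf_fm Le (Conj \<psi>1 \<psi>2)" using \<phi>1 \<phi>2 by (simp add: \<psi>1_def \<psi>2_def wf_rn)
    show "(u w1 w2 x, u w1' w2' x) \<in> H \<and> u w1 w2 x \<in> univ Ne (fst x)"
      if x: "x \<in> fv (Conj \<psi>1 \<psi>2) - {(Home, 0)}" for x
      using x 1[of x] 2[of x] by (simp only: fv.simps Un_Diff Un_iff) (elim disjE; simp)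
  qed simp
qed

lemma twins_U: "twins H U U"
  by (rule twinsI[of "Eq (Var Home 0) (Var Home 0)" "{(Home, 0)}"]) (auto simp: Home_sort carves_def)

lemma twins_INT:
  assumes "finite F" "\<And>C C'. (C, C') \<in> F \<Longrightarrow> twins H C C'"
  shows "twins H (U \<inter> (\<Inter>(C, C')\<in>F. C)) (U \<inter> (\<Inter>(C, C')\<in>F. C'))"
  using assms
proof (induction F rule: finite_induct)
  case (insert p F)
  obtain C C' where p: "p = (C, C')" by (cases p)
  have "twins H C C'" by (rule insert.prems) (simp add: p)
  moreover have "twins H (U \<inter> (\<Inter>(C, C')\<in>F. C)) (U \<inter> (\<Inter>(C, C')\<in>F. C'))"
    by (rule insert.IH) (use insert.prems in auto)
  ultimately have "twins H (C \<inter> (U \<inter> (\<Inter>(C, C')\<in>F. C))) (C' \<inter> (U \<inter> (\<Inter>(C, C')\<in>F. C')))"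
    by (rule twins_Int)
  moreover have "C \<inter> (U \<inter> (\<Inter>(C, C')\<in>F. C)) = U \<inter> (\<Inter>(C, C')\<in>insert p F. C)"
    "C' \<inter> (U \<inter> (\<Inter>(C, C')\<in>F. C')) = U \<inter> (\<Inter>(C, C')\<in>insert p F. C')"
    by (auto simp: p)
  ultimately show ?case by simp
qed (simp add: twins_U)

end

lemma sorts_fv_tm: "wf_tm L t \<Longrightarrow> x \<in> fv_tm t \<Longrightarrow> fst x \<in> sorts L"
  by (induction t) auto

lemma sorts_fv: "wf_fm L \<phi> \<Longrightarrow> x \<in> fv \<phi> \<Longrightarrow> fst x \<in> sorts L"
  by (induction \<phi>) (auto dest: sorts_fv_tm)

context one_sorted
begin

lemma list_all2_sorts_L: "list_all2 (\<lambda>x s. x \<in> univ N s) xs ss \<longleftrightarrow> length xs = length ss \<and> set xs \<subseteq> U"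
  by (auto simp: list_all2_conv_all_nth in_set_conv_nth subset_iff)

lemma automorphism_iff:
  "automorphism L N \<sigma> \<longleftrightarrow> bij_betw \<sigma> U U \<and>
     (\<forall>f\<in>fsyms L. \<forall>xs. length xs = length (fdom L f) \<and> set xs \<subseteq> U \<longrightarrow> \<sigma> (fint N f xs) = fint N f (map \<sigma> xs)) \<and>
     (\<forall>r\<in>rsyms L. \<forall>xs. length xs = length (rdom L r) \<and> set xs \<subseteq> U \<longrightarrow> (rint N r (map \<sigma> xs) \<longleftrightarrow> rint N r xs))"
  unfolding automorphism_def carrier_L list_all2_sorts_L by (auto simp: sorts_L bij_betw_def)

lemma fint_U: "f \<in> fsyms L \<Longrightarrow> length xs = length (fdom L f) \<Longrightarrow> set xs \<subseteq> U \<Longrightarrow> fint N f xs \<in> U"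
  using is_struct_N unfolding is_struct_def list_all2_sorts_L by simp

lemma automorphism_comp:
  assumes "automorphism L N \<sigma>" "automorphism L N \<tau>"
  shows "automorphism L N (\<lambda>x. \<tau> (\<sigma> x))"
proof -
  have s: "set (map \<sigma> xs) \<subseteq> U" if "set xs \<subseteq> U" for xs using that aut_U[OF assms(1)] by auto
  have "bij_betw (\<lambda>x. \<tau> (\<sigma> x)) U U"
    using bij_betw_trans[OF aut_bij[OF assms(1)] aut_bij[OF assms(2)]] by (simp add: comp_def)
  moreover have "\<tau> (\<sigma> (fint N f xs)) = fint N f (map (\<lambda>x. \<tau> (\<sigma> x)) xs)"
    if "f \<in> fsyms L" "length xs = length (fdom L f)" "set xs \<subseteq> U" for f xs
  proof -
    have "\<sigma> (fint N f xs) = fint N f (map \<sigma> xs)"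
      using assms(1) that by (simp add: automorphism_iff)
    moreover have "\<tau> (fint N f (map \<sigma> xs)) = fint N f (map \<tau> (map \<sigma> xs))"
      using assms(2) that s by (simp add: automorphism_iff del: map_map)
    ultimately show ?thesis by (simp add: comp_def)
  qed
  moreover have "rint N r (map (\<lambda>x. \<tau> (\<sigma> x)) xs) \<longleftrightarrow> rint N r xs"
    if "r \<in> rsyms L" "length xs = length (rdom L r)" "set xs \<subseteq> U" for r xs
  proof -
    have "rint N r (map \<sigma> xs) \<longleftrightarrow> rint N r xs"
      using assms(1) that by (simp add: automorphism_iff)
    moreover have "rint N r (map \<tau> (map \<sigma> xs)) \<longleftrightarrow> rint N r (map \<sigma> xs)"
      using assms(2) that s by (simp add: automorphism_iff del: map_map)
    ultimately show ?thesis by (simp add: comp_def)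
  qed
  ultimately show ?thesis by (simp add: automorphism_iff)
qed

lemma automorphism_inverse:
  assumes \<sigma>: "automorphism L N \<sigma>"
  shows "\<exists>\<tau>. automorphism L N \<tau> \<and> (\<forall>x\<in>U. \<tau> (\<sigma> x) = x)"
proof -
  define \<tau> where "\<tau> = inv_into U \<sigma>"
  have b: "bij_betw \<tau> U U" unfolding \<tau>_def by (rule bij_betw_inv_into[OF aut_bij[OF \<sigma>]])
  have l: "\<tau> (\<sigma> x) = x" if "x \<in> U" for x
    unfolding \<tau>_def by (rule bij_betw_inv_into_left[OF aut_bij[OF \<sigma>] that])
  have r: "\<sigma> (\<tau> x) = x" if "x \<in> U" for x
    unfolding \<tau>_def by (rule bij_betw_inv_into_right[OF aut_bij[OF \<sigma>] that])
  have mr: "map \<sigma> (map \<tau> xs) = xs" "set (map \<tau> xs) \<subseteq> U" if "set xs \<subseteq> U" for xs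
    using that r b by (auto simp: bij_betw_def intro!: map_idI)
  have "\<tau> (fint N f xs) = fint N f (map \<tau> xs)"
    if "f \<in> fsyms L" "length xs = length (fdom L f)" "set xs \<subseteq> U" for f xs
  proof -
    have "\<sigma> (fint N f (map \<tau> xs)) = fint N f (map \<sigma> (map \<tau> xs))"
      using \<sigma> that mr(2)[OF that(3)] by (simp add: automorphism_iff del: map_map)
    also have "\<dots> = fint N f xs" by (simp only: mr(1)[OF that(3)])
    finally show ?thesis using l[of "fint N f (map \<tau> xs)"] fint_U[of f "map \<tau> xs"] that mr(2)[OF that(3)]
      by simp
  qed
  moreover have "rint N r (map \<tau> xs) \<longleftrightarrow> rint N r xs"
    if "r \<in> rsyms L" "length xs = length (rdom L r)" "set xs \<subseteq> U" for r xs
  proof -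
    have "rint N r (map \<sigma> (map \<tau> xs)) \<longleftrightarrow> rint N r (map \<tau> xs)"
      using \<sigma> that mr(2)[OF that(3)] by (simp add: automorphism_iff del: map_map)
    then show ?thesis by (simp only: mr(1)[OF that(3)])
  qed
  ultimately have "automorphism L N \<tau>" using b by (simp add: automorphism_iff)
  then show ?thesis using l by blast
qed

lemma eq_map_comp: "eq_map (\<lambda>x. \<tau> (\<sigma> x)) e = eq_map \<tau> (eq_map \<sigma> e)"
  by (cases e) (auto simp: image_image comp_def)

lemma eq_map_fixes:
  assumes "automorphism L N \<sigma>" "B \<subseteq> U" "\<And>b. b \<in> B \<Longrightarrow> \<sigma> b = b" "e \<in> eq_set L N B"
  shows "eq_map \<sigma> e = e"
proof -
  obtain s xs where s: "s \<in> sorts Le" "xs \<in> tuples B (arity s)" "e = cls N s xs"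
    using assms(4) by (auto simp: eq_set_cls)
  have "xs \<in> tuples U (arity s)" "map \<sigma> xs = xs"
    using s(2) assms(2,3) by (auto simp: tuples_def intro!: map_idI)
  then show ?thesis using eq_map_cls[OF assms(1) s(1)] s(3) by simp
qed

lemma eq_set_reps:
  assumes "A \<subseteq> eq_set L N M" "|A| <o r" "Card_order r" "natLeq <o r"
  shows "\<exists>B\<subseteq>M. |B| <o r \<and> A \<subseteq> eq_set L N B"
proof -
  have "\<forall>e\<in>A. \<exists>F. finite F \<and> F \<subseteq> M \<and> e \<in> eq_set L N F"
  proof
    fix e assume "e \<in> A"
    then obtain s xs where "s \<in> sorts Le" "xs \<in> tuples M (arity s)" "e = cls N s xs"
      using assms(1) by (auto simp: eq_set_cls)
    then have "finite (set xs) \<and> set xs \<subseteq> M \<and> e \<in> eq_set L N (set xs)"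
      by (auto simp: eq_set_cls tuples_def)
    then show "\<exists>F. finite F \<and> F \<subseteq> M \<and> e \<in> eq_set L N F" by blast
  qed
  from bchoice[OF this] obtain F where F: "\<forall>e\<in>A. finite (F e) \<and> F e \<subseteq> M \<and> e \<in> eq_set L N (F e)" ..
  have "|\<Union>e\<in>A. F e| <o r"
    using card_UN_finite_ordLess[OF assms(3,4,2), of F] F by blast
  moreover have "e \<in> eq_set L N (\<Union>e\<in>A. F e)" if "e \<in> A" for e
    using F eq_set_mono[of "F e" "\<Union>e\<in>A. F e"] that by blast
  moreover have "(\<Union>e\<in>A. F e) \<subseteq> M" using F by blast
  ultimately show ?thesis by blast
qed

lemma eq_set_univ:
  assumes "y \<in> eq_set L N D" "D \<subseteq> U" "y \<in> univ Ne s" "s \<in> sorts Le"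
  shows "\<exists>xs\<in>tuples D (arity s). y = cls N s xs"
proof -
  obtain t xs where t: "t \<in> sorts Le" "xs \<in> tuples D (arity t)" "y = cls N t xs"
    using assms(1) by (auto simp: eq_set_cls)
  have "xs \<in> tuples U (arity t)" using t(2) assms(2) by (auto simp: tuples_def)
  then have "y \<in> univ Ne t" using t by (simp add: univ_Ne)
  then have "t = s" using sort_unique[OF _ assms(3) t(1) assms(4)] by simp
  then show ?thesis using t by blast
qed

lemma elem_rel_range: "elem_rel Le Ne H \<Longrightarrow> (x, y) \<in> H \<Longrightarrow> x \<in> Ue \<Longrightarrow> y \<in> Ue"
  using elem_rel_sort[of Le Ne H x y] by (auto simp: carrier_def)

end

text \<open>
  A saturated and strongly homogeneous structure, of uncountable monstrosity.
\<close>

locale monster = one_sorted L N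
  for L :: "(unit, 'f, 'r) lang" and N :: "(unit, 'f, 'r, 'a) struct" +
  fixes \<mu> :: "'k rel"
  assumes Card_order_mu: "Card_order \<mu>" and mu_uncountable: "natLeq <o \<mu>"
    and saturated_N: "saturated L N \<mu>" and strongly_homogeneous_N: "strongly_homogeneous L N \<mu>"
begin

lemmas mu_facts = Card_order_mu mu_uncountable

text \<open>
  A small partial elementary map between imaginaries extends to any element \<open>d\<close> of the home sort.
  The twins of the sets containing \<open>d\<close> are definable over representatives of the range, and they
  have the finite intersection property because twins are closed under intersection.
\<close>

lemma elem_rel_extend:
  assumes H: "elem_rel Le Ne H" "|H| <o \<mu>" "\<And>x y. (x, y) \<in> H \<Longrightarrow> x \<in> Ue" and d: "d \<in> U"
  shows "\<exists>d'\<in>U. elem_rel Le Ne (insert (Elt d, Elt d') H)"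
proof -
  \<comment> \<open>\<open>D\<close> consists of representatives of the range, \<open>\<Sigma>\<close> is the image of the type of \<open>d\<close> over the domain.\<close>
  have "snd ` H \<subseteq> eq_set L N U"
    using elem_rel_range[OF H(1)] H(3) by (force simp: carrier_Le)
  from eq_set_reps[OF this card_image_ordLess[OF H(2)] mu_facts]
  obtain D where D: "D \<subseteq> U" "|D| <o \<mu>" "snd ` H \<subseteq> eq_set L N D"
    by (elim exE conjE)
  define \<Sigma> where "\<Sigma> = {\<chi> \<in> forms1 L D. \<exists>C C'. twins H C C' \<and> d \<in> C \<and>
    (\<forall>c\<in>U. sat (param_struct N) (\<lambda>_. c) \<chi> \<longleftrightarrow> c \<in> C')}"
  have fs: "\<exists>c. realizes N c p0" if p0: "finite p0" "p0 \<subseteq> \<Sigma>" for p0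
  proof -
    have "\<forall>\<chi>\<in>p0. \<exists>CC. twins H (fst CC) (snd CC) \<and> d \<in> fst CC \<and>
      (\<forall>c\<in>U. sat (param_struct N) (\<lambda>_. c) \<chi> \<longleftrightarrow> c \<in> snd CC)"
    proof
      fix \<chi> assume "\<chi> \<in> p0"
      then have "\<exists>C C'. twins H C C' \<and> d \<in> C \<and> (\<forall>c\<in>U. sat (param_struct N) (\<lambda>_. c) \<chi> \<longleftrightarrow> c \<in> C')"
        using p0(2) unfolding \<Sigma>_def by blast
      then obtain C C' where "twins H C C' \<and> d \<in> C \<and> (\<forall>c\<in>U. sat (param_struct N) (\<lambda>_. c) \<chi> \<longleftrightarrow> c \<in> C')"
        by (elim exE)
      then show "\<exists>CC. twins H (fst CC) (snd CC) \<and> d \<in> fst CC \<and>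
        (\<forall>c\<in>U. sat (param_struct N) (\<lambda>_. c) \<chi> \<longleftrightarrow> c \<in> snd CC)"
        by (intro exI[of _ "(C, C')"]) simp
    qed
    from bchoice[OF this] obtain g where g: "\<forall>\<chi>\<in>p0. twins H (fst (g \<chi>)) (snd (g \<chi>)) \<and> d \<in> fst (g \<chi>) \<and>
      (\<forall>c\<in>U. sat (param_struct N) (\<lambda>_. c) \<chi> \<longleftrightarrow> c \<in> snd (g \<chi>))" ..
    have "twins H (U \<inter> (\<Inter>(C, C')\<in>g ` p0. C)) (U \<inter> (\<Inter>(C, C')\<in>g ` p0. C'))"
    proof (rule twins_INT)
      show "finite (g ` p0)" using p0(1) by simp
      show "twins H C C'" if CC: "(C, C') \<in> g ` p0" for C C'
      proof -
        obtain \<chi> where \<chi>: "\<chi> \<in> p0" "(C, C') = g \<chi>" using CC by (rule imageE)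
        then show ?thesis using bspec[OF g \<chi>(1)] by (simp flip: \<chi>(2))
      qed
    qed
    moreover have "d \<in> U \<inter> (\<Inter>(C, C')\<in>g ` p0. C)" using d g by (simp add: split_beta)
    ultimately have "U \<inter> (\<Inter>(C, C')\<in>g ` p0. C') \<noteq> {}"
      by (rule twins_nonempty[OF H(1)])
    then obtain c where c: "c \<in> U" "c \<in> (\<Inter>(C, C')\<in>g ` p0. C')" by blast
    have "sat (param_struct N) (\<lambda>_. c) \<chi>" if "\<chi> \<in> p0" for \<chi>
    proof -
      have "c \<in> snd (g \<chi>)" using c(2) that by (simp add: split_beta)
      then show ?thesis using bspec[OF g that] c(1) by simp
    qed
    then have "realizes N c p0" using c(1) by (simp add: realizes_def)
    then show ?thesis by blast
  qed
  have "\<Sigma> \<subseteq> forms1 L D" unfolding \<Sigma>_def by (rule Collect_restrict)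
  from finitely_satisfiable_extends_S1[OF this fs]
  obtain p where p: "p \<in> S1 L N D" "\<Sigma> \<subseteq> p" ..
  have "small L N \<mu> D" using D by (simp add: small_def carrier_L)
  then obtain d' where d': "realizes N d' p"
    using saturated_N p(1) unfolding saturated_def by blast
  have d'U: "d' \<in> U" using d' by (simp add: realizes_def)
  have step: "d' \<in> C'" if t: "twins H C C'" and c: "d \<in> C" for C C'
  proof -
    obtain \<phi> V w w' where \<phi>: "wf_fm Le \<phi>" and V: "V \<subseteq> {Home} \<times> UNIV"
      and ww: "\<forall>x\<in>fv \<phi> - V. (w x, w' x) \<in> H \<and> w x \<in> univ Ne (fst x)"
      and "carves C \<phi> V w" and C': "carves C' \<phi> V w'"
      by (rule twinsE[OF t])
    have "\<exists>xs\<in>tuples D (arity (fst x)). w' x = cls N (fst x) xs" if x: "x \<in> fv \<phi> - V" for x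
    proof (rule eq_set_univ[OF _ D(1)])
      have xH: "(w x, w' x) \<in> H" "w x \<in> univ Ne (fst x)" using bspec[OF ww x] by auto
      have "w' x \<in> snd ` H" using xH(1) by (metis snd_conv imageI)
      then show "w' x \<in> eq_set L N D" using D(3) by blast
      show s: "fst x \<in> sorts Le"
        using sorts_fv[OF \<phi>] x by auto
      show "w' x \<in> univ Ne (fst x)" using elem_rel_sort[OF H(1) xH(1) s] xH(2) by simp
    qed
    from definable_over[OF \<phi> V D(1) this] obtain \<chi> where \<chi>: "\<chi> \<in> forms1 L D"
      "\<forall>c\<in>U. sat (param_struct N) (\<lambda>_. c) \<chi> \<longleftrightarrow> sat Ne (\<lambda>x. if x \<in> V then Elt c else w' x) \<phi>" ..
    have "\<forall>c\<in>U. sat (param_struct N) (\<lambda>_. c) \<chi> \<longleftrightarrow> c \<in> C'"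
      using \<chi>(2) C' by (simp add: carves_def)
    then have "\<chi> \<in> \<Sigma>" and iff: "sat (param_struct N) (\<lambda>_. d') \<chi> \<longleftrightarrow> d' \<in> C'"
      using \<chi>(1) t c d'U unfolding \<Sigma>_def by blast+
    then have "sat (param_struct N) (\<lambda>_. d') \<chi>" using p(2) d' unfolding realizes_def by blast
    then show ?thesis using iff by simp
  qed
  have half: "sat Ne w' \<phi>" if \<phi>: "wf_fm Le \<phi>"
    and h: "\<forall>(s, n)\<in>fv \<phi>. (w (s, n), w' (s, n)) \<in> insert (Elt d, Elt d') H \<and> w (s, n) \<in> univ Ne s"
    and w: "sat Ne w \<phi>" for \<phi> w w'
  proof -
    define V where "V = {x \<in> fv \<phi>. (w x, w' x) = (Elt d, Elt d')}"
    have V: "V \<subseteq> {Home} \<times> UNIV"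
    proof
      fix x assume x: "x \<in> V"
      obtain s n where sn: "x = (s, n)" by (cases x)
      have "Elt d \<in> univ Ne s" "s \<in> sorts Le" using x sn h sorts_fv[OF \<phi>] by (auto simp: V_def)
      moreover have "Elt d \<in> univ Ne Home" using d by (simp add: univ_Ne_Home)
      ultimately have "s = Home" using sort_unique[OF _ _ _ Home_sort] by blast
      then show "x \<in> {Home} \<times> UNIV" using sn by simp
    qed
    define C C' where "C = {c \<in> U. sat Ne (\<lambda>x. if x \<in> V then Elt c else w x) \<phi>}"
      and "C' = {c \<in> U. sat Ne (\<lambda>x. if x \<in> V then Elt c else w' x) \<phi>}"
    have "twins H C C'"
    proof (rule twinsI[OF \<phi> V])
      show "(w x, w' x) \<in> H \<and> w x \<in> univ Ne (fst x)" if x: "x \<in> fv \<phi> - V" for x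
        using h x by (auto simp: V_def)
    qed (simp_all add: carves_def C_def C'_def)
    moreover have "sat Ne (\<lambda>x. if x \<in> V then Elt d else w x) \<phi> \<longleftrightarrow> sat Ne w \<phi>"
      by (rule sat_cong) (auto simp: V_def)
    then have "d \<in> C" using w d by (simp add: C_def)
    ultimately have "d' \<in> C'" by (rule step)
    moreover have "sat Ne (\<lambda>x. if x \<in> V then Elt d' else w' x) \<phi> \<longleftrightarrow> sat Ne w' \<phi>"
      by (rule sat_cong) (auto simp: V_def)
    ultimately show ?thesis by (simp add: C'_def)
  qed
  have "elem_rel Le Ne (insert (Elt d, Elt d') H)"
    unfolding elem_rel_def
  proof (intro conjI allI impI)
    have "Elt d \<in> univ Ne s \<longleftrightarrow> Elt d' \<in> univ Ne s" if s: "s \<in> sorts Le" for s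
    proof -
      have "Elt c \<in> univ Ne s \<longleftrightarrow> s = Home" if "c \<in> U" for c
        using that by (cases s) (auto simp: eq_struct_def)
      then show ?thesis using d d'U by simp
    qed
    then show "\<forall>(x, y)\<in>insert (Elt d, Elt d') H. \<forall>s\<in>sorts Le. x \<in> univ Ne s \<longleftrightarrow> y \<in> univ Ne s"
      using elem_rel_sort[OF H(1)] by auto
  next
    fix \<phi> w w'
    assume \<phi>: "wf_fm Le \<phi>" and
      h: "\<forall>(s, n)\<in>fv \<phi>. (w (s, n), w' (s, n)) \<in> insert (Elt d, Elt d') H \<and> w (s, n) \<in> univ Ne s"
    show "sat Ne w \<phi> \<longleftrightarrow> sat Ne w' \<phi>"
      using half[OF \<phi> h] half[of "Neg \<phi>" w w'] \<phi> h by auto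
  qed
  then show ?thesis using d'U by blast
qed

lemma elem_rel_card:
  assumes "elem_rel L' N' G" "\<And>x y. (x, y) \<in> G \<Longrightarrow> x \<in> carrier L' N'" "|fst ` G| <o r"
  shows "|G| <o r"
proof (rule card_inj_on_ordLess[OF assms(3)])
  show "inj_on fst G"
    using elem_rel_functional[OF assms(1)] assms(2) by (auto simp: inj_on_def)
qed

lemma home_homogeneous:
  assumes G: "elem_rel L N G" "\<And>x y. (x, y) \<in> G \<Longrightarrow> x \<in> U" "|G| <o \<mu>"
  shows "\<exists>\<sigma>. automorphism L N \<sigma> \<and> (\<forall>(x, y)\<in>G. y = \<sigma> x)"
proof -
  define g where "g x = (SOME y. (x, y) \<in> G)" for x
  have g: "y = g x" if "(x, y) \<in> G" for x y
  proof -
    have "(x, g x) \<in> G" unfolding g_def using that by (rule someI)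
    then show ?thesis using elem_rel_functional[OF G(1) that] G(2)[OF that] by (simp add: carrier_L)
  qed
  have "(\<lambda>x. (id x, g x)) ` fst ` G = G" using g by force
  then have "elementary_map L N (fst ` G) g"
    unfolding elementary_map_def same_type_iff_elem_rel using G(1) by simp
  moreover have "small L N \<mu> (fst ` G)"
    using G(2) card_image_ordLess[OF G(3)] by (auto simp: small_def carrier_L)
  ultimately obtain \<sigma> where "automorphism L N \<sigma>" "\<forall>x\<in>fst ` G. \<sigma> x = g x"
    using strongly_homogeneous_N unfolding strongly_homogeneous_def by blast
  then show ?thesis using g by (intro exI[of _ \<sigma>]) force
qed

lemma elem_rel_cls:
  assumes G: "elem_rel Le Ne G" and y: "(y, y') \<in> G" "y = cls N s xs" "s \<in> sorts Le" "xs \<in> tuples U (arity s)"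
    and g: "\<And>x. x \<in> set xs \<Longrightarrow> (Elt x, Elt (g x)) \<in> G"
  shows "y' = cls N s (map g xs)"
proof (cases s)
  case Home
  then obtain x where x: "xs = [x]" "x \<in> U" using y(4) by (auto simp: tuples_1)
  have "(Elt x, y') \<in> G" using y(1,2) x Home by simp
  then have "y' = Elt (g x)"
    using elem_rel_functional[OF G _ g[of x]] x by (simp add: Elt_Ue)
  then show ?thesis using x Home by simp
next
  case (Quot n E)
  have len: "length xs = n" and xsU: "set xs \<subseteq> U" using y(4) Quot by (auto simp: tuples_def)
  have E: "eq_formula L N n E" using y(3) Quot by (simp add: Quot_sort)
  define ts :: "(('f, 'r) eq_sort, ('f, 'r) eq_fun) tm list" where "ts = map (Var Home) [0..<n]"
  define w :: "('f, 'r, 'a) eq_elem \<Rightarrow> 'a list \<Rightarrow> ('f, 'r) eq_sort \<times> nat \<Rightarrow> ('f, 'r, 'a) eq_elem"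
    where "w z zs = (\<lambda>(s, k). if s = Home then Elt (zs ! k) else z)" for z zs
  define \<phi> :: "(('f, 'r) eq_sort, ('f, 'r) eq_fun, 'r) fm" where "\<phi> = Eq (Var (Quot n E) 0) (Fn (Proj n E) ts)"
  have sat: "sat Ne (w z zs) \<phi> \<longleftrightarrow> z = cls N (Quot n E) zs" if "length zs = n" for z zs
  proof -
    have "map un_elt (map (tm_val Ne (w z zs)) ts) = zs"
      using that by (auto simp: ts_def w_def intro: nth_equalityI)
    moreover have "fint Ne (Proj n E) us = cls N (Quot n E) (map un_elt us)" for us
      by (simp add: eq_struct_def)
    ultimately have "tm_val Ne (w z zs) (Fn (Proj n E) ts) = cls N (Quot n E) zs"
      by (simp only: tm_val.simps)
    moreover have "tm_val Ne (w z zs) (Var (Quot n E) 0) = z" by (simp add: w_def)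
    ultimately show ?thesis by (simp only: \<phi>_def sat.simps)
  qed
  have "wf_fm Le \<phi>"
    using E by (auto simp: \<phi>_def ts_def Quot_sort Le_simps Home_sort intro: nth_equalityI)
  moreover have "(w y xs (s, k), w y' (map g xs) (s, k)) \<in> G \<and> w y xs (s, k) \<in> univ Ne s"
    if "(s, k) \<in> fv \<phi>" for s k
  proof -
    have "s = Quot n E \<and> k = 0 \<or> s = Home \<and> k < n"
      using that by (auto simp: \<phi>_def ts_def)
    then show ?thesis
    proof
      assume "s = Quot n E \<and> k = 0"
      then show ?thesis using y Quot univ_Ne[of s] by (auto simp: w_def simp del: cls.simps)
    next
      assume k: "s = Home \<and> k < n"
      then have "xs ! k \<in> set xs" using len by simp
      moreover from this have "xs ! k \<in> U" using xsU by blast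
      ultimately show ?thesis using k g len by (auto simp: w_def univ_Ne_Home)
    qed
  qed
  ultimately have "sat Ne (w y xs) \<phi> \<longleftrightarrow> sat Ne (w y' (map g xs)) \<phi>"
    by (rule elem_rel_sat[OF G])
  then show ?thesis using sat[of xs y] sat[of "map g xs" y'] len y(2) Quot by simp
qed

text \<open>
  Strong homogeneity passes to imaginaries: extend the map to representatives of its domain, one at
  a time, and apply strong homogeneity to the part on the home sort.
\<close>

lemma eq_homogeneous:
  assumes H: "elem_rel Le Ne H" "|H| <o \<mu>" "\<And>x y. (x, y) \<in> H \<Longrightarrow> x \<in> Ue"
  shows "\<exists>\<sigma>. automorphism L N \<sigma> \<and> (\<forall>(x, y)\<in>H. y = eq_map \<sigma> x)"
proof -
  have "fst ` H \<subseteq> eq_set L N U" using H(3) by (force simp: carrier_Le)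
  from eq_set_reps[OF this card_image_ordLess[OF H(2)] mu_facts]
  obtain D where D: "D \<subseteq> U" "|D| <o \<mu>" "fst ` H \<subseteq> eq_set L N D" by (elim exE conjE)
  define \<A> where "\<A> = {G. H \<subseteq> G \<and> fst ` G \<subseteq> fst ` H \<union> Elt ` D \<and> elem_rel Le Ne G}"
  have "\<exists>G\<in>\<A>. \<forall>X\<in>\<A>. G \<subseteq> X \<longrightarrow> X = G"
  proof (rule subset_Zorn_nonempty)
    have "H \<in> \<A>" using H(1) by (simp add: \<A>_def)
    then show "\<A> \<noteq> {}" by blast
    fix \<C> assume \<C>: "\<C> \<noteq> {}" "subset.chain \<A> \<C>"
    then have mem: "H \<subseteq> G" "fst ` G \<subseteq> fst ` H \<union> Elt ` D" "elem_rel Le Ne G" if "G \<in> \<C>" for G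
      using that by (auto simp: subset.chain_def \<A>_def)
    have "elem_rel Le Ne (\<Union>\<C>)" by (rule elem_rel_Union_chain[OF \<C>(2,1) mem(3)])
    moreover have "H \<subseteq> \<Union>\<C>" using mem(1) \<C>(1) by blast
    moreover have "fst ` \<Union>\<C> \<subseteq> fst ` H \<union> Elt ` D" unfolding image_Union using mem(2) by (rule UN_least)
    ultimately show "\<Union>\<C> \<in> \<A>" by (simp add: \<A>_def)
  qed
  then obtain G where G: "G \<in> \<A>" and max: "\<forall>X\<in>\<A>. G \<subseteq> X \<longrightarrow> X = G" ..
  have HG: "H \<subseteq> G" and fG: "fst ` G \<subseteq> fst ` H \<union> Elt ` D" and eG: "elem_rel Le Ne G"
    using G by (auto simp: \<A>_def)
  have domG: "x \<in> Ue" if "(x, y) \<in> G" for x y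
  proof -
    have "x \<in> fst ` H \<union> Elt ` D" using fG that by force
    then show ?thesis using H(3) D(1) by (auto simp: Elt_Ue)
  qed
  have "|fst ` G| <o \<mu>"
    by (rule card_subset_ordLess[OF card_Un_ordLess[OF mu_facts card_image_ordLess[OF H(2)] card_image_ordLess[OF D(2)]] fG])
  from elem_rel_card[OF eG domG this] have cG: "|G| <o \<mu>" .
  have "\<exists>d'. (Elt d, Elt d') \<in> G" if d: "d \<in> D" for d
  proof -
    obtain d' where d': "elem_rel Le Ne (insert (Elt d, Elt d') G)"
      using elem_rel_extend[OF eG cG, of d] domG d D(1) by blast
    have "insert (Elt d, Elt d') G \<in> \<A>" using d' HG fG d by (auto simp: \<A>_def)
    then have "insert (Elt d, Elt d') G = G" using max by blast
    then show ?thesis by blast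
  qed
  then have "\<forall>d\<in>D. \<exists>d'. (Elt d, Elt d') \<in> G" by blast
  from bchoice[OF this] obtain g where g: "\<forall>d\<in>D. (Elt d, Elt (g d)) \<in> G" ..
  have "elem_rel L N ((\<lambda>d. (d, g d)) ` D)"
    by (rule elem_rel_mono[OF elem_rel_home[OF eG]]) (use g in auto)
  moreover have "|(\<lambda>d. (d, g d)) ` D| <o \<mu>" by (rule card_image_ordLess[OF D(2)])
  ultimately obtain \<sigma> where \<sigma>: "automorphism L N \<sigma>" "\<forall>(x, y)\<in>(\<lambda>d. (d, g d)) ` D. y = \<sigma> x"
    using home_homogeneous[of "(\<lambda>d. (d, g d)) ` D"] D(1) by blast
  have "y = eq_map \<sigma> x" if xy: "(x, y) \<in> H" for x y
  proof -
    have "x \<in> eq_set L N D" using D(3) xy by force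
    then obtain s xs where s: "s \<in> sorts Le" "xs \<in> tuples D (arity s)" "x = cls N s xs"
      by (auto simp: eq_set_cls)
    have xsU: "xs \<in> tuples U (arity s)" using s(2) D(1) by (auto simp: tuples_def)
    have "y = cls N s (map \<sigma> xs)"
    proof (rule elem_rel_cls[OF eG _ s(3,1) xsU])
      show "(x, y) \<in> G" using xy HG by blast
      show "(Elt z, Elt (\<sigma> z)) \<in> G" if "z \<in> set xs" for z
      proof -
        have "z \<in> D" using that s(2) by (auto simp: tuples_def)
        then show ?thesis using g \<sigma>(2) by auto
      qed
    qed
    then show ?thesis using eq_map_cls[OF \<sigma>(1) s(1) xsU] s(3) by simp
  qed
  then show ?thesis using \<sigma>(1) by blast
qed

lemma equiv_over_automorphism:
  assumes "equiv_over Le Ne B A A'" "small Le Ne \<mu> A" "small Le Ne \<mu> B"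
  shows "\<exists>\<sigma>. automorphism L N \<sigma> \<and> (\<forall>b\<in>B. eq_map \<sigma> b = b) \<and> eq_map \<sigma> ` A = A'"
proof -
  obtain f where f: "elementary_map Le Ne (A \<union> B) f" "\<forall>b\<in>B. f b = b" "f ` A = A'"
    using assms(1) by (auto simp: equiv_over_def)
  have "elem_rel Le Ne ((\<lambda>x. (id x, f x)) ` (A \<union> B))"
    using f(1) by (simp only: elementary_map_def same_type_iff_elem_rel)
  moreover have "|(\<lambda>x. (id x, f x)) ` (A \<union> B)| <o \<mu>"
    using assms(2,3) by (intro card_image_ordLess card_Un_ordLess[OF mu_facts]) (auto simp: small_def)
  moreover have "x \<in> Ue" if "(x, y) \<in> (\<lambda>x. (id x, f x)) ` (A \<union> B)" for x y
    using that assms(2,3) by (auto simp: small_def)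
  ultimately obtain \<sigma> where \<sigma>: "automorphism L N \<sigma>" "\<forall>(x, y)\<in>(\<lambda>x. (id x, f x)) ` (A \<union> B). y = eq_map \<sigma> x"
    using eq_homogeneous by blast
  have "eq_map \<sigma> x = f x" if "x \<in> A \<union> B" for x using \<sigma>(2) that by auto
  then have "\<forall>b\<in>B. eq_map \<sigma> b = b" "eq_map \<sigma> ` A = A'" using f(2,3) by auto
  then show ?thesis using \<sigma>(1) by blast
qed

lemma realizes_tp_automorphism:
  assumes "B \<subseteq> U" "|B| <o \<mu>" "c \<in> U" "realizes N b (tp L N B c)"
  shows "\<exists>\<sigma>. automorphism L N \<sigma> \<and> (\<forall>x\<in>B. \<sigma> x = x) \<and> \<sigma> c = b"
proof -
  have "|insert (c, b) (Id_on B)| <o \<mu>"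
  proof -
    have "insert (c, b) (Id_on B) = {(c, b)} \<union> (\<lambda>x. (x, x)) ` B" by (auto simp: Id_on_def)
    then show ?thesis
      by (simp only:) (intro card_Un_ordLess[OF mu_facts] card_finite_ordLess[OF mu_uncountable]
        card_image_ordLess[OF assms(2)] finite.intros)
  qed
  moreover have "x \<in> U" if "(x, y) \<in> insert (c, b) (Id_on B)" for x y using that assms(1,3) by auto
  ultimately obtain \<sigma> where "automorphism L N \<sigma>" "\<forall>(x, y)\<in>insert (c, b) (Id_on B). y = \<sigma> x"
    using home_homogeneous[OF elem_rel_realizes_tp[OF sorts_L assms(1,3,4)]] by blast
  then have "\<sigma> c = b" "\<And>x. x \<in> B \<Longrightarrow> \<sigma> x = x" by force+
  then show ?thesis using \<open>automorphism L N \<sigma>\<close> by blast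
qed

end

section \<open>Calculus of independence relations\<close>

lemma card_finite_subsets_ordLess:
  assumes "|A| <o r" "Card_order r" "natLeq <o r"
  shows "|{F. F \<subseteq> A \<and> finite F}| <o r"
proof -
  define c where "c = |A <+> (UNIV :: nat set)|"
  have infr: "infinite (Field r)"
    using assms(2,3) by (metis cinfinite_def cinfinite_mono natLeq_cinfinite ordLess_imp_ordLeq)
  have "|UNIV :: nat set| <o r"
    using card_of_nat assms(3) by (rule ordIso_ordLess_trans)
  then have cr: "c <o r"
    unfolding c_def by (rule card_of_Plus_ordLess_infinite_Field[OF infr assms(2,1)])
  have "Card_order c" unfolding c_def by (rule card_of_Card_order)
  moreover have "infinite (Field c)" by (simp add: c_def Field_card_of)
  ultimately have C: "Card_order c" "infinite (Field c)" .
  have Ac: "|A| \<le>o c" and nc: "|UNIV :: nat set| \<le>o c"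
    unfolding c_def by (rule card_of_Plus1, rule card_of_Plus2)
  define S where "S n = {xs. length xs = n \<and> set xs \<subseteq> A}" for n
  have "|S n| \<le>o c" for n
  proof (induction n)
    case 0
    have "S 0 = {[]}" by (auto simp: S_def)
    moreover have "|{[]}| \<le>o c"
      unfolding c_def by (rule card_of_singl_ordLeq) auto
    ultimately show ?case by simp
  next
    case (Suc n)
    have "S (Suc n) = (\<lambda>(x, xs). x # xs) ` (A \<times> S n)"
      by (auto simp: S_def length_Suc_conv image_iff)
    moreover have "|A \<times> S n| \<le>o c"
      by (rule card_of_Times_ordLeq_infinite_Field[OF C(2) Ac Suc C(1)])
    ultimately show ?case by (simp only:) (rule ordLeq_transitive[OF card_of_image])
  qed
  then have "|\<Union>n. S n| \<le>o c"
    by (intro card_of_UNION_ordLeq_infinite_Field[OF C(2,1) nc]) blast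
  moreover have "{F. F \<subseteq> A \<and> finite F} \<subseteq> set ` (\<Union>n. S n)"
  proof
    fix F assume "F \<in> {F. F \<subseteq> A \<and> finite F}"
    then obtain xs where "set xs = F" "F \<subseteq> A" using finite_list by auto
    then show "F \<in> set ` (\<Union>n. S n)" by (auto simp: S_def)
  qed
  ultimately have "|{F. F \<subseteq> A \<and> finite F}| \<le>o c"
    by (meson card_of_mono1 card_of_image ordLeq_transitive)
  then show ?thesis using cr by (rule ordLeq_ordLess_trans)
qed

text \<open>
  An independence relation, for any many-sorted structure, so that what follows applies both to
  the home sort and to imaginaries. \<open>sm\<close> means small and \<open>cl\<close> is the closure operator.
\<close>

locale indep_rel =
  fixes L :: "('s, 'f, 'r) lang" and N :: "('s, 'f, 'r, 'a) struct" and \<mu> :: "'k rel"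
    and ind :: "'a set \<Rightarrow> 'a set \<Rightarrow> 'a set \<Rightarrow> bool"
  assumes Card_order_mu: "Card_order \<mu>" and mu_uncountable: "natLeq <o \<mu>"
    and independence: "independence_relation L N \<mu> ind"
begin

abbreviation sm where "sm \<equiv> small L N \<mu>"
abbreviation cl where "cl \<equiv> closure_of L N ind"

lemma sm_carrier: "sm A \<Longrightarrow> A \<subseteq> carrier L N"
  by (simp add: small_def)

lemma sm_card: "sm A \<Longrightarrow> |A| <o \<mu>"
  by (simp add: small_def)

lemma sm_Un: "sm A \<Longrightarrow> sm B \<Longrightarrow> sm (A \<union> B)"
  by (simp add: small_def card_Un_ordLess[OF Card_order_mu mu_uncountable])

lemma sm_subset: "sm B \<Longrightarrow> A \<subseteq> B \<Longrightarrow> sm A"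
  using card_subset_ordLess[of B \<mu> A] by (auto simp: small_def)

lemma sm_finite: "finite A \<Longrightarrow> A \<subseteq> carrier L N \<Longrightarrow> sm A"
  by (simp add: small_def card_finite_ordLess[OF mu_uncountable])

lemma sm_insert: "c \<in> carrier L N \<Longrightarrow> sm B \<Longrightarrow> sm (insert c B)"
  using sm_Un[of "{c}" B] sm_finite[of "{c}"] by simp

lemma cl_carrier: "cl A \<subseteq> carrier L N"
  by (auto simp: closure_of_def)

lemmas independence_ax = independence[unfolded independence_relation_def]

lemma invariance:
  "ind A B C \<Longrightarrow> automorphism L N \<sigma> \<Longrightarrow> sm A \<Longrightarrow> sm B \<Longrightarrow> sm C \<Longrightarrow> ind (\<sigma> ` A) (\<sigma> ` B) (\<sigma> ` C)"
  by (rule independence_ax[THEN conjunct1, rule_format]) auto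

lemma normality: "ind A B C \<Longrightarrow> sm A \<Longrightarrow> sm B \<Longrightarrow> sm C \<Longrightarrow> ind (A \<union> B) B C"
  by (rule independence_ax[THEN conjunct2, THEN conjunct1, rule_format]) auto

lemma sym: "ind A B C \<Longrightarrow> sm A \<Longrightarrow> sm B \<Longrightarrow> sm C \<Longrightarrow> ind C B A"
  by (rule independence_ax[THEN conjunct2, THEN conjunct2, THEN conjunct1, rule_format]) auto

lemma transitivity:
  "B \<subseteq> C \<Longrightarrow> C \<subseteq> D \<Longrightarrow> sm A \<Longrightarrow> sm D \<Longrightarrow> ind A B D \<longleftrightarrow> ind A B C \<and> ind A C D"
  by (rule independence_ax[THEN conjunct2, THEN conjunct2, THEN conjunct2, THEN conjunct1, rule_format])
    (use sm_subset[of D C] sm_subset[of C B] in auto)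

lemma finite_character:
  "sm A \<Longrightarrow> sm B \<Longrightarrow> sm C \<Longrightarrow> ind A B C \<longleftrightarrow> (\<forall>F. finite F \<and> F \<subseteq> A \<longrightarrow> ind F B C)"
  by (rule independence_ax[THEN conjunct2, THEN conjunct2, THEN conjunct2, THEN conjunct2, THEN conjunct1, rule_format]) auto

lemma extension:
  "sm A \<Longrightarrow> sm B \<Longrightarrow> sm C \<Longrightarrow> \<exists>A'. sm A' \<and> equiv_over L N B A A' \<and> ind A' B C"
  by (rule independence_ax[THEN conjunct2, THEN conjunct2, THEN conjunct2, THEN conjunct2, THEN conjunct2, THEN conjunct1, rule_format]) auto

lemma mono_left:
  assumes "ind A B C" "A' \<subseteq> A" "sm A" "sm B" "sm C"
  shows "ind A' B C"
proof (rule finite_character[OF sm_subset[OF assms(3,2)] assms(4,5), THEN iffD2], intro allI impI)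
  fix F assume "finite F \<and> F \<subseteq> A'"
  then have "finite F \<and> F \<subseteq> A" using assms(2) by blast
  then show "ind F B C"
    using finite_character[OF assms(3-5), THEN iffD1, OF assms(1)] by blast
qed

lemma mono_right:
  assumes "ind A B C" "C' \<subseteq> C" "sm A" "sm B" "sm C"
  shows "ind A B C'"
proof -
  have "ind C' B A" by (rule mono_left[OF sym[OF assms(1,3-5)] assms(2,5,4,3)])
  then show ?thesis by (rule sym) (use assms sm_subset in auto)
qed

lemma absorb_right:
  assumes "ind A B C" "sm A" "sm B" "sm C"
  shows "ind A B (B \<union> C)"
proof -
  have "ind (C \<union> B) B A" by (rule normality[OF sym[OF assms] assms(4,3,2)])
  then have "ind A B (C \<union> B)" by (rule sym) (use assms in \<open>auto simp: sm_Un\<close>)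
  then show ?thesis by (simp add: Un_commute)
qed

lemma trans_right:
  assumes "ind A B C" "ind A (B \<union> C) D" "sm A" "sm B" "sm C" "sm D"
  shows "ind A B (C \<union> D)"
proof -
  have s: "sm (B \<union> C)" "sm (B \<union> C \<union> D)" using assms by (simp_all add: sm_Un)
  have "ind A B (B \<union> C)" using absorb_right assms by simp
  moreover have "ind A (B \<union> C) (B \<union> C \<union> D)" using absorb_right[OF assms(2)] assms s by simp
  ultimately have "ind A B (B \<union> C \<union> D)"
    by (intro transitivity[of B "B \<union> C" "B \<union> C \<union> D" A, THEN iffD2] conjI) (use assms s in auto)
  then show ?thesis by (rule mono_right) (use assms s in auto)
qed

lemma base_mono:
  assumes "ind A B (C \<union> D)" "sm A" "sm B" "sm C" "sm D"
  shows "ind A (B \<union> C) D"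
proof -
  have s: "sm (B \<union> C)" "sm (B \<union> C \<union> D)" "sm (C \<union> D)" using assms by (simp_all add: sm_Un)
  have "ind A B (B \<union> C \<union> D)" using absorb_right[OF assms(1)] assms s by (simp add: Un_assoc)
  then have "ind A (B \<union> C) (B \<union> C \<union> D)"
    by (intro transitivity[of B "B \<union> C" "B \<union> C \<union> D" A, THEN iffD1, THEN conjunct2]) (use assms s in auto)
  then show ?thesis by (rule mono_right) (use assms s in auto)
qed

lemma trans_left:
  assumes "ind A B C" "ind D (B \<union> A) C" "sm A" "sm B" "sm C" "sm D"
  shows "ind (A \<union> D) B C"
proof -
  have "ind C B A" using sym[OF assms(1)] assms by simp
  moreover have "ind C (B \<union> A) D" using sym[OF assms(2)] assms by (simp add: sm_Un)
  ultimately have "ind C B (A \<union> D)" by (rule trans_right) (use assms in auto)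
  then show ?thesis by (rule sym) (use assms in \<open>auto simp: sm_Un\<close>)
qed

text \<open>
  An element \<open>c\<close> independent of itself is independent of everything: the extension axiom over the
  base \<open>B \<union> {c}\<close> cannot move \<open>c\<close>.
\<close>

lemma cl_indep1:
  assumes "c \<in> cl B" "sm B" "sm D"
  shows "ind {c} B D"
proof -
  have c: "c \<in> carrier L N" "ind {c} B {c}" using assms(1) by (auto simp: closure_of_def)
  have s: "sm {c}" using c(1) by (intro sm_finite) auto
  obtain A' where A': "equiv_over L N (B \<union> {c}) {c} A'" "ind A' (B \<union> {c}) D"
    using extension[OF s sm_Un[OF assms(2) s] assms(3)] by blast
  have "A' = {c}" using A'(1) by (auto simp: equiv_over_def)
  then have "ind {c} B ({c} \<union> D)"
    using trans_right[OF c(2)] A'(2) s assms by simp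
  then show ?thesis by (rule mono_right) (use s assms sm_insert[OF c(1)] in auto)
qed

lemma cl_indep:
  assumes "X \<subseteq> cl B" "sm X" "sm B" "sm D"
  shows "ind X B D"
  unfolding finite_character[OF assms(2-4)]
proof (intro allI impI, elim conjE)
  fix F assume "finite F" "F \<subseteq> X"
  then show "ind F B D"
  proof (induction F rule: finite_induct)
    case empty
    have "sm {}" by (rule sm_finite) auto
    obtain A' where A': "equiv_over L N B {} A'" "ind A' B D"
      using extension[OF \<open>sm {}\<close> assms(3,4)] by blast
    then have "A' = {}" by (auto simp: equiv_over_def)
    then show ?case using A'(2) by simp
  next
    case (insert c F)
    have s: "sm F" "sm {c}" using insert.prems by (auto intro: sm_subset[OF assms(2)])
    have "ind {c} B (F \<union> D)"
      by (rule cl_indep1) (use insert.prems assms s in \<open>auto simp: sm_Un\<close>)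
    then have "ind {c} (B \<union> F) D" by (rule base_mono) (use s assms in auto)
    moreover have "ind F B D" using insert by auto
    ultimately have "ind (F \<union> {c}) B D" using s assms by (intro trans_left) auto
    then show ?case by simp
  qed
qed

lemma cl_mono: "B \<subseteq> B' \<Longrightarrow> sm B' \<Longrightarrow> cl B \<subseteq> cl B'"
proof
  fix c assume B: "B \<subseteq> B'" "sm B'" and c: "c \<in> cl B"
  then have s: "sm B" "sm {c}" using cl_carrier by (auto intro: sm_subset sm_finite)
  have "ind {c} B (B' \<union> {c})" by (rule cl_indep1[OF c s(1) sm_Un[OF B(2) s(2)]])
  then have "ind {c} (B \<union> B') {c}" using B s by (intro base_mono)
  then have "ind {c} B' {c}" using B(1) by (simp add: Un_absorb1)
  then show "c \<in> cl B'" using c cl_carrier by (auto simp: closure_of_def)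
qed

lemma cl_fixed:
  assumes "b \<in> carrier L N" "sm B"
    "\<And>f. elementary_map L N ({b} \<union> B) f \<Longrightarrow> \<forall>x\<in>B. f x = x \<Longrightarrow> f b = b"
  shows "b \<in> cl B"
proof -
  have s: "sm {b}" using assms(1) by (intro sm_finite) auto
  obtain A' where A': "equiv_over L N B {b} A'" "ind A' B {b}"
    using extension[OF s assms(2) s] by blast
  have "A' = {b}" using A'(1) assms(3) by (auto simp: equiv_over_def)
  then show ?thesis using A'(2) assms(1) by (simp add: closure_of_def)
qed

lemma subset_cl: "sm B \<Longrightarrow> B \<subseteq> cl B"
  using cl_fixed sm_carrier by blast

lemma extend_right:
  assumes "ind A B C" "X \<subseteq> cl (B \<union> C)" "sm A" "sm B" "sm C" "sm X"
  shows "ind A B (C \<union> X)"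
  by (rule trans_right[OF assms(1)]) (use assms sym[OF cl_indep[OF assms(2)]] in \<open>auto simp: sm_Un\<close>)

lemma extend_left:
  assumes "ind A B C" "X \<subseteq> cl (B \<union> A)" "sm A" "sm B" "sm C" "sm X"
  shows "ind (A \<union> X) B C"
  using sym[OF extend_right[OF sym[OF assms(1)] assms(2)]] assms by (simp add: sm_Un)

lemma base_up:
  assumes "ind A B C" "B \<subseteq> B'" "B' \<subseteq> cl (B \<union> C)" "sm A" "sm B'" "sm C"
  shows "ind A B' C"
proof -
  have s: "sm B" using sm_subset assms(2,5) by blast
  have "ind A B (B' \<union> C)" using extend_right[OF assms(1,3,4) s assms(6,5)] by (simp add: Un_commute)
  then have "ind A (B \<union> B') C" by (rule base_mono) (use s assms in auto)
  then show ?thesis using assms(2) by (simp add: Un_absorb1)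
qed

lemma base_down:
  assumes "ind A (B \<union> X) C" "X \<subseteq> cl B" "sm A" "sm B" "sm C" "sm X"
  shows "ind A B C"
proof -
  have "ind A B X" using sym[OF cl_indep[OF assms(2,6,4,3)]] assms by simp
  then have "ind A B (X \<union> C)" using assms by (intro trans_right)
  then show ?thesis by (rule mono_right) (use assms in \<open>auto simp: sm_Un\<close>)
qed

text \<open>
  Membership in the closure of \<open>R\<close> is witnessed by a base \<open>Q\<close> over which \<open>e\<close> is independent of
  \<open>R\<close>, hence is a property of \<open>e\<close> and \<open>Q\<close> alone.
\<close>

lemma cl_iff:
  assumes "ind {e} Q R" "Q \<subseteq> cl R" "e \<in> carrier L N" "sm Q" "sm R"
  shows "e \<in> cl R \<longleftrightarrow> e \<in> cl Q"
proof -
  have s: "sm {e}" "sm (Q \<union> R)" using assms by (auto intro: sm_finite simp: sm_Un)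
  show ?thesis
  proof
    assume "e \<in> cl R"
    then have "e \<in> cl (Q \<union> R)" using cl_mono[of R "Q \<union> R"] s by auto
    then have "ind {e} (Q \<union> R) {e}" by (simp add: closure_of_def)
    then have "ind {e} Q (R \<union> {e})" using assms s by (intro trans_right)
    then have "ind {e} Q {e}" by (rule mono_right) (use assms s sm_insert in auto)
    then show "e \<in> cl Q" using assms(3) by (simp add: closure_of_def)
  next
    assume "e \<in> cl Q"
    then have "e \<in> cl (R \<union> Q)" using cl_mono[of Q "R \<union> Q"] s by (auto simp: Un_commute)
    then have "ind {e} (R \<union> Q) {e}" by (simp add: closure_of_def)
    then have "ind {e} R {e}" using assms s by (intro base_down[of "{e}" R Q "{e}"])
    then show "e \<in> cl R" using assms(3) by (simp add: closure_of_def)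
  qed
qed

lemma cl_automorphism:
  assumes "automorphism L N \<sigma>" "e \<in> cl B" "sm B"
  shows "\<sigma> e \<in> cl (\<sigma> ` B)"
proof -
  have e: "e \<in> carrier L N" "ind {e} B {e}" using assms(2) by (auto simp: closure_of_def)
  then have "ind (\<sigma> ` {e}) (\<sigma> ` B) (\<sigma> ` {e})"
    using assms by (intro invariance) (auto intro: sm_finite)
  moreover have "\<sigma> e \<in> carrier L N" using e(1) assms(1) by (auto simp: automorphism_def bij_betw_def)
  ultimately show ?thesis by (simp add: closure_of_def)
qed

text \<open>
  Local character for finite tuples gives it for very small sets, by taking the union of the bases
  of all finite subsets. No regularity of \<open>\<kappa>\<close> is needed because the bases have size below
  \<open>\<nu> < \<kappa>\<close>.
\<close>

lemma very_small_local_character: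
  assumes flc: "finite_local_character L N \<mu> ind \<nu>" and \<nu>: "Cinfinite \<nu>" "\<nu> <o \<kappa>" and \<kappa>: "Card_order \<kappa>" "\<kappa> <o \<mu>"
    and A: "A \<subseteq> carrier L N" "|A| <o \<kappa>" and B: "sm B"
  shows "\<exists>B0\<subseteq>B. |B0| <o \<kappa> \<and> ind A B0 B"
proof -
  define \<F> where "\<F> = {F. F \<subseteq> A \<and> finite F}"
  have natk: "natLeq <o \<kappa>"
    using \<nu> natLeq_ordLeq_cinfinite[OF \<nu>(1)] ordLeq_ordLess_trans by blast
  have "\<forall>F\<in>\<F>. \<exists>B0. B0 \<subseteq> B \<and> |B0| <o \<nu> \<and> ind F B0 B"
    using flc A(1) B unfolding finite_local_character_def \<F>_def by blast
  from bchoice[OF this] obtain b where b: "\<forall>F\<in>\<F>. b F \<subseteq> B \<and> |b F| <o \<nu> \<and> ind F (b F) B" ..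
  define B0 where "B0 = (\<Union>F\<in>\<F>. b F)"
  have B0: "B0 \<subseteq> B" using b by (auto simp: B0_def)
  have "|B0| <o \<kappa>"
    unfolding B0_def
  proof (rule card_UN_ordLess[OF \<kappa>(1) \<nu>])
    show "|\<F>| <o \<kappa>" unfolding \<F>_def by (rule card_finite_subsets_ordLess[OF A(2) \<kappa>(1) natk])
    show "|b F| \<le>o \<nu>" if "F \<in> \<F>" for F using b that ordLess_imp_ordLeq by blast
  qed
  moreover have "ind A B0 B"
  proof -
    have sA: "sm A" using A ordLess_transitive[OF A(2) \<kappa>(2)] by (simp add: small_def)
    have "ind F B0 B" if "finite F" "F \<subseteq> A" for F
    proof (rule base_up)
      have F: "F \<in> \<F>" using that by (simp add: \<F>_def)
      show "ind F (b F) B" using b F by blast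
      show "b F \<subseteq> B0" using F by (auto simp: B0_def)
      have "b F \<union> B = B" using b F by blast
      then show "B0 \<subseteq> cl (b F \<union> B)" using B0 subset_cl[OF B] by simp
      show "sm F" using sA that(2) by (rule sm_subset)
    qed (use B sm_subset[OF B B0] in auto)
    then show ?thesis using finite_character[OF sA sm_subset[OF B B0] B] by blast
  qed
  ultimately show ?thesis using B0 by blast
qed

end

section \<open>Lovely pairs\<close>

text \<open>
  The setting of the theorem, without the pairs: a monster model with an independence relation on
  the home sort and one extending it to imaginaries, and cardinals \<open>\<kappa>0 < \<kappa> < \<mu>\<close> such that finite
  tuples have local character below \<open>\<kappa>0\<close>. Very small means of cardinality below \<open>\<kappa>\<close>.
\<close>

locale lovely_pairs =
  monster L N \<mu> + home: indep_rel L N \<mu> ind + im: indep_rel "eq_lang L N" "eq_struct N" \<mu> ind_eq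
  for L :: "(unit, 'f, 'r) lang" and N :: "(unit, 'f, 'r, 'a) struct" and \<mu> :: "'k rel"
    and ind :: "'a set \<Rightarrow> 'a set \<Rightarrow> 'a set \<Rightarrow> bool"
    and ind_eq :: "('f, 'r, 'a) eq_elem set \<Rightarrow> ('f, 'r, 'a) eq_elem set \<Rightarrow> ('f, 'r, 'a) eq_elem set \<Rightarrow> bool" +
  fixes \<kappa> \<kappa>0 :: "'k rel"
  assumes Card_order_kappa: "Card_order \<kappa>" and kappa_mu: "\<kappa> <o \<mu>" and kappa0_kappa: "\<kappa>0 <o \<kappa>"
    and Cinfinite_kappa0: "Cinfinite \<kappa>0" and local_kappa0: "finite_local_character L N \<mu> ind \<kappa>0"
    and extends: "extends_to_eq L N \<mu> ind ind_eq"
begin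

abbreviation smE where "smE \<equiv> small Le Ne \<mu>"
abbreviation clE where "clE \<equiv> closure_of Le Ne ind_eq"

lemma kappa_uncountable: "natLeq <o \<kappa>"
  using natLeq_ordLeq_cinfinite[OF Cinfinite_kappa0] kappa0_kappa by (rule ordLeq_ordLess_trans)

lemmas kappa_facts = Card_order_kappa kappa_uncountable

lemma very_small: "|A| <o \<kappa> \<Longrightarrow> |A| <o \<mu>"
  using ordLess_transitive kappa_mu by blast

lemma sm_U: "home.sm A \<longleftrightarrow> A \<subseteq> U \<and> |A| <o \<mu>"
  by (simp add: small_def carrier_L)

lemma smE_Elt: "home.sm A \<Longrightarrow> smE (Elt ` A)"
  using card_image_ordLess by (auto simp: small_def carrier_L Elt_Ue)

lemma smE_very_small: "A \<subseteq> eq_set L N U \<Longrightarrow> |A| <o \<kappa> \<Longrightarrow> smE A"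
  by (simp add: small_def carrier_Le very_small)

lemma sm_very_small: "A \<subseteq> U \<Longrightarrow> |A| <o \<kappa> \<Longrightarrow> home.sm A"
  by (simp add: sm_U very_small)

lemma ind_Elt:
  "home.sm A \<Longrightarrow> home.sm B \<Longrightarrow> home.sm C \<Longrightarrow> ind_eq (Elt ` A) (Elt ` B) (Elt ` C) \<longleftrightarrow> ind A B C"
  using extends by (simp add: extends_to_eq_def)

text \<open>
  Imaginaries with representatives in \<open>B\<close> are definable over \<open>B\<close>, hence in its closure.
\<close>

lemma eq_set_cl:
  assumes "home.sm B"
  shows "eq_set L N B \<subseteq> clE (Elt ` B)"
proof
  fix e assume e: "e \<in> eq_set L N B"
  have BU: "B \<subseteq> U" using assms by (simp add: sm_U)
  obtain s xs where s: "s \<in> sorts Le" "xs \<in> tuples B (arity s)" "e = cls N s xs"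
    using e by (auto simp: eq_set_cls)
  have xsU: "xs \<in> tuples U (arity s)" using s(2) BU by (auto simp: tuples_def)
  show "e \<in> clE (Elt ` B)"
  proof (rule im.cl_fixed)
    show "e \<in> Ue" using e eq_set_mono[OF BU] by (auto simp: carrier_Le)
    show "smE (Elt ` B)" by (rule smE_Elt[OF assms])
    fix f assume f: "elementary_map Le Ne ({e} \<union> Elt ` B) f" "\<forall>x\<in>Elt ` B. f x = x"
    have G: "elem_rel Le Ne ((\<lambda>x. (id x, f x)) ` ({e} \<union> Elt ` B))"
      using f(1) by (simp only: elementary_map_def same_type_iff_elem_rel)
    have "f e = cls N s (map id xs)"
    proof (rule elem_rel_cls[OF G _ s(3,1) xsU])
      show "(e, f e) \<in> (\<lambda>x. (id x, f x)) ` ({e} \<union> Elt ` B)" by auto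
      show "(Elt x, Elt (id x)) \<in> (\<lambda>x. (id x, f x)) ` ({e} \<union> Elt ` B)" if "x \<in> set xs" for x
      proof -
        have "x \<in> B" using that s(2) by (auto simp: tuples_def)
        then show ?thesis using f(2) by (intro image_eqI[of _ _ "Elt x"]) auto
      qed
    qed
    then show "f e = e" using s(3) by simp
  qed
qed

lemma eq_set_cl_subset: "home.sm B \<Longrightarrow> A \<subseteq> eq_set L N B \<Longrightarrow> Elt ` B \<subseteq> C \<Longrightarrow> smE C \<Longrightarrow> A \<subseteq> clE C"
  using eq_set_cl[of B] im.cl_mono[of "Elt ` B" C] by blast

text \<open>The extension axiom, with an automorphism of the home sort as a witness.\<close>

lemma extension_automorphism:
  assumes "smE A" "smE B" "smE C"
  shows "\<exists>\<sigma>. automorphism L N \<sigma> \<and> (\<forall>b\<in>B. eq_map \<sigma> b = b) \<and> ind_eq (eq_map \<sigma> ` A) B C"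
proof -
  obtain A' where A': "equiv_over Le Ne B A A'" "ind_eq A' B C"
    using im.extension[OF assms] by blast
  obtain \<sigma> where "automorphism L N \<sigma>" "\<forall>b\<in>B. eq_map \<sigma> b = b" "eq_map \<sigma> ` A = A'"
    using equiv_over_automorphism[OF A'(1) assms(1,2)] by blast
  then show ?thesis using A'(2) by blast
qed

lemma image_fixed: "\<forall>x\<in>A. f x = x \<Longrightarrow> f ` A = A"
  by simp

lemma eq_map_inverse:
  assumes "automorphism L N \<sigma>"
  shows "\<exists>\<tau>. automorphism L N \<tau> \<and> (\<forall>e\<in>Ue. eq_map \<tau> (eq_map \<sigma> e) = e)"
proof -
  obtain \<tau> where \<tau>: "automorphism L N \<tau>" "\<forall>x\<in>U. \<tau> (\<sigma> x) = x"
    using automorphism_inverse[OF assms] by blast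
  have "eq_map \<tau> (eq_map \<sigma> e) = e" if "e \<in> Ue" for e
    unfolding eq_map_comp[symmetric]
    by (rule eq_map_fixes[OF automorphism_comp[OF assms \<tau>(1)] order_refl])
      (use \<tau>(2) that in \<open>auto simp: carrier_Le\<close>)
  then show ?thesis using \<tau>(1) by blast
qed

lemma eq_map_Ue: "automorphism L N \<sigma> \<Longrightarrow> e \<in> Ue \<Longrightarrow> eq_map \<sigma> e \<in> Ue"
  using eq_map_eq_set[of \<sigma> U] aut_image_U by (auto simp: carrier_Le)

lemma smE_eq_map: "automorphism L N \<sigma> \<Longrightarrow> smE A \<Longrightarrow> smE (eq_map \<sigma> ` A)"
  using eq_map_Ue card_image_ordLess by (auto simp: small_def)

lemma eq_map_cl_iff:
  assumes "automorphism L N \<sigma>" "e \<in> Ue" "smE B"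
  shows "eq_map \<sigma> e \<in> clE (eq_map \<sigma> ` B) \<longleftrightarrow> e \<in> clE B"
proof
  obtain \<tau> where \<tau>: "automorphism L N \<tau>" "\<forall>e\<in>Ue. eq_map \<tau> (eq_map \<sigma> e) = e"
    using eq_map_inverse[OF assms(1)] by blast
  have BU: "B \<subseteq> Ue" by (rule im.sm_carrier[OF assms(3)])
  have "eq_map \<tau> ` eq_map \<sigma> ` B = B"
    unfolding image_image by (rule image_fixed) (use \<tau>(2) BU in blast)
  moreover assume "eq_map \<sigma> e \<in> clE (eq_map \<sigma> ` B)"
  then have "eq_map \<tau> (eq_map \<sigma> e) \<in> clE (eq_map \<tau> ` eq_map \<sigma> ` B)"
    by (rule im.cl_automorphism[OF eq_map_automorphism[OF \<tau>(1)] _ smE_eq_map[OF assms(1,3)]])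
  ultimately show "e \<in> clE B" using \<tau>(2) assms(2) by simp
next
  assume "e \<in> clE B"
  then show "eq_map \<sigma> e \<in> clE (eq_map \<sigma> ` B)"
    by (rule im.cl_automorphism[OF eq_map_automorphism[OF assms(1)] _ assms(3)])
qed

lemma ind_eq_map:
  "ind_eq A B C \<Longrightarrow> automorphism L N \<sigma> \<Longrightarrow> smE A \<Longrightarrow> smE B \<Longrightarrow> smE C \<Longrightarrow>
     ind_eq (eq_map \<sigma> ` A) (eq_map \<sigma> ` B) (eq_map \<sigma> ` C)"
  by (rule im.invariance[OF _ eq_map_automorphism])

subsection \<open>The density property for very small tuples\<close>

context
  fixes M PM :: "'a set"
  assumes lovely: "lovely_pair L N \<mu> ind \<kappa> M PM"
begin

lemma elementary_M: "elementary_substructure L N M"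
  using lovely by (simp add: lovely_pair_def is_pair_def)

lemma PM_M: "PM \<subseteq> M"
  using lovely by (simp add: lovely_pair_def is_pair_def)

lemma sm_M: "home.sm M"
  using lovely by (simp add: lovely_pair_def)

lemma M_U: "M \<subseteq> U"
  using sm_M by (simp add: sm_U)

lemma sm_PM: "home.sm PM"
  by (rule home.sm_subset[OF sm_M PM_M])

lemma smE_PM: "smE (Elt ` PM)"
  by (rule smE_Elt[OF sm_PM])

lemma density:
  assumes "B \<subseteq> M" "|B| <o \<kappa>" "c \<in> U" "ind {c} (PM \<inter> B) B"
  shows "\<exists>b\<in>PM. realizes N b (tp L N B c)"
proof -
  have "type_indep N ind (tp L N B c) (PM \<inter> B) B"
    using assms(3,4) realizes_tp[OF assms(3), of L B] by (auto simp: type_indep_def)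
  then show ?thesis using lovely tp_S1[OF assms(3), of L B] assms(1,2) by (simp add: lovely_pair_def)
qed

lemma extension_property:
  assumes "B \<subseteq> M" "|B| <o \<kappa>" "c \<in> U"
  shows "\<exists>b\<in>M. realizes N b (tp L N B c) \<and> ind {b} B PM"
  using lovely tp_S1[OF assms(3), of L B] assms(1,2) by (simp add: lovely_pair_def)

text \<open>
  The density property for types of very small tuples \<open>X\<close>: realize the members of \<open>X\<close> in \<open>P\<close> one
  at a time, adding each realization to the base. Zorn's lemma for partial elementary maps fixing
  \<open>B\<close> and sending a subset of \<open>X\<close> into \<open>P\<close> replaces a transfinite recursion.
\<close>

lemma density_tuple:
  assumes B: "B \<subseteq> M" "|B| <o \<kappa>" and X: "X \<subseteq> U" "|X| <o \<kappa>" and ind: "ind X (PM \<inter> B) B"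
  shows "\<exists>\<rho>. automorphism L N \<rho> \<and> (\<forall>b\<in>B. \<rho> b = b) \<and> \<rho> ` X \<subseteq> PM"
proof -
  have BU: "B \<subseteq> U" using B(1) M_U by blast
  define \<A> where "\<A> = {G. Id_on B \<subseteq> G \<and> G \<subseteq> Id_on B \<union> X \<times> PM \<and> elem_rel L N G}"
  have "\<exists>G\<in>\<A>. \<forall>Y\<in>\<A>. G \<subseteq> Y \<longrightarrow> Y = G"
  proof (rule subset_Zorn_nonempty)
    have "automorphism L N id" by (auto simp: automorphism_def)
    then have "elem_rel L N (Id_on B)"
      by (rule elem_rel_automorphism[OF is_struct_N fcod_sorted_L]) (use BU in \<open>auto simp: carrier_L\<close>)
    then have "Id_on B \<in> \<A>" by (simp add: \<A>_def)
    then show "\<A> \<noteq> {}" by blast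
    fix \<C> assume \<C>: "\<C> \<noteq> {}" "subset.chain \<A> \<C>"
    then have mem: "Id_on B \<subseteq> G" "G \<subseteq> Id_on B \<union> X \<times> PM" "elem_rel L N G" if "G \<in> \<C>" for G
      using that by (auto simp: subset.chain_def \<A>_def)
    have "elem_rel L N (\<Union>\<C>)" by (rule elem_rel_Union_chain[OF \<C>(2,1) mem(3)])
    moreover have "Id_on B \<subseteq> \<Union>\<C>" using mem(1) \<C>(1) by blast
    moreover have "\<Union>\<C> \<subseteq> Id_on B \<union> X \<times> PM" using mem(2) by (rule Sup_least)
    ultimately show "\<Union>\<C> \<in> \<A>" by (simp add: \<A>_def)
  qed
  then obtain G where G: "G \<in> \<A>" and max: "\<forall>Y\<in>\<A>. G \<subseteq> Y \<longrightarrow> Y = G" ..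
  have IG: "Id_on B \<subseteq> G" and GX: "G \<subseteq> Id_on B \<union> X \<times> PM" and eG: "elem_rel L N G"
    using G by (auto simp: \<A>_def)
  have domG: "x \<in> U" if "(x, y) \<in> G" for x y using GX that BU X(1) by auto
  have "fst ` G \<subseteq> B \<union> X" using GX by auto
  then have "|fst ` G| <o \<kappa>"
    by (rule card_subset_ordLess[OF card_Un_ordLess[OF kappa_facts B(2) X(2)]])
  from elem_rel_card[OF eG _ this] have cG: "|G| <o \<kappa>" using domG by (simp add: carrier_L)
  obtain \<sigma> where \<sigma>: "automorphism L N \<sigma>" and \<sigma>G': "\<forall>(x, y)\<in>G. y = \<sigma> x"
    using home_homogeneous[OF eG _ very_small[OF cG]] domG by blast
  have \<sigma>G: "y = \<sigma> x" if "(x, y) \<in> G" for x y using \<sigma>G' that by auto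
  have \<sigma>B: "\<sigma> b = b" if "b \<in> B" for b using \<sigma>G[of b b] IG that by (auto simp: Id_on_def)
  have "\<sigma> x \<in> PM" if x: "x \<in> X" for x
  proof -
    \<comment> \<open>\<open>X1\<close> is the part of \<open>X\<close> already sent into \<open>P\<close>, and \<open>B1\<close> is the range of \<open>G\<close>.\<close>
    define X1 where "X1 = {x \<in> X. \<exists>b\<in>PM. (x, b) \<in> G}"
    define B1 where "B1 = B \<union> \<sigma> ` X1"
    have X1: "X1 \<subseteq> X" "\<sigma> ` X1 \<subseteq> PM" using \<sigma>G by (auto simp: X1_def)
    have sndG: "\<sigma> u \<in> B1" if "(u, y) \<in> G" for u y
    proof -
      have "u = y \<and> u \<in> B \<or> u \<in> X \<and> y \<in> PM" using GX that by auto
      then show ?thesis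
      proof
        assume "u \<in> X \<and> y \<in> PM"
        then have "u \<in> X1" using that by (auto simp: X1_def)
        then show ?thesis by (simp add: B1_def)
      qed (use \<sigma>B in \<open>auto simp: B1_def\<close>)
    qed
    have B1: "B1 \<subseteq> M" using B(1) X1(2) PM_M by (auto simp: B1_def)
    have cX1: "|X1| <o \<kappa>" by (rule card_subset_ordLess[OF X(2) X1(1)])
    have cB1: "|B1| <o \<kappa>" unfolding B1_def
      by (rule card_Un_ordLess[OF kappa_facts B(2) card_image_ordLess[OF cX1]])
    have sX: "home.sm X" and sB: "home.sm B" and sB1: "home.sm B1"
      using sm_very_small X B(2) BU B1 cB1 M_U by auto
    have sX1: "home.sm X1" and sx: "home.sm {x}" and sP: "home.sm (PM \<inter> B)"
      using home.sm_subset[OF sX] home.sm_subset[OF sB] X1(1) x by auto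
    have sPX: "home.sm (PM \<inter> B \<union> X1)" using sP sX1 by (rule home.sm_Un)
    have "ind B (PM \<inter> B) (X1 \<union> {x})"
      by (rule home.sym[OF home.mono_left[OF ind]]) (use X1 x sX sP sB sX1 sx home.sm_Un[OF sX1 sx] in auto)
    then have "ind B (PM \<inter> B \<union> X1) {x}" by (rule home.base_mono) (use sB sP sX1 sx in auto)
    then have "ind {x} (PM \<inter> B \<union> X1) B" by (rule home.sym) (use sB sPX sx in auto)
    then have "ind (\<sigma> ` {x}) (\<sigma> ` (PM \<inter> B \<union> X1)) (\<sigma> ` B)"
      by (rule home.invariance[OF _ \<sigma>]) (use sB sPX sx in auto)
    moreover have "\<sigma> ` B = B" "\<sigma> ` (PM \<inter> B) = PM \<inter> B" using \<sigma>B by auto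
    ultimately have 1: "ind {\<sigma> x} (PM \<inter> B \<union> \<sigma> ` X1) B" by (simp add: image_Un)
    have s: "home.sm {\<sigma> x}" "home.sm (\<sigma> ` X1)" "home.sm (PM \<inter> B \<union> \<sigma> ` X1)" "home.sm (PM \<inter> B1)"
    proof -
      show "home.sm {\<sigma> x}" using aut_U[OF \<sigma>] X(1) x by (intro home.sm_finite) (auto simp: carrier_L)
      show 2: "home.sm (\<sigma> ` X1)" by (rule home.sm_subset[OF sB1]) (simp add: B1_def)
      show "home.sm (PM \<inter> B \<union> \<sigma> ` X1)" by (rule home.sm_Un[OF sP 2])
      show "home.sm (PM \<inter> B1)" by (rule home.sm_subset[OF sB1]) simp
    qed
    have "ind {\<sigma> x} (PM \<inter> B \<union> \<sigma> ` X1) (B \<union> \<sigma> ` X1)"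
    proof (rule home.extend_right[OF 1])
      have "PM \<inter> B \<union> \<sigma> ` X1 \<union> B = B1" by (auto simp: B1_def)
      then show "\<sigma> ` X1 \<subseteq> home.cl (PM \<inter> B \<union> \<sigma> ` X1 \<union> B)"
        using home.subset_cl[OF sB1] by (auto simp: B1_def)
    qed (use s sB in auto)
    then have "ind {\<sigma> x} (PM \<inter> B \<union> \<sigma> ` X1) B1" by (simp add: B1_def)
    then have "ind {\<sigma> x} (PM \<inter> B1) B1"
    proof (rule home.base_up)
      show "PM \<inter> B \<union> \<sigma> ` X1 \<subseteq> PM \<inter> B1" using X1(2) by (auto simp: B1_def)
      have "PM \<inter> B \<union> \<sigma> ` X1 \<union> B1 = B1" by (auto simp: B1_def)
      then show "PM \<inter> B1 \<subseteq> home.cl (PM \<inter> B \<union> \<sigma> ` X1 \<union> B1)" using home.subset_cl[OF sB1] by auto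
    qed (use s sB1 in auto)
    moreover have \<sigma>xU: "\<sigma> x \<in> U" using aut_U[OF \<sigma>] X(1) x by blast
    ultimately obtain b where b: "b \<in> PM" "realizes N b (tp L N B1 (\<sigma> x))"
      using density[OF B1 cB1] by blast
    have B1U: "B1 \<subseteq> U" using B1 M_U by blast
    obtain \<rho> where \<rho>: "automorphism L N \<rho>" "\<forall>u\<in>B1. \<rho> u = u" "\<rho> (\<sigma> x) = b"
      using realizes_tp_automorphism[OF B1U very_small[OF cB1] \<sigma>xU b(2)] by blast
    have "elem_rel L N (insert (x, b) G)"
    proof (rule elem_rel_automorphism[OF is_struct_N fcod_sorted_L automorphism_comp[OF \<sigma> \<rho>(1)]])
      fix u y assume uy: "(u, y) \<in> insert (x, b) G"
      show "u \<in> carrier L N \<and> y = \<rho> (\<sigma> u)"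
      proof (cases "(u, y) = (x, b)")
        case True
        then show ?thesis using \<rho>(3) X(1) x by (auto simp: carrier_L)
      next
        case False
        then have "(u, y) \<in> G" using uy by auto
        then show ?thesis using \<rho>(2) sndG \<sigma>G domG by (auto simp: carrier_L)
      qed
    qed
    then have "insert (x, b) G \<in> \<A>" using IG GX b(1) x by (auto simp: \<A>_def)
    then have "(x, b) \<in> G" using max by blast
    then show ?thesis using \<sigma>G b(1) by blast
  qed
  then show ?thesis using \<sigma> \<sigma>B by blast
qed

lemma local_PM:
  assumes "B \<subseteq> U" "|B| <o \<kappa>"
  shows "\<exists>A0\<subseteq>PM. |A0| <o \<kappa> \<and> ind B A0 PM"
  by (rule home.very_small_local_character[OF local_kappa0 Cinfinite_kappa0 kappa0_kappa
      Card_order_kappa kappa_mu _ assms(2) sm_PM]) (simp add: carrier_L assms(1))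

text \<open>
  An imaginary \<open>e\<close> of \<open>M\<close> in the closure of \<open>P\<close> has a representative in \<open>P\<close>: it is in the closure
  of a very small \<open>A0 \<subseteq> P\<close>, so that a generic representative over \<open>e\<close> and \<open>A0\<close> is independent
  over \<open>A0\<close>, and the density property moves it into \<open>P\<close> without moving \<open>e\<close>.
\<close>

lemma P_eq_set: "clE (Elt ` PM) \<inter> eq_set L N M = eq_set L N PM"
proof
  show "eq_set L N PM \<subseteq> clE (Elt ` PM) \<inter> eq_set L N M"
    using eq_set_cl[OF sm_PM] eq_set_mono[OF PM_M] by blast
  show "clE (Elt ` PM) \<inter> eq_set L N M \<subseteq> eq_set L N PM"
  proof
    fix e assume "e \<in> clE (Elt ` PM) \<inter> eq_set L N M"
    then have ecl: "e \<in> clE (Elt ` PM)" and eM: "e \<in> eq_set L N M" by auto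
    obtain s xs where s: "s \<in> sorts Le" "xs \<in> tuples M (arity s)" "e = cls N s xs"
      using eM by (auto simp: eq_set_cls)
    define F where "F = set xs"
    have F: "finite F" "F \<subseteq> M" "e \<in> eq_set L N F"
      using s by (auto simp: F_def tuples_def eq_set_cls)
    have FU: "F \<subseteq> U" using F(2) M_U by blast
    have xsU: "xs \<in> tuples U (arity s)" using s(2) M_U by (auto simp: tuples_def)
    have cF: "|F| <o \<kappa>" by (rule card_finite_ordLess[OF kappa_uncountable F(1)])
    obtain A0 where A0: "A0 \<subseteq> PM" "|A0| <o \<kappa>" "ind F A0 PM" using local_PM[OF FU cF] by blast
    have A0U: "A0 \<subseteq> U" using A0(1) PM_M M_U by blast
    define B where "B = A0 \<union> F"
    have B: "B \<subseteq> M" "|B| <o \<kappa>"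
      using A0(1) PM_M F(2) card_Un_ordLess[OF kappa_facts A0(2) cF] by (auto simp: B_def)
    have eU: "e \<in> Ue" using ecl im.cl_carrier by blast
    have sF: "home.sm F" and sA: "home.sm A0" and sB: "home.sm B"
      using sm_very_small FU A0U cF A0(2) B M_U by auto
    have sE: "smE (Elt ` F)" "smE (Elt ` A0)" "smE (Elt ` B)" "smE {e}" "smE (Elt ` A0 \<union> {e})"
      using smE_Elt sF sA sB im.sm_finite[of "{e}"] eU im.sm_Un[of "Elt ` A0" "{e}"] by auto
    have "ind_eq (Elt ` F) (Elt ` A0) (Elt ` PM)" using A0(3) ind_Elt[OF sF sA sm_PM] by simp
    then have "ind_eq (Elt ` F \<union> {e}) (Elt ` A0) (Elt ` PM)"
    proof (rule im.extend_left)
      show "{e} \<subseteq> clE (Elt ` A0 \<union> Elt ` F)"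
        by (rule eq_set_cl_subset[OF sF]) (use F(3) im.sm_Un sE in auto)
    qed (use sE smE_PM in auto)
    then have "ind_eq {e} (Elt ` A0) (Elt ` PM)"
      by (rule im.mono_left) (use sE smE_PM im.sm_insert[OF eU] in auto)
    moreover have "Elt ` A0 \<subseteq> clE (Elt ` PM)" using im.subset_cl[OF smE_PM] A0(1) by blast
    ultimately have eA: "e \<in> clE (Elt ` A0)" using im.cl_iff ecl eU sE smE_PM by blast
    obtain \<tau> where \<tau>: "automorphism L N \<tau>" "\<forall>b\<in>Elt ` A0 \<union> {e}. eq_map \<tau> b = b"
      "ind_eq (eq_map \<tau> ` Elt ` F) (Elt ` A0 \<union> {e}) (Elt ` B)"
      using extension_automorphism[OF sE(1,5,3)] by blast
    have \<tau>F: "\<tau> ` F \<subseteq> U" "|\<tau> ` F| <o \<kappa>" using aut_U[OF \<tau>(1)] FU card_image_ordLess[OF cF] by auto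
    have s\<tau>: "home.sm (\<tau> ` F)" using \<tau>F by (rule sm_very_small)
    have "ind_eq (Elt ` \<tau> ` F) (Elt ` A0) (Elt ` B)"
      by (rule im.base_down[OF \<tau>(3)[unfolded eq_map_Elt_image]]) (use eA sE smE_Elt[OF s\<tau>] in auto)
    then have "ind (\<tau> ` F) A0 B" using ind_Elt[OF s\<tau> sA sB] by simp
    then have "ind (\<tau> ` F) (PM \<inter> B) B"
    proof (rule home.base_up)
      show "A0 \<subseteq> PM \<inter> B" using A0(1) by (auto simp: B_def)
      have "A0 \<union> B = B" by (auto simp: B_def)
      then show "PM \<inter> B \<subseteq> home.cl (A0 \<union> B)" using home.subset_cl[OF sB] by auto
      show "home.sm (PM \<inter> B)" by (rule home.sm_subset[OF sB]) simp
    qed (use s\<tau> sB in auto)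
    from density_tuple[OF B \<tau>F this] obtain \<rho> where \<rho>: "automorphism L N \<rho>" "\<forall>b\<in>B. \<rho> b = b"
      "\<rho> ` \<tau> ` F \<subseteq> PM" by blast
    have "e \<in> eq_set L N B" using F(3) eq_set_mono[of F B] by (auto simp: B_def)
    then have "eq_map \<rho> e = e"
      using eq_map_fixes[OF \<rho>(1), of B] \<rho>(2) B(1) M_U by blast
    moreover have "eq_map \<tau> e = e" using \<tau>(2) by simp
    ultimately have "e = eq_map (\<lambda>x. \<rho> (\<tau> x)) e" by (simp add: eq_map_comp)
    also have "\<dots> = cls N s (map (\<lambda>x. \<rho> (\<tau> x)) xs)"
      using eq_map_cls[OF automorphism_comp[OF \<tau>(1) \<rho>(1)] s(1) xsU] s(3) by simp
    finally have "e = cls N s (map (\<lambda>x. \<rho> (\<tau> x)) xs)" .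
    moreover have "map (\<lambda>x. \<rho> (\<tau> x)) xs \<in> tuples PM (arity s)"
      using \<rho>(3) s(2) by (auto simp: tuples_def F_def)
    ultimately show "e \<in> eq_set L N PM" using s(1) by (auto simp: eq_set_cls)
  qed
qed

end

end

context lovely_pairs
begin

subsection \<open>Local character over imaginaries\<close>

text \<open>
  The cardinal \<open>\<kappa>0\<close> controls bases in the home sort only. A base consisting of imaginaries is
  replaced by representatives that are generic over them, in the following sense: \<open>R\<close> is a set of
  pairs of an imaginary in \<open>E\<close> and a finite set of elements of the home sort over which it is
  defined, one for each imaginary, and the elements attached to a set of imaginaries are
  independent over that set from \<open>E\<close> and \<open>Z\<close>.
\<close>

definition independent_reps where
  "independent_reps E Z R \<longleftrightarrow> inj_on fst R \<and>
     (\<forall>p\<in>R. fst p \<in> E \<and> finite (snd p) \<and> snd p \<subseteq> U \<and> fst p \<in> eq_set L N (snd p)) \<and>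
     (\<forall>R0. R0 \<subseteq> R \<longrightarrow> ind_eq (Elt ` \<Union>(snd ` R0)) (fst ` R0) (E \<union> Z))"

lemma independent_repsD:
  assumes "independent_reps E Z R"
  shows "inj_on fst R"
    "p \<in> R \<Longrightarrow> fst p \<in> E \<and> finite (snd p) \<and> snd p \<subseteq> U \<and> fst p \<in> eq_set L N (snd p)"
    "R0 \<subseteq> R \<Longrightarrow> ind_eq (Elt ` \<Union>(snd ` R0)) (fst ` R0) (E \<union> Z)"
  using assms by (simp_all add: independent_reps_def)

lemma independent_reps_sm:
  assumes "independent_reps E Z R" "smE E" "R0 \<subseteq> R"
  shows "home.sm (\<Union>(snd ` R0))" "smE (fst ` R0)"
proof -
  have fE: "fst ` R \<subseteq> E" using independent_repsD(2)[OF assms(1)] by auto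
  show "smE (fst ` R0)" by (rule im.sm_subset[OF assms(2)]) (use fE assms(3) in auto)
  have "|fst ` R| <o \<mu>" by (rule card_subset_ordLess[OF im.sm_card[OF assms(2)] fE])
  from card_inj_on_ordLess[OF this independent_repsD(1)[OF assms(1)]]
  have "|R0| <o \<mu>" using assms(3) by (rule card_subset_ordLess)
  then have "|\<Union>p\<in>R0. snd p| <o \<mu>"
  proof (rule card_UN_finite_ordLess[OF mu_facts])
    show "finite (snd p)" if "p \<in> R0" for p
      using independent_repsD(2)[OF assms(1) subsetD[OF assms(3) that]] by simp
  qed
  moreover have "(\<Union>p\<in>R0. snd p) \<subseteq> U"
  proof (rule UN_least)
    show "snd p \<subseteq> U" if "p \<in> R0" for p
      using independent_repsD(2)[OF assms(1) subsetD[OF assms(3) that]] by simp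
  qed
  ultimately show "home.sm (\<Union>(snd ` R0))" by (simp add: sm_U)
qed

lemma independent_reps_exist:
  assumes E: "smE E" and Z: "smE Z"
  shows "\<exists>R. independent_reps E Z R \<and> fst ` R = E"
proof -
  have sEZ: "smE (E \<union> Z)" using E Z by (rule im.sm_Un)
  define \<A> where "\<A> = {R. independent_reps E Z R}"
  have "\<exists>R\<in>\<A>. \<forall>Y\<in>\<A>. R \<subseteq> Y \<longrightarrow> Y = R"
  proof (rule subset_Zorn_nonempty)
    have "ind_eq {} {} (E \<union> Z)" by (rule im.cl_indep) (use sEZ im.sm_finite[of "{}"] in auto)
    then have "{} \<in> \<A>" by (simp add: \<A>_def independent_reps_def)
    then show "\<A> \<noteq> {}" by blast
    fix \<C> assume \<C>: "\<C> \<noteq> {}" "subset.chain \<A> \<C>"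
    have mem: "independent_reps E Z R" if "R \<in> \<C>" for R
      using that \<C>(2) by (auto simp: subset.chain_def \<A>_def)
    have fin: "\<exists>R\<in>\<C>. F \<subseteq> R" if "finite F" "F \<subseteq> \<Union>\<C>" for F
      using finite_subset_chain[OF \<C>(2) that] \<C>(1) by (cases "F = {}") auto
    have basic: "fst p \<in> E \<and> finite (snd p) \<and> snd p \<subseteq> U \<and> fst p \<in> eq_set L N (snd p)"
      if "p \<in> \<Union>\<C>" for p
    proof -
      obtain R where R: "R \<in> \<C>" "p \<in> R" using \<open>p \<in> \<Union>\<C>\<close> by (rule UnionE)
      then show ?thesis using independent_repsD(2)[OF mem[OF R(1)]] by simp
    qed
    have inj: "inj_on fst (\<Union>\<C>)"
    proof (rule inj_onI)
      fix p q assume pq: "p \<in> \<Union>\<C>" "q \<in> \<Union>\<C>" "fst p = fst q"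
      then have "finite {p, q}" "{p, q} \<subseteq> \<Union>\<C>" by simp_all
      from fin[OF this] obtain R where R: "R \<in> \<C>" "{p, q} \<subseteq> R" ..
      show "p = q"
        by (rule inj_onD[OF independent_repsD(1)[OF mem[OF R(1)]] pq(3)]) (use R(2) in simp_all)
    qed
    have fE: "fst ` \<Union>\<C> \<subseteq> E" by (rule image_subsetI) (use basic in simp)
    have "|fst ` \<Union>\<C>| <o \<mu>" by (rule card_subset_ordLess[OF im.sm_card[OF E] fE])
    from card_inj_on_ordLess[OF this inj] have cU: "|\<Union>\<C>| <o \<mu>" .
    have "ind_eq (Elt ` \<Union>(snd ` R0)) (fst ` R0) (E \<union> Z)" if R0: "R0 \<subseteq> \<Union>\<C>" for R0
    proof -
      have f0: "fst ` R0 \<subseteq> E" by (rule order_trans[OF image_mono[OF R0] fE])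
      have s0: "smE (fst ` R0)" by (rule im.sm_subset[OF E f0])
      have "|\<Union>p\<in>R0. snd p| <o \<mu>"
        by (rule card_UN_finite_ordLess[OF mu_facts card_subset_ordLess[OF cU R0]])
          (use basic[OF subsetD[OF R0]] in simp)
      moreover have "(\<Union>p\<in>R0. snd p) \<subseteq> U"
        by (rule UN_least) (use basic[OF subsetD[OF R0]] in simp)
      ultimately have sS: "home.sm (\<Union>(snd ` R0))" by (simp add: sm_U)
      show ?thesis
      proof (rule im.finite_character[OF smE_Elt[OF sS] s0 sEZ, THEN iffD2], intro allI impI, elim conjE)
        fix F :: "('f, 'r, 'a) eq_elem set" assume F: "finite F" "F \<subseteq> Elt ` \<Union>(snd ` R0)"
        have "\<forall>x\<in>F. \<exists>p. p \<in> R0 \<and> x \<in> Elt ` snd p" using F(2) by blast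
        from bchoice[OF this] obtain p where p: "\<forall>x\<in>F. p x \<in> R0 \<and> x \<in> Elt ` snd (p x)" ..
        define R1 where "R1 = p ` F"
        have R1: "finite R1" "R1 \<subseteq> R0" using F(1) p by (auto simp: R1_def)
        then have "R1 \<subseteq> \<Union>\<C>" using R0 by blast
        from fin[OF R1(1) this] obtain R where R: "R \<in> \<C>" "R1 \<subseteq> R" ..
        have 1: "ind_eq (Elt ` \<Union>(snd ` R1)) (fst ` R1) (E \<union> Z)"
          by (rule independent_repsD(3)[OF mem[OF R(1)] R(2)])
        have sR1: "smE (Elt ` \<Union>(snd ` R1))"
          by (rule smE_Elt[OF independent_reps_sm(1)[OF mem[OF R(1)] E R(2)]])
        have "ind_eq (Elt ` \<Union>(snd ` R1)) (fst ` R0) (E \<union> Z)"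
        proof (rule im.base_up[OF 1 image_mono[OF R1(2)] _ sR1 s0 sEZ])
          have s2: "smE (fst ` R1 \<union> (E \<union> Z))"
            by (rule im.sm_Un[OF im.sm_subset[OF s0 image_mono[OF R1(2)]] sEZ])
          then show "fst ` R0 \<subseteq> clE (fst ` R1 \<union> (E \<union> Z))" using im.subset_cl f0 by blast
        qed
        then show "ind_eq F (fst ` R0) (E \<union> Z)"
        proof (rule im.mono_left[OF _ _ sR1 s0 sEZ])
          show "F \<subseteq> Elt ` \<Union>(snd ` R1)" using p unfolding R1_def by blast
        qed
      qed
    qed
    then have "independent_reps E Z (\<Union>\<C>)"
      unfolding independent_reps_def using inj basic by simp
    then show "\<Union>\<C> \<in> \<A>" by (simp add: \<A>_def)
  qed
  then obtain R where R: "R \<in> \<A>" and max: "\<forall>Y\<in>\<A>. R \<subseteq> Y \<longrightarrow> Y = R" ..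
  have iR: "independent_reps E Z R" using R by (simp add: \<A>_def)
  have fR: "fst ` R \<subseteq> E" by (rule image_subsetI) (use independent_repsD(2)[OF iR] in simp)
  have "e \<in> fst ` R" if e: "e \<in> E" for e
  proof (rule ccontr)
    assume ne: "e \<notin> fst ` R"
    have eU: "e \<in> Ue" using e im.sm_carrier[OF E] by blast
    then obtain s xs where s: "s \<in> sorts Le" "xs \<in> tuples U (arity s)" "e = cls N s xs"
      by (auto simp: carrier_Le eq_set_cls)
    define D where "D = set xs"
    have D: "finite D" "D \<subseteq> U" "e \<in> eq_set L N D"
      using s by (auto simp: D_def eq_set_cls tuples_def)
    have sD: "home.sm D" using D by (intro home.sm_finite) (auto simp: carrier_L)
    define S :: "('f, 'r, 'a) eq_elem set" where "S = Elt ` \<Union>(snd ` R)"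
    have sS: "smE S" unfolding S_def by (rule smE_Elt[OF independent_reps_sm(1)[OF iR E order_refl]])
    have se: "smE {e}" using eU by (intro im.sm_finite) auto
    have sEZS: "smE (S \<union> (E \<union> Z))" using sS sEZ by (rule im.sm_Un)
    obtain \<tau> where \<tau>: "automorphism L N \<tau>" "\<forall>b\<in>{e}. eq_map \<tau> b = b"
      "ind_eq (eq_map \<tau> ` Elt ` D) {e} (S \<union> (E \<union> Z))"
      using extension_automorphism[OF smE_Elt[OF sD] se sEZS] by blast
    define D' where "D' = \<tau> ` D"
    have D': "finite D'" "D' \<subseteq> U" using D aut_U[OF \<tau>(1)] by (auto simp: D'_def)
    have eD': "e \<in> eq_set L N D'"
      using eq_map_eq_set[OF \<tau>(1) D(2)] D(3) \<tau>(2) by (force simp: D'_def)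
    have sD': "smE (Elt ` D')" using D' by (intro smE_Elt home.sm_finite) (auto simp: carrier_L)
    have 1: "ind_eq (Elt ` D') {e} (S \<union> (E \<union> Z))" using \<tau>(3) by (simp add: eq_map_Elt_image D'_def)
    have "ind_eq (Elt ` \<Union>(snd ` R0)) (fst ` R0) (E \<union> Z)" if R0: "R0 \<subseteq> insert (e, D') R" for R0
    proof (cases "(e, D') \<in> R0")
      case False
      then have "R0 \<subseteq> R" using R0 by blast
      then show ?thesis by (rule independent_repsD(3)[OF iR])
    next
      case True
      define R1 where "R1 = R0 - {(e, D')}"
      have R1: "R1 \<subseteq> R" using R0 by (auto simp: R1_def)
      have R0eq: "R0 = insert (e, D') R1" using True by (auto simp: R1_def)
      define S1 :: "('f, 'r, 'a) eq_elem set" where "S1 = Elt ` \<Union>(snd ` R1)"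
      have sS1: "smE S1" unfolding S1_def by (rule smE_Elt[OF independent_reps_sm(1)[OF iR E R1]])
      have sf1: "smE (fst ` R1)" by (rule independent_reps_sm(2)[OF iR E R1])
      have f1E: "fst ` R1 \<subseteq> E" by (rule order_trans[OF image_mono[OF R1] fR])
      have sf0: "smE (fst ` R0)" unfolding R0eq using im.sm_insert[OF eU sf1] by simp
      have "ind_eq S1 (fst ` R1) (E \<union> Z)" unfolding S1_def by (rule independent_repsD(3)[OF iR R1])
      then have 2: "ind_eq S1 (fst ` R0) (E \<union> Z)"
      proof (rule im.base_up[OF _ _ _ sS1 sf0 sEZ])
        show "fst ` R1 \<subseteq> fst ` R0" by (auto simp: R0eq)
        have s2: "smE (fst ` R1 \<union> (E \<union> Z))" using sf1 sEZ by (rule im.sm_Un)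
        show "fst ` R0 \<subseteq> clE (fst ` R1 \<union> (E \<union> Z))"
          using im.subset_cl[OF s2] f1E e by (auto simp: R0eq)
      qed
      have s3: "smE (fst ` R1 \<union> S1)" using sf1 sS1 by (rule im.sm_Un)
      have "ind_eq (Elt ` D') {e} ((fst ` R1 \<union> S1) \<union> (E \<union> Z))"
      proof (rule im.mono_right[OF 1 _ sD' se sEZS])
        have "S1 \<subseteq> S" using R1 by (auto simp: S1_def S_def)
        then show "(fst ` R1 \<union> S1) \<union> (E \<union> Z) \<subseteq> S \<union> (E \<union> Z)" using f1E by blast
      qed
      then have "ind_eq (Elt ` D') ({e} \<union> (fst ` R1 \<union> S1)) (E \<union> Z)"
        by (rule im.base_mono[OF _ sD' se s3 sEZ])
      moreover have "{e} \<union> (fst ` R1 \<union> S1) = fst ` R0 \<union> S1" by (auto simp: R0eq)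
      ultimately have "ind_eq (Elt ` D') (fst ` R0 \<union> S1) (E \<union> Z)" by simp
      then have "ind_eq (S1 \<union> Elt ` D') (fst ` R0) (E \<union> Z)"
        by (rule im.trans_left[OF 2 _ sS1 sf0 sEZ sD'])
      moreover have "S1 \<union> Elt ` D' = Elt ` \<Union>(snd ` R0)" by (auto simp: S1_def R0eq)
      ultimately show ?thesis by simp
    qed
    moreover have "inj_on fst (insert (e, D') R)" using independent_repsD(1)[OF iR] ne by auto
    moreover have "fst p \<in> E \<and> finite (snd p) \<and> snd p \<subseteq> U \<and> fst p \<in> eq_set L N (snd p)"
      if "p \<in> insert (e, D') R" for p
      using that independent_repsD(2)[OF iR, of p] e D' eD' by (elim insertE) simp_all
    ultimately have "insert (e, D') R \<in> \<A>"
      unfolding \<A>_def independent_reps_def by simp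
    then have "(e, D') \<in> R" using max by blast
    then show False using ne by force
  qed
  then have "fst ` R = E" using fR by blast
  then show ?thesis using iR by blast
qed

text \<open>
  With generic representatives of all of \<open>E\<close>, a base for \<open>X\<close> among the representatives can be
  replaced by the imaginaries \<open>E0\<close> that they represent, because the representatives are
  independent of \<open>X\<close> over \<open>E0\<close>.
\<close>

lemma local_character_imaginary:
  assumes X: "finite X" "X \<subseteq> U" and E: "smE E"
  shows "\<exists>E0\<subseteq>E. |E0| <o \<kappa> \<and> ind_eq (Elt ` X) E0 E"
proof -
  have sX: "home.sm X" using X by (intro home.sm_finite) (auto simp: carrier_L)
  have sXe: "smE (Elt ` X)" by (rule smE_Elt[OF sX])
  obtain R where R: "independent_reps E (Elt ` X) R" "fst ` R = E"
    using independent_reps_exist[OF E sXe] by blast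
  define D where "D = \<Union>(snd ` R)"
  have sD: "home.sm D" unfolding D_def by (rule independent_reps_sm(1)[OF R(1) E order_refl])
  obtain D0 where D0: "D0 \<subseteq> D" "|D0| <o \<kappa>0" "ind X D0 D"
    using local_kappa0[unfolded finite_local_character_def carrier_L, rule_format, of X D] X sD by blast
  have "\<forall>d\<in>D0. \<exists>p. p \<in> R \<and> d \<in> snd p" using D0(1) unfolding D_def by blast
  from bchoice[OF this] obtain p where p: "\<forall>d\<in>D0. p d \<in> R \<and> d \<in> snd (p d)" ..
  define R0 where "R0 = p ` D0"
  have R0: "R0 \<subseteq> R" using p by (auto simp: R0_def)
  define E0 where "E0 = fst ` R0"
  have E0E: "E0 \<subseteq> E" using R(2) R0 by (auto simp: E0_def)
  have sE0: "smE E0" by (rule im.sm_subset[OF E E0E])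
  have "|D0| <o \<kappa>" by (rule ordLess_transitive[OF D0(2) kappa0_kappa])
  then have cE0: "|E0| <o \<kappa>" unfolding E0_def R0_def by (intro card_image_ordLess)
  define S where "S = \<Union>(snd ` R0)"
  have SD: "S \<subseteq> D" using R0 by (auto simp: S_def D_def)
  have sS: "home.sm S" by (rule home.sm_subset[OF sD SD])
  have sSe: "smE (Elt ` S)" and sDe: "smE (Elt ` D)" by (rule smE_Elt[OF sS], rule smE_Elt[OF sD])
  have D0S: "D0 \<subseteq> S" using p by (auto simp: S_def R0_def)
  have "ind X S D"
  proof (rule home.base_up[OF D0(3) D0S _ sX sS sD])
    have "D0 \<union> D = D" using D0(1) by blast
    then show "S \<subseteq> home.cl (D0 \<union> D)" using home.subset_cl[OF sD] SD by auto
  qed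
  then have "ind_eq (Elt ` X) (Elt ` S) (Elt ` D)" using ind_Elt[OF sX sS sD] by simp
  then have "ind_eq (Elt ` X) (Elt ` S) (Elt ` D \<union> E)"
  proof (rule im.extend_right[OF _ _ sXe sSe sDe E])
    have "E \<subseteq> eq_set L N D"
    proof
      fix e assume "e \<in> E"
      then have "e \<in> fst ` R" using R(2) by simp
      then obtain q where q: "e = fst q" "q \<in> R" by (rule imageE)
      have "e \<in> eq_set L N (snd q)" using independent_repsD(2)[OF R(1) q(2)] q(1) by simp
      moreover have "snd q \<subseteq> D" using q(2) by (auto simp: D_def)
      ultimately show "e \<in> eq_set L N D" using eq_set_mono by blast
    qed
    then show "E \<subseteq> clE (Elt ` S \<union> Elt ` D)"
      by (rule eq_set_cl_subset[OF sD]) (use sSe sDe im.sm_Un in auto)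
  qed
  then have "ind_eq (Elt ` X) (Elt ` S) (E0 \<union> E)"
    by (rule im.mono_right) (use E0E sXe sSe sDe E im.sm_Un in auto)
  then have 1: "ind_eq (Elt ` X) (Elt ` S \<union> E0) E"
    by (rule im.base_mono[OF _ sXe sSe sE0 E])
  have sEX: "smE (E \<union> Elt ` X)" using E sXe by (rule im.sm_Un)
  have "ind_eq (Elt ` S) E0 (E \<union> Elt ` X)"
    unfolding S_def E0_def by (rule independent_repsD(3)[OF R(1) R0])
  then have "ind_eq (Elt ` S) E0 (Elt ` X)"
    by (rule im.mono_right[OF _ _ sSe sE0 sEX]) auto
  then have "ind_eq (Elt ` X) E0 (Elt ` S)" by (rule im.sym[OF _ sSe sE0 sXe])
  then have "ind_eq (Elt ` X) E0 (Elt ` S \<union> E)"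
    by (rule im.trans_right) (use 1 sXe sE0 sSe E in \<open>auto simp: Un_commute\<close>)
  then have "ind_eq (Elt ` X) E0 E"
    by (rule im.mono_right) (use sXe sE0 sSe E im.sm_Un in auto)
  then show ?thesis using E0E cE0 by blast
qed

lemma finite_reps:
  assumes "finite F" "F \<subseteq> eq_set L N M"
  shows "\<exists>X\<subseteq>M. finite X \<and> F \<subseteq> eq_set L N X"
  using assms
proof (induction F rule: finite_induct)
  case (insert e F)
  then obtain X where X: "X \<subseteq> M" "finite X" "F \<subseteq> eq_set L N X" by auto
  obtain s xs where s: "s \<in> sorts Le" "xs \<in> tuples M (arity s)" "e = cls N s xs"
    using insert.prems by (auto simp: eq_set_cls)
  have "e \<in> eq_set L N (X \<union> set xs)" using s by (auto simp: eq_set_cls tuples_def)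
  moreover have "F \<subseteq> eq_set L N (X \<union> set xs)" using X(3) eq_set_mono[of X "X \<union> set xs"] by auto
  moreover have "X \<union> set xs \<subseteq> M" using X(1) s(2) by (auto simp: tuples_def)
  ultimately show ?case using X(2) by (intro exI[of _ "X \<union> set xs"]) auto
qed auto

lemma local_character_eq:
  assumes F: "finite F" "F \<subseteq> Ue" and E: "smE E"
  shows "\<exists>E0\<subseteq>E. |E0| <o \<kappa> \<and> ind_eq F E0 E"
proof -
  obtain X where X: "X \<subseteq> U" "finite X" "F \<subseteq> eq_set L N X"
    using finite_reps[of F U] F by (auto simp: carrier_Le)
  have sX: "home.sm X" using X by (intro home.sm_finite) (auto simp: carrier_L)
  have sXe: "smE (Elt ` X)" by (rule smE_Elt[OF sX])
  have sF: "smE F" using F by (rule im.sm_finite)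
  obtain E0 where E0: "E0 \<subseteq> E" "|E0| <o \<kappa>" "ind_eq (Elt ` X) E0 E"
    using local_character_imaginary[OF X(2,1) E] by blast
  have sE0: "smE E0" by (rule im.sm_subset[OF E E0(1)])
  have "ind_eq (Elt ` X \<union> F) E0 E"
  proof (rule im.extend_left[OF E0(3) _ sXe sE0 E sF])
    show "F \<subseteq> clE (E0 \<union> Elt ` X)"
      by (rule eq_set_cl_subset[OF sX X(3)]) (use sE0 sXe im.sm_Un in auto)
  qed
  then have "ind_eq F E0 E" by (rule im.mono_left) (use sXe sF sE0 E im.sm_Un in auto)
  then show ?thesis using E0 by blast
qed

end

context lovely_pairs
begin

subsection \<open>The back-and-forth system\<close>

text \<open>
  The graph \<open>H\<close> of a very small partial map from the imaginaries of \<open>M\<close> to those of \<open>M'\<close>, induced by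
  an automorphism \<open>\<sigma>\<close>, with P-independent domain and range, and preserving P. By \<open>P_eq_set\<close>, the
  P-part of a set of imaginaries of \<open>M\<close> is its intersection with \<open>eq_set L N PM\<close>.
\<close>

definition small_map where
  "small_map M PM M' PM' \<sigma> H \<longleftrightarrow> |H| <o \<kappa> \<and> automorphism L N \<sigma> \<and>
     (\<forall>(x, y)\<in>H. x \<in> eq_set L N M \<and> y \<in> eq_set L N M' \<and> y = eq_map \<sigma> x \<and>
        (x \<in> eq_set L N PM \<longleftrightarrow> y \<in> eq_set L N PM')) \<and>
     ind_eq (fst ` H) (fst ` H \<inter> eq_set L N PM) (Elt ` PM) \<and>
     ind_eq (snd ` H) (snd ` H \<inter> eq_set L N PM') (Elt ` PM')"

lemma small_mapD:
  assumes "small_map M PM M' PM' \<sigma> H"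
  shows "|H| <o \<kappa>" "automorphism L N \<sigma>"
    "(x, y) \<in> H \<Longrightarrow> x \<in> eq_set L N M \<and> y \<in> eq_set L N M' \<and> y = eq_map \<sigma> x \<and>
        (x \<in> eq_set L N PM \<longleftrightarrow> y \<in> eq_set L N PM')"
    "ind_eq (fst ` H) (fst ` H \<inter> eq_set L N PM) (Elt ` PM)"
    "ind_eq (snd ` H) (snd ` H \<inter> eq_set L N PM') (Elt ` PM')"
  using assms by (auto simp: small_map_def)

lemma small_map_sets:
  assumes "small_map M PM M' PM' \<sigma> H"
  shows "fst ` H \<subseteq> eq_set L N M" "snd ` H \<subseteq> eq_set L N M'" "eq_map \<sigma> ` fst ` H = snd ` H"
    "eq_map \<sigma> ` (fst ` H \<inter> eq_set L N PM) = snd ` H \<inter> eq_set L N PM'"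
proof -
  note D = small_mapD(3)[OF assms]
  show "fst ` H \<subseteq> eq_set L N M" "snd ` H \<subseteq> eq_set L N M'" using D by auto
  show "eq_map \<sigma> ` fst ` H = snd ` H"
    unfolding image_image by (rule image_cong) (use D in auto)
  show "eq_map \<sigma> ` (fst ` H \<inter> eq_set L N PM) = snd ` H \<inter> eq_set L N PM'"
  proof (rule subset_antisym; rule subsetI)
    fix z assume "z \<in> eq_map \<sigma> ` (fst ` H \<inter> eq_set L N PM)"
    then obtain x y where "(x, y) \<in> H" "x \<in> eq_set L N PM" "z = eq_map \<sigma> x" by auto
    then show "z \<in> snd ` H \<inter> eq_set L N PM'" using D by force
  next
    fix z assume "z \<in> snd ` H \<inter> eq_set L N PM'"
    then obtain x where x: "(x, z) \<in> H" "z \<in> eq_set L N PM'" by auto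
    then have "x \<in> fst ` H \<inter> eq_set L N PM" "z = eq_map \<sigma> x" using D[OF x(1)] by force+
    then show "z \<in> eq_map \<sigma> ` (fst ` H \<inter> eq_set L N PM)" by blast
  qed
qed

lemma small_map_elem_rel:
  assumes "small_map M PM M' PM' \<sigma> H" "M \<subseteq> U"
  shows "elem_rel Le Ne H"
proof (rule elem_rel_eq_map[OF small_mapD(2)[OF assms(1)]])
  fix x y assume "(x, y) \<in> H"
  then show "x \<in> Ue \<and> y = eq_map \<sigma> x"
    using small_mapD(3)[OF assms(1)] eq_set_mono[OF assms(2)] by (auto simp: carrier_Le)
qed

lemma small_map_sym:
  assumes H: "small_map M PM M' PM' \<sigma> H" and M: "M \<subseteq> U"
  shows "\<exists>\<tau>. small_map M' PM' M PM \<tau> (H\<inverse>)"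
proof -
  obtain \<tau> where \<tau>: "automorphism L N \<tau>" "\<forall>e\<in>Ue. eq_map \<tau> (eq_map \<sigma> e) = e"
    using eq_map_inverse[OF small_mapD(2)[OF H]] by blast
  have "(\<lambda>(x, y). (y, x)) ` H = H\<inverse>" by auto
  then have c: "|H\<inverse>| <o \<kappa>" using card_image_ordLess[OF small_mapD(1)[OF H], of "\<lambda>(x, y). (y, x)"] by simp
  have f: "fst ` (H\<inverse>) = snd ` H" "snd ` (H\<inverse>) = fst ` H" by force+
  have "x \<in> eq_set L N M' \<and> y \<in> eq_set L N M \<and> y = eq_map \<tau> x \<and>
      (x \<in> eq_set L N PM' \<longleftrightarrow> y \<in> eq_set L N PM)" if "(x, y) \<in> H\<inverse>" for x y
  proof -
    have "(y, x) \<in> H" using that by simp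
    from small_mapD(3)[OF H this] show ?thesis
      using \<tau>(2) eq_set_mono[OF M] by (auto simp: carrier_Le)
  qed
  then show ?thesis unfolding small_map_def f
    using c \<tau>(1) small_mapD(4,5)[OF H] by (intro exI[of _ \<tau>]) auto
qed

context
  fixes M PM M' PM' :: "'a set"
  assumes lovely: "lovely_pair L N \<mu> ind \<kappa> M PM" and lovely': "lovely_pair L N \<mu> ind \<kappa> M' PM'"
begin

lemmas M_facts = M_U[OF lovely] PM_M[OF lovely] sm_PM[OF lovely] smE_PM[OF lovely] P_eq_set[OF lovely]
lemmas M'_facts = M_U[OF lovely'] PM_M[OF lovely'] sm_PM[OF lovely'] smE_PM[OF lovely'] P_eq_set[OF lovely']

lemma PM_cl: "eq_set L N PM \<subseteq> clE (Elt ` PM)" "eq_set L N PM' \<subseteq> clE (Elt ` PM')"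
  using M_facts(5) M'_facts(5) by auto

lemma small_map_sm:
  assumes "small_map M PM M' PM' \<sigma> H"
  shows "smE (fst ` H)" "smE (snd ` H)" "smE (fst ` H \<inter> eq_set L N PM)" "smE (snd ` H \<inter> eq_set L N PM')"
    "|fst ` H| <o \<kappa>" "|snd ` H| <o \<kappa>"
proof -
  show c: "|fst ` H| <o \<kappa>" "|snd ` H| <o \<kappa>"
    using card_image_ordLess[OF small_mapD(1)[OF assms]] by auto
  show 1: "smE (fst ` H)"
    by (rule smE_very_small[OF order_trans[OF small_map_sets(1)[OF assms] eq_set_mono[OF M_facts(1)]] c(1)])
  show 2: "smE (snd ` H)"
    by (rule smE_very_small[OF order_trans[OF small_map_sets(2)[OF assms] eq_set_mono[OF M'_facts(1)]] c(2)])
  show "smE (fst ` H \<inter> eq_set L N PM)" by (rule im.sm_subset[OF 1]) simp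
  show "smE (snd ` H \<inter> eq_set L N PM')" by (rule im.sm_subset[OF 2]) simp
qed

lemma base_P:
  assumes "ind_eq A Q (Elt ` P)" "Q \<subseteq> Q'" "Q' \<subseteq> clE (Elt ` P)" "smE A" "smE Q'" "smE (Elt ` P)"
  shows "ind_eq A Q' (Elt ` P)"
proof (rule im.base_up[OF assms(1,2) _ assms(4-6)])
  have "smE (Q \<union> Elt ` P)" using im.sm_Un im.sm_subset[OF assms(5,2)] assms(6) by blast
  then show "Q' \<subseteq> clE (Q \<union> Elt ` P)" using im.cl_mono[of "Elt ` P" "Q \<union> Elt ` P"] assms(3) by blast
qed

text \<open>
  If the enlarged domain and range stay independent of P over the old P-parts, then
  \<open>P_eq_set\<close> and \<open>cl_iff\<close> express membership of \<open>e\<close> in P by the closure of the old P-part,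
  which the automorphism preserves.
\<close>

lemma small_map_insert:
  assumes H: "small_map M PM M' PM' \<sigma> H" and e: "e \<in> eq_set L N M" "eq_map \<sigma> e \<in> eq_set L N M'"
    and i: "ind_eq (insert e (fst ` H)) (fst ` H \<inter> eq_set L N PM) (Elt ` PM)"
    and i': "ind_eq (insert (eq_map \<sigma> e) (snd ` H)) (snd ` H \<inter> eq_set L N PM') (Elt ` PM')"
  shows "small_map M PM M' PM' \<sigma> (insert (e, eq_map \<sigma> e) H)"
proof -
  note s = small_map_sm[OF H] and \<sigma> = small_mapD(2)[OF H]
  have eU: "e \<in> Ue" "eq_map \<sigma> e \<in> Ue"
    using e eq_set_mono[OF M_facts(1)] eq_set_mono[OF M'_facts(1)] by (auto simp: carrier_Le)
  have si: "smE (insert e (fst ` H))" "smE (insert (eq_map \<sigma> e) (snd ` H))"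
    using im.sm_insert eU s by auto
  have "ind_eq {e} (fst ` H \<inter> eq_set L N PM) (Elt ` PM)"
    by (rule im.mono_left[OF i]) (use si s M_facts in auto)
  then have "e \<in> clE (Elt ` PM) \<longleftrightarrow> e \<in> clE (fst ` H \<inter> eq_set L N PM)"
    by (rule im.cl_iff) (use PM_cl eU s M_facts in auto)
  moreover have "ind_eq {eq_map \<sigma> e} (snd ` H \<inter> eq_set L N PM') (Elt ` PM')"
    by (rule im.mono_left[OF i']) (use si s M'_facts in auto)
  then have "eq_map \<sigma> e \<in> clE (Elt ` PM') \<longleftrightarrow> eq_map \<sigma> e \<in> clE (snd ` H \<inter> eq_set L N PM')"
    by (rule im.cl_iff) (use PM_cl eU s M'_facts in auto)
  moreover have "eq_map \<sigma> e \<in> clE (snd ` H \<inter> eq_set L N PM') \<longleftrightarrow> e \<in> clE (fst ` H \<inter> eq_set L N PM)"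
    using eq_map_cl_iff[OF \<sigma> eU(1) s(3)] by (simp add: small_map_sets(4)[OF H])
  ultimately have P: "e \<in> eq_set L N PM \<longleftrightarrow> eq_map \<sigma> e \<in> eq_set L N PM'"
    using e M_facts(5) M'_facts(5) by blast
  have "ind_eq (insert e (fst ` H)) (insert e (fst ` H) \<inter> eq_set L N PM) (Elt ` PM)"
    by (rule base_P[OF i]) (use PM_cl si M_facts im.sm_subset[OF si(1)] in auto)
  moreover have "ind_eq (insert (eq_map \<sigma> e) (snd ` H)) (insert (eq_map \<sigma> e) (snd ` H) \<inter> eq_set L N PM') (Elt ` PM')"
    by (rule base_P[OF i']) (use PM_cl si M'_facts im.sm_subset[OF si(2)] in auto)
  moreover have "|insert (e, eq_map \<sigma> e) H| <o \<kappa>"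
    using card_Un_ordLess[OF kappa_facts card_finite_ordLess[OF kappa_uncountable, of "{(e, eq_map \<sigma> e)}"] small_mapD(1)[OF H]]
    by simp
  ultimately show ?thesis
    unfolding small_map_def using \<sigma> e P small_mapD(3)[OF H] by auto
qed

text \<open>Representatives of very small sets of imaginaries, those in the closure of \<open>P\<close> taken in \<open>P\<close>.\<close>

lemma reps_with_P_part:
  assumes "A \<subseteq> eq_set L N M'" "|A| <o \<kappa>"
  shows "\<exists>B\<subseteq>M'. |B| <o \<kappa> \<and> A \<subseteq> eq_set L N B \<and> A \<inter> eq_set L N PM' \<subseteq> eq_set L N (PM' \<inter> B)"
proof -
  obtain B1 where B1: "B1 \<subseteq> M'" "|B1| <o \<kappa>" "A \<subseteq> eq_set L N B1"
    using eq_set_reps[OF assms kappa_facts] by blast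
  have "|A \<inter> eq_set L N PM'| <o \<kappa>" by (rule card_subset_ordLess[OF assms(2)]) simp
  then obtain B2 where B2: "B2 \<subseteq> PM'" "|B2| <o \<kappa>" "A \<inter> eq_set L N PM' \<subseteq> eq_set L N B2"
    using eq_set_reps[OF _ _ kappa_facts, of "A \<inter> eq_set L N PM'" PM'] by blast
  have "B1 \<union> B2 \<subseteq> M'" using B1 B2 M'_facts by auto
  moreover have "|B1 \<union> B2| <o \<kappa>" by (rule card_Un_ordLess[OF kappa_facts B1(2) B2(2)])
  moreover have "A \<subseteq> eq_set L N (B1 \<union> B2)" using B1(3) eq_set_mono[of B1 "B1 \<union> B2"] by blast
  moreover have "A \<inter> eq_set L N PM' \<subseteq> eq_set L N (PM' \<inter> (B1 \<union> B2))"
    using B2 eq_set_mono[of B2 "PM' \<inter> (B1 \<union> B2)"] by blast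
  ultimately show ?thesis by blast
qed

text \<open>
  A very small subset \<open>A\<close> of P can be added to the domain: take a copy of \<open>A\<close> over the range that is
  independent of representatives \<open>B\<close> of the range, and move it into P by the density property.
\<close>

lemma small_map_P:
  assumes H: "small_map M PM M' PM' \<sigma> H" and A: "A \<subseteq> PM" "|A| <o \<kappa>"
  shows "\<exists>\<theta> H'. small_map M PM M' PM' \<theta> H' \<and> H \<subseteq> H' \<and> fst ` H' = fst ` H \<union> Elt ` A"
proof -
  note s = small_map_sm[OF H] and \<sigma> = small_mapD(2)[OF H]
  define Q' where "Q' = snd ` H \<inter> eq_set L N PM'"
  have AU: "A \<subseteq> U" using A(1) M_facts by blast
  have sA: "home.sm A" by (rule sm_very_small[OF AU A(2)])
  have sAe: "smE (Elt ` A)" by (rule smE_Elt[OF sA])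
  obtain B where B: "B \<subseteq> M'" "|B| <o \<kappa>" "snd ` H \<subseteq> eq_set L N B" "Q' \<subseteq> eq_set L N (PM' \<inter> B)"
    using reps_with_P_part[OF small_map_sets(2)[OF H] s(6)] unfolding Q'_def by blast
  have BU: "B \<subseteq> U" using B(1) M'_facts by blast
  have sB: "home.sm B" by (rule sm_very_small[OF BU B(2)])
  have sPB: "home.sm (PM' \<inter> B)" by (rule home.sm_subset[OF sB]) simp
  have sBe: "smE (Elt ` B)" and sPBe: "smE (Elt ` (PM' \<inter> B))" by (rule smE_Elt[OF sB], rule smE_Elt[OF sPB])
  have sQ: "smE Q'" unfolding Q'_def by (rule s(4))
  have "ind_eq (fst ` H) (fst ` H \<inter> eq_set L N PM) (Elt ` A)"
    by (rule im.mono_right[OF small_mapD(4)[OF H]]) (use A(1) s M_facts in auto)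
  then have "ind_eq (Elt ` A) (fst ` H \<inter> eq_set L N PM) (fst ` H)"
    by (rule im.sym) (use s sAe in auto)
  from ind_eq_map[OF this \<sigma> sAe s(3) s(1)]
  have 1: "ind_eq (Elt ` \<sigma> ` A) Q' (snd ` H)"
    by (simp add: eq_map_Elt_image small_map_sets(3,4)[OF H] Q'_def)
  have s\<sigma>: "smE (Elt ` \<sigma> ` A)" using smE_eq_map[OF \<sigma> sAe] by (simp add: eq_map_Elt_image)
  obtain \<tau> where \<tau>: "automorphism L N \<tau>" "\<forall>b\<in>snd ` H. eq_map \<tau> b = b"
    "ind_eq (eq_map \<tau> ` Elt ` \<sigma> ` A) (snd ` H) (Elt ` B)"
    using extension_automorphism[OF s\<sigma> s(2) sBe] by blast
  define X where "X = \<tau> ` \<sigma> ` A"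
  have XU: "X \<subseteq> U" unfolding X_def using aut_U[OF \<sigma>] aut_U[OF \<tau>(1)] AU by blast
  have cX: "|X| <o \<kappa>" unfolding X_def by (intro card_image_ordLess A(2))
  have sX: "home.sm X" by (rule sm_very_small[OF XU cX])
  have sXe: "smE (Elt ` X)" by (rule smE_Elt[OF sX])
  have fixed: "eq_map \<tau> ` snd ` H = snd ` H" "eq_map \<tau> ` Q' = Q'"
    by (rule image_fixed; use \<tau>(2) in \<open>auto simp: Q'_def\<close>)+
  have 2: "ind_eq (Elt ` X) Q' (snd ` H)"
    using ind_eq_map[OF 1 \<tau>(1) s\<sigma> sQ s(2)] by (simp add: eq_map_Elt_image fixed X_def)
  have 3: "ind_eq (Elt ` X) (snd ` H) (Elt ` B)" using \<tau>(3) by (simp add: eq_map_Elt_image X_def)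
  have "Q' \<union> snd ` H = snd ` H" by (auto simp: Q'_def)
  then have "ind_eq (Elt ` X) (Q' \<union> snd ` H) (Elt ` B)" using 3 by simp
  from im.trans_right[OF 2 this sXe sQ s(2) sBe]
  have "ind_eq (Elt ` X) Q' (snd ` H \<union> Elt ` B)" .
  then have "ind_eq (Elt ` X) Q' (Elt ` B)"
    by (rule im.mono_right[OF _ _ sXe sQ im.sm_Un[OF s(2) sBe]]) simp
  then have "ind_eq (Elt ` X) (Elt ` (PM' \<inter> B) \<union> Q') (Elt ` B)"
  proof (rule im.base_up[OF _ _ _ sXe im.sm_Un[OF sPBe sQ] sBe])
    have s3: "smE (Q' \<union> Elt ` B)" by (rule im.sm_Un[OF sQ sBe])
    show "Elt ` (PM' \<inter> B) \<union> Q' \<subseteq> clE (Q' \<union> Elt ` B)" using im.subset_cl[OF s3] by blast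
  qed simp
  then have "ind_eq (Elt ` X) (Elt ` (PM' \<inter> B)) (Elt ` B)"
    by (rule im.base_down[OF _ _ sXe sPBe sBe sQ]) (use B(4) eq_set_cl[OF sPB] in blast)
  then have "ind X (PM' \<inter> B) B" using ind_Elt[OF sX sPB sB] by simp
  from density_tuple[OF lovely' B(1,2) XU cX this]
  obtain \<rho> where \<rho>: "automorphism L N \<rho>" "\<forall>b\<in>B. \<rho> b = b" "\<rho> ` X \<subseteq> PM'" by blast
  define \<theta> where "\<theta> = (\<lambda>x. \<rho> (\<tau> (\<sigma> x)))"
  have \<theta>: "automorphism L N \<theta>" unfolding \<theta>_def
    using automorphism_comp[OF automorphism_comp[OF \<sigma> \<tau>(1)] \<rho>(1)] .
  have \<theta>A: "\<theta> ` A \<subseteq> PM'" using \<rho>(3) by (auto simp: \<theta>_def X_def)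
  have \<theta>H: "y = eq_map \<theta> x" if xy: "(x, y) \<in> H" for x y
  proof -
    have "y = eq_map \<sigma> x" using small_mapD(3)[OF H xy] by simp
    moreover have yH: "y \<in> snd ` H" using xy by force
    moreover have "eq_map \<rho> y = y"
      by (rule eq_map_fixes[OF \<rho>(1) BU]) (use \<rho>(2) B(3) yH in auto)
    moreover have "eq_map \<tau> y = y" using \<tau>(2) yH by blast
    moreover have "eq_map \<theta> x = eq_map \<rho> (eq_map \<tau> (eq_map \<sigma> x))"
      unfolding \<theta>_def eq_map_comp[of \<rho> "\<lambda>x. \<tau> (\<sigma> x)" x] eq_map_comp[of \<tau> \<sigma> x] ..
    ultimately show ?thesis by simp
  qed
  define H' where "H' = H \<union> (\<lambda>x. (Elt x, Elt (\<theta> x))) ` A"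
  have f: "fst ` H' = fst ` H \<union> Elt ` A" "snd ` H' = snd ` H \<union> Elt ` \<theta> ` A"
    by (auto simp: H'_def image_Un image_image)
  have sTe: "smE (Elt ` \<theta> ` A)" using smE_eq_map[OF \<theta> sAe] by (simp add: eq_map_Elt_image)
  have addP: "ind_eq (D \<union> Z) ((D \<union> Z) \<inter> eq_set L N P) (Elt ` P)"
    if D: "ind_eq D (D \<inter> eq_set L N P) (Elt ` P)" and Z: "Z \<subseteq> Elt ` P" and sD: "smE D" and sZ: "smE Z"
      and sP: "smE (Elt ` P)" and cP: "eq_set L N P \<subseteq> clE (Elt ` P)" for D Z P
  proof -
    have sQ: "smE ((D \<union> Z) \<inter> eq_set L N P)" by (rule im.sm_subset[OF im.sm_Un[OF sD sZ]]) simp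
    have "ind_eq D ((D \<union> Z) \<inter> eq_set L N P) (Elt ` P)"
      by (rule base_P[OF D _ _ sD sQ sP]) (use cP in auto)
    then show ?thesis
    proof (rule im.extend_left[OF _ _ sD sQ sP sZ])
      have "Z \<subseteq> (D \<union> Z) \<inter> eq_set L N P" using Z by (auto simp: Elt_in_eq_set)
      then show "Z \<subseteq> clE ((D \<union> Z) \<inter> eq_set L N P \<union> D)"
        using im.subset_cl[OF im.sm_Un[OF sQ sD]] by blast
    qed
  qed
  have "ind_eq (fst ` H') (fst ` H' \<inter> eq_set L N PM) (Elt ` PM)"
    unfolding f by (rule addP[OF small_mapD(4)[OF H]]) (use A(1) s sAe M_facts PM_cl in auto)
  moreover have "ind_eq (snd ` H') (snd ` H' \<inter> eq_set L N PM') (Elt ` PM')"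
    unfolding f by (rule addP[OF small_mapD(5)[OF H]]) (use \<theta>A s sTe M'_facts PM_cl in auto)
  moreover have "|H'| <o \<kappa>" unfolding H'_def
    by (rule card_Un_ordLess[OF kappa_facts small_mapD(1)[OF H] card_image_ordLess[OF A(2)]])
  moreover have "x \<in> eq_set L N M \<and> y \<in> eq_set L N M' \<and> y = eq_map \<theta> x \<and>
      (x \<in> eq_set L N PM \<longleftrightarrow> y \<in> eq_set L N PM')" if xy: "(x, y) \<in> H'" for x y
  proof (cases "(x, y) \<in> H")
    case True
    then show ?thesis using small_mapD(3)[OF H True] \<theta>H[OF True] by blast
  next
    case False
    then obtain a where a: "a \<in> A" "x = Elt a" "y = Elt (\<theta> a)" using xy by (auto simp: H'_def)
    have "a \<in> PM" "\<theta> a \<in> PM'" using a(1) A(1) \<theta>A by auto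
    then show ?thesis using a(2,3) M_facts(2) M'_facts(2) by (auto simp: Elt_in_eq_set)
  qed
  ultimately have "small_map M PM M' PM' \<theta> H'" unfolding small_map_def using \<theta> by auto
  then show ?thesis using f(1) by (intro exI[of _ \<theta>] exI[of _ H']) (auto simp: H'_def)
qed

text \<open>
  An element \<open>d\<close> of \<open>M\<close> can be added to the domain. A very small part \<open>A\<close> of P is added first, so
  that \<open>d\<close> and the domain become P-independent; the image of \<open>d\<close> then comes from the extension
  property over representatives \<open>B\<close> of the range.
\<close>

lemma small_map_home:
  assumes H0: "small_map M PM M' PM' \<sigma>0 H0" and d: "d \<in> M"
  shows "\<exists>\<theta> H'. small_map M PM M' PM' \<theta> H' \<and> H0 \<subseteq> H' \<and> Elt d \<in> fst ` H'"
proof -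
  obtain C where C: "C \<subseteq> M" "|C| <o \<kappa>" "fst ` H0 \<subseteq> eq_set L N C"
    using eq_set_reps[OF small_map_sets(1)[OF H0] small_map_sm(5)[OF H0] kappa_facts] by blast
  define D where "D = C \<union> {d}"
  have D: "D \<subseteq> U" "|D| <o \<kappa>"
    using C(1) d M_facts(1) card_Un_ordLess[OF kappa_facts C(2) card_finite_ordLess[OF kappa_uncountable, of "{d}"]]
    by (auto simp: D_def)
  have sD: "home.sm D" by (rule sm_very_small[OF D])
  have sDe: "smE (Elt ` D)" by (rule smE_Elt[OF sD])
  obtain A where A: "A \<subseteq> PM" "|A| <o \<kappa>" "ind D A PM" using local_PM[OF lovely D] by blast
  have AU: "A \<subseteq> U" using A(1) M_facts by blast
  have sA: "home.sm A" by (rule sm_very_small[OF AU A(2)])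
  have sAe: "smE (Elt ` A)" by (rule smE_Elt[OF sA])
  obtain \<sigma> H where H: "small_map M PM M' PM' \<sigma> H" "H0 \<subseteq> H" and fH: "fst ` H = fst ` H0 \<union> Elt ` A"
    using small_map_P[OF H0 A(1,2)] by blast
  note s = small_map_sm[OF H(1)] and \<sigma> = small_mapD(2)[OF H(1)]
  have dU: "d \<in> U" using d M_facts(1) by blast
  have eU: "Elt d \<in> Ue" using dU by (simp add: Elt_Ue)
  have sHd: "smE (insert (Elt d) (fst ` H))" by (rule im.sm_insert[OF eU s(1)])
  \<comment> \<open>The domain and \<open>d\<close> are in the closure of \<open>A\<close> and \<open>D\<close>.\<close>
  have "ind_eq (Elt ` D) (Elt ` A) (Elt ` PM)" using A(3) ind_Elt[OF sD sA M_facts(3)] by simp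
  then have "ind_eq (Elt ` D \<union> insert (Elt d) (fst ` H)) (Elt ` A) (Elt ` PM)"
  proof (rule im.extend_left[OF _ _ sDe sAe M_facts(4) sHd])
    have sAD: "smE (Elt ` A \<union> Elt ` D)" by (rule im.sm_Un[OF sAe sDe])
    have "fst ` H0 \<subseteq> eq_set L N D" using C(3) eq_set_mono[of C D] by (auto simp: D_def)
    then have "fst ` H0 \<subseteq> clE (Elt ` A \<union> Elt ` D)"
      by (rule eq_set_cl_subset[OF sD _ _ sAD]) simp
    moreover have "insert (Elt d) (Elt ` A) \<subseteq> clE (Elt ` A \<union> Elt ` D)"
      using im.subset_cl[OF sAD] by (auto simp: D_def)
    ultimately show "insert (Elt d) (fst ` H) \<subseteq> clE (Elt ` A \<union> Elt ` D)" unfolding fH by blast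
  qed
  then have "ind_eq (insert (Elt d) (fst ` H)) (Elt ` A) (Elt ` PM)"
    by (rule im.mono_left[OF _ _ im.sm_Un[OF sDe sHd] sAe M_facts(4)]) auto
  then have i: "ind_eq (insert (Elt d) (fst ` H)) (fst ` H \<inter> eq_set L N PM) (Elt ` PM)"
  proof (rule base_P[OF _ _ _ sHd s(3) M_facts(4)])
    show "Elt ` A \<subseteq> fst ` H \<inter> eq_set L N PM" using A(1) by (auto simp: fH Elt_in_eq_set)
    show "fst ` H \<inter> eq_set L N PM \<subseteq> clE (Elt ` PM)" using PM_cl by blast
  qed
  \<comment> \<open>The image \<open>d'\<close> realizes the type over \<open>B\<close> of a copy \<open>c\<close> of \<open>d\<close> independent of \<open>B\<close> over the range.\<close>
  obtain B where B: "B \<subseteq> M'" "|B| <o \<kappa>" "snd ` H \<subseteq> eq_set L N B"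
    using eq_set_reps[OF small_map_sets(2)[OF H(1)] s(6) kappa_facts] by blast
  have BU: "B \<subseteq> U" using B(1) M'_facts by blast
  have sB: "home.sm B" by (rule sm_very_small[OF BU B(2)])
  have sBe: "smE (Elt ` B)" by (rule smE_Elt[OF sB])
  have \<sigma>dU: "\<sigma> d \<in> U" by (rule aut_U[OF \<sigma> dU])
  have "smE {Elt (\<sigma> d)}" using \<sigma>dU by (intro im.sm_finite) (auto simp: Elt_Ue)
  then obtain \<tau> where \<tau>: "automorphism L N \<tau>" "\<forall>b\<in>snd ` H. eq_map \<tau> b = b"
    "ind_eq (eq_map \<tau> ` {Elt (\<sigma> d)}) (snd ` H) (Elt ` B)"
    using extension_automorphism[OF _ s(2) sBe] by blast
  define c where "c = \<tau> (\<sigma> d)"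
  have cU: "c \<in> U" unfolding c_def by (rule aut_U[OF \<tau>(1) \<sigma>dU])
  have sc: "smE {Elt c}" using cU by (intro im.sm_finite) (auto simp: Elt_Ue)
  have 1: "ind_eq {Elt c} (snd ` H) (Elt ` B)" using \<tau>(3) by (simp add: c_def)
  obtain d' where d': "d' \<in> M'" "realizes N d' (tp L N B c)" "ind {d'} B PM'"
    using extension_property[OF lovely' B(1,2) cU] by blast
  obtain \<rho> where \<rho>: "automorphism L N \<rho>" "\<forall>x\<in>B. \<rho> x = x" "\<rho> c = d'"
    using realizes_tp_automorphism[OF BU very_small[OF B(2)] cU d'(2)] by blast
  have d'U: "d' \<in> U" using d'(1) M'_facts(1) by blast
  have sd': "home.sm {d'}" using d'U by (intro home.sm_finite) (auto simp: carrier_L)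
  have sd'e: "smE {Elt d'}" using smE_Elt[OF sd'] by simp
  have \<rho>H: "eq_map \<rho> y = y" if "y \<in> snd ` H" for y
    by (rule eq_map_fixes[OF \<rho>(1) BU]) (use \<rho>(2) B(3) that in auto)
  have fixed: "eq_map \<rho> ` snd ` H = snd ` H" by (rule image_fixed) (use \<rho>H in blast)
  have fixB: "\<rho> ` B = B" by (rule image_fixed[OF \<rho>(2)])
  have 2: "ind_eq {Elt d'} (snd ` H) (Elt ` B)"
    using ind_eq_map[OF 1 \<rho>(1) sc s(2) sBe] by (simp add: fixed fixB eq_map_Elt_image \<rho>(3))
  have sHB: "smE (snd ` H \<union> Elt ` B)" by (rule im.sm_Un[OF s(2) sBe])
  have "ind_eq {Elt d'} (Elt ` B) (Elt ` PM')"
    using d'(3) ind_Elt[OF sd' sB M'_facts(3)] by simp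
  then have "ind_eq {Elt d'} (snd ` H \<union> Elt ` B) (Elt ` PM')"
  proof (rule im.base_up[OF _ _ _ sd'e sHB M'_facts(4)])
    have s4: "smE (Elt ` B \<union> Elt ` PM')" by (rule im.sm_Un[OF sBe M'_facts(4)])
    have "snd ` H \<subseteq> clE (Elt ` B \<union> Elt ` PM')" by (rule eq_set_cl_subset[OF sB B(3) _ s4]) simp
    then show "snd ` H \<union> Elt ` B \<subseteq> clE (Elt ` B \<union> Elt ` PM')" using im.subset_cl[OF s4] by blast
  qed simp
  from im.trans_right[OF 2 this sd'e s(2) sBe M'_facts(4)]
  have "ind_eq {Elt d'} (snd ` H) (Elt ` B \<union> Elt ` PM')" .
  then have "ind_eq {Elt d'} (snd ` H) (Elt ` PM')"
    by (rule im.mono_right[OF _ _ sd'e s(2) im.sm_Un[OF sBe M'_facts(4)]]) simp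
  moreover have "(snd ` H \<inter> eq_set L N PM') \<union> snd ` H = snd ` H" by blast
  ultimately have "ind_eq {Elt d'} ((snd ` H \<inter> eq_set L N PM') \<union> snd ` H) (Elt ` PM')" by simp
  from im.trans_left[OF small_mapD(5)[OF H(1)] this s(2,4) M'_facts(4) sd'e]
  have i': "ind_eq (insert (Elt d') (snd ` H)) (snd ` H \<inter> eq_set L N PM') (Elt ` PM')" by simp
  define \<theta> where "\<theta> = (\<lambda>x. \<rho> (\<tau> (\<sigma> x)))"
  have \<theta>: "automorphism L N \<theta>" unfolding \<theta>_def
    using automorphism_comp[OF automorphism_comp[OF \<sigma> \<tau>(1)] \<rho>(1)] .
  have \<theta>H: "y = eq_map \<theta> x" if xy: "(x, y) \<in> H" for x y
  proof -
    have "y = eq_map \<sigma> x" using small_mapD(3)[OF H(1) xy] by simp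
    moreover have yH: "y \<in> snd ` H" using xy by force
    moreover have "eq_map \<tau> y = y" using \<tau>(2) yH by blast
    moreover have "eq_map \<theta> x = eq_map \<rho> (eq_map \<tau> (eq_map \<sigma> x))"
      unfolding \<theta>_def eq_map_comp[of \<rho> "\<lambda>x. \<tau> (\<sigma> x)" x] eq_map_comp[of \<tau> \<sigma> x] ..
    ultimately show ?thesis using \<rho>H by simp
  qed
  have H\<theta>: "small_map M PM M' PM' \<theta> H"
    unfolding small_map_def using small_mapD[OF H(1)] \<theta> \<theta>H by auto
  have \<theta>d: "eq_map \<theta> (Elt d) = Elt d'" by (simp add: \<theta>_def \<rho>(3) flip: c_def)
  have "small_map M PM M' PM' \<theta> (insert (Elt d, eq_map \<theta> (Elt d)) H)"
    by (rule small_map_insert[OF H\<theta> _ _ i]) (use d d'(1) i' in \<open>simp_all only: \<theta>d Elt_in_eq_set\<close>)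
  then show ?thesis using H(2) by (intro exI[of _ \<theta>] exI[of _ "insert (Elt d, eq_map \<theta> (Elt d)) H"]) auto
qed

lemma small_map_home_list:
  assumes "small_map M PM M' PM' \<sigma> H" "set xs \<subseteq> M"
  shows "\<exists>\<theta> H'. small_map M PM M' PM' \<theta> H' \<and> H \<subseteq> H' \<and> Elt ` set xs \<subseteq> fst ` H'"
  using assms(2)
proof (induction xs)
  case Nil
  then show ?case using assms(1) by auto
next
  case (Cons x xs)
  then obtain \<theta>1 H1 where 1: "small_map M PM M' PM' \<theta>1 H1" "H \<subseteq> H1" "Elt ` set xs \<subseteq> fst ` H1" by auto
  obtain \<theta> H' where "small_map M PM M' PM' \<theta> H'" "H1 \<subseteq> H'" "Elt x \<in> fst ` H'"
    using small_map_home[OF 1(1), of x] Cons.prems by auto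
  moreover from this have "fst ` H1 \<subseteq> fst ` H'" by (intro image_mono)
  then have "Elt ` set (x # xs) \<subseteq> fst ` H'" using 1(3) \<open>Elt x \<in> fst ` H'\<close> by auto
  ultimately show ?case using 1(2) by (intro exI[of _ \<theta>] exI[of _ H']) auto
qed

lemma small_map_forth:
  assumes "small_map M PM M' PM' \<sigma>0 H0" "e \<in> eq_set L N M"
  shows "\<exists>\<theta> H'. small_map M PM M' PM' \<theta> H' \<and> H0 \<subseteq> H' \<and> e \<in> fst ` H'"
proof -
  obtain s xs where s: "s \<in> sorts Le" "xs \<in> tuples M (arity s)" "e = cls N s xs"
    using assms(2) by (auto simp: eq_set_cls)
  have xsM: "set xs \<subseteq> M" using s(2) by (auto simp: tuples_def)
  obtain \<sigma> H where H: "small_map M PM M' PM' \<sigma> H" "H0 \<subseteq> H" "Elt ` set xs \<subseteq> fst ` H"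
    using small_map_home_list[OF assms(1) xsM] by blast
  note sm = small_map_sm[OF H(1)] and \<sigma> = small_mapD(2)[OF H(1)]
  have xsU: "xs \<in> tuples U (arity s)" using s(2) M_facts(1) by (auto simp: tuples_def)
  have \<sigma>xs: "Elt ` set (map \<sigma> xs) \<subseteq> snd ` H"
    using image_mono[OF H(3), of "eq_map \<sigma>"] by (simp add: small_map_sets(3)[OF H(1)] eq_map_Elt_image)
  then have "Elt ` set (map \<sigma> xs) \<subseteq> eq_set L N M'" using small_map_sets(2)[OF H(1)] by blast
  then have \<sigma>M: "set (map \<sigma> xs) \<subseteq> M'" using Elt_in_eq_set by blast
  have \<sigma>e: "eq_map \<sigma> e = cls N s (map \<sigma> xs)" using eq_map_cls[OF \<sigma> s(1) xsU] s(3) by simp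
  have eM': "eq_map \<sigma> e \<in> eq_set L N M'"
    unfolding \<sigma>e eq_set_cls using s(1,2) \<sigma>M by (intro UN_I[OF s(1)] imageI) (auto simp: tuples_def)
  have eU: "e \<in> Ue" "eq_map \<sigma> e \<in> Ue"
    using assms(2) eM' eq_set_mono[OF M_facts(1)] eq_set_mono[OF M'_facts(1)] by (auto simp: carrier_Le)
  have se: "smE {e}" "smE {eq_map \<sigma> e}" using eU by (auto intro: im.sm_finite)
  have inc: "smE D \<Longrightarrow> Elt ` set ys \<subseteq> D \<Longrightarrow> ys \<in> tuples U (arity s) \<Longrightarrow> cls N s ys \<in> clE D" for ys D
  proof -
    assume D: "smE D" "Elt ` set ys \<subseteq> D" and ys: "ys \<in> tuples U (arity s)"
    have "home.sm (set ys)" using ys by (intro home.sm_finite) (auto simp: tuples_def carrier_L)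
    moreover have "{cls N s ys} \<subseteq> eq_set L N (set ys)" using ys s(1) by (auto simp: eq_set_cls tuples_def)
    ultimately show "cls N s ys \<in> clE D" using eq_set_cl_subset[OF _ _ D(2,1)] by blast
  qed
  have "ind_eq (fst ` H \<union> {e}) (fst ` H \<inter> eq_set L N PM) (Elt ` PM)"
  proof (rule im.extend_left[OF small_mapD(4)[OF H(1)] _ sm(1,3) M_facts(4) se(1)])
    show "{e} \<subseteq> clE (fst ` H \<inter> eq_set L N PM \<union> fst ` H)"
      using inc[OF im.sm_Un[OF sm(3,1)], of xs] H(3) xsU s(3) by auto
  qed
  moreover have "ind_eq (snd ` H \<union> {eq_map \<sigma> e}) (snd ` H \<inter> eq_set L N PM') (Elt ` PM')"
  proof (rule im.extend_left[OF small_mapD(5)[OF H(1)] _ sm(2,4) M'_facts(4) se(2)])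
    show "{eq_map \<sigma> e} \<subseteq> clE (snd ` H \<inter> eq_set L N PM' \<union> snd ` H)"
      using inc[OF im.sm_Un[OF sm(4,2)], of "map \<sigma> xs"] \<sigma>xs aut_tuples[OF \<sigma> xsU] \<sigma>e by auto
  qed
  ultimately have "small_map M PM M' PM' \<sigma> (insert (e, eq_map \<sigma> e) H)"
    by (intro small_map_insert[OF H(1) assms(2) eM']) simp_all
  then show ?thesis using H(2) by (intro exI[of _ \<sigma>] exI[of _ "insert (e, eq_map \<sigma> e) H"]) auto
qed

end

end

section \<open>Types in a pair\<close>

lemma tm_val_pair: "tm_val (pair_eq_struct L N M PM) w t = tm_val (eq_struct N) w t"
proof (induction t)
  case (Fn f ts)
  then have "map (tm_val (pair_eq_struct L N M PM) w) ts = map (tm_val (eq_struct N) w) ts" by auto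
  moreover have "fint (pair_eq_struct L N M PM) f = fint (eq_struct N) f"
    by (simp add: pair_eq_struct_def expand_def substr_def)
  ultimately show ?case by (simp only: tm_val.simps)
qed simp

lemma sort_of_add_pred: "sort_of (add_pred L h) t = sort_of L t"
  by (cases t) (auto simp: add_pred_def)

lemma wf_tm_add_pred: "wf_tm (add_pred L h) t \<longleftrightarrow> wf_tm L t"
proof (induction t)
  case (Fn f ts)
  have "fsyms (add_pred L h) = fsyms L" "fdom (add_pred L h) = fdom L" by (simp_all add: add_pred_def)
  moreover have "map (sort_of (add_pred L h)) ts = map (sort_of L) ts" by (simp add: sort_of_add_pred)
  ultimately show ?case using Fn by (simp only: wf_tm.simps) auto
qed (simp add: add_pred_def)

lemma univ_pair: "univ (pair_eq_struct L N M PM) s = univ (eq_struct N) s \<inter> eq_set L N M"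
  by (simp add: pair_eq_struct_def expand_def substr_def)

lemma rint_pair:
  "rint (pair_eq_struct L N M PM) (Some r) xs \<longleftrightarrow> rint (eq_struct N) r xs"
  "rint (pair_eq_struct L N M PM) None xs \<longleftrightarrow> (\<exists>x\<in>Elt ` PM. xs = [x])"
  by (simp_all add: pair_eq_struct_def expand_def substr_def)

context one_sorted
begin

lemma home_term_in_substructure:
  assumes M: "elementary_substructure L N M"
  shows "wf_tm Le t \<Longrightarrow> sort_of Le t = Home \<Longrightarrow>
    (\<And>s n. (s, n) \<in> fv_tm t \<Longrightarrow> w (s, n) \<in> univ Ne s \<inter> eq_set L N M) \<Longrightarrow> tm_val Ne w t \<in> Elt ` M"
proof (induction t)
  case (Var s n)
  then have "w (s, n) \<in> Elt ` U" "w (s, n) \<in> eq_set L N M" by (auto simp: univ_Ne_Home)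
  then show ?case using Elt_in_eq_set by auto
next
  case (Fn f ts)
  then obtain f0 where f0: "f = Old f0" by (cases f) (auto simp: Le_simps)
  have len: "length ts = length (fdom L f0)"
    using Fn.prems(1) f0 length_eq_of_map[of "sort_of Le" ts "fdom Le f"] by (simp add: Le_simps)
  have "tm_val Ne w t \<in> Elt ` M" if t: "t \<in> set ts" for t
  proof (rule Fn.IH[OF t])
    have "sort_of Le t \<in> set (fdom Le f)" using t Fn.prems(1) by (metis image_eqI list.set_map wf_tm.simps(2))
    then show "sort_of Le t = Home" by (auto simp: f0 Le_simps)
  qed (use t Fn.prems in auto)
  then have "set (map (tm_val Ne w) ts) \<subseteq> Elt ` M" by auto
  then obtain xs where xs: "set xs \<subseteq> M" "map (tm_val Ne w) ts = map Elt xs"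
    using subset_image_map by metis
  have "length xs = length (fdom L f0)" using len arg_cong[OF xs(2), of length] by simp
  moreover have "M \<subseteq> U" using M by (simp add: elementary_substructure_def carrier_L)
  ultimately have "list_all2 (\<lambda>x s. x \<in> univ (substr N M) s) xs (fdom L f0)"
    using xs(1) by (auto simp: list_all2_conv_all_nth substr_def subset_iff)
  moreover have "f0 \<in> fsyms L" using Fn.prems(1) f0 by (simp add: Le_simps)
  ultimately have "fint (substr N M) f0 xs \<in> univ (substr N M) (fcod L f0)"
    using M unfolding elementary_substructure_def is_struct_def by blast
  then have "fint N f0 xs \<in> M" by (simp add: substr_def)
  moreover have "tm_val Ne w (Fn f ts) = fint Ne (Old f0) (map Elt xs)"
    by (simp only: tm_val.simps xs(2) f0)
  moreover have "fint Ne (Old f0) (map Elt xs) = Elt (fint N f0 xs)"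
    by (simp add: eq_struct_def comp_def)
  ultimately show ?case by simp
qed

end

context lovely_pairs
begin

text \<open>
  Small maps form a back-and-forth system, so they preserve all formulas of the pair. In an atomic
  formula \<open>P(t)\<close> the value of the term \<open>t\<close> need not be in the domain; it has to be added to it
  before the preservation of P can be used.
\<close>

lemma small_map_sat:
  assumes lovely: "lovely_pair L N \<mu> ind \<kappa> M PM" and lovely': "lovely_pair L N \<mu> ind \<kappa> M' PM'"
  shows "small_map M PM M' PM' \<sigma> H \<Longrightarrow> wf_fm (add_pred Le Home) \<phi> \<Longrightarrow>
    (\<And>s n. (s, n) \<in> fv \<phi> \<Longrightarrow> (w (s, n), w' (s, n)) \<in> H \<and> w (s, n) \<in> univ Ne s) \<Longrightarrow>
    sat (pair_eq_struct L N M PM) w \<phi> \<longleftrightarrow> sat (pair_eq_struct L N M' PM') w' \<phi>"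
proof (induction \<phi> arbitrary: \<sigma> H w w')
  case (Eq t u)
  have "sat Ne w (Eq t u) \<longleftrightarrow> sat Ne w' (Eq t u)"
  proof (rule elem_rel_sat[OF small_map_elem_rel[OF Eq.prems(1) M_U[OF lovely]]])
    show "wf_fm Le (Eq t u)" using Eq.prems(2) by (simp add: wf_tm_add_pred sort_of_add_pred)
  qed (use Eq.prems(3) in simp)
  then show ?case by (simp add: tm_val_pair)
next
  case (Rel r' ts)
  note eH = small_map_elem_rel[OF Rel.prems(1) M_U[OF lovely]]
  have wf: "\<forall>t\<in>set ts. wf_tm Le t" using Rel.prems(2) by (simp add: wf_tm_add_pred)
  have srt: "map (sort_of Le) ts = rdom (add_pred Le Home) r'"
    using Rel.prems(2) by (simp add: sort_of_add_pred[abs_def])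
  show ?case
  proof (cases r')
    case (Some r)
    have "sat Ne w (Rel r ts) \<longleftrightarrow> sat Ne w' (Rel r ts)"
    proof (rule elem_rel_sat[OF eH])
      have "r \<in> rsyms Le" "rdom (add_pred Le Home) r' = rdom Le r"
        using Rel.prems(2) Some by (auto simp: add_pred_def)
      then show "wf_fm Le (Rel r ts)" using wf srt by simp
    qed (use Rel.prems(3) in simp)
    then show ?thesis using Some by (simp add: rint_pair tm_val_pair[abs_def])
  next
    case None
    then have "map (sort_of Le) ts = [Home]" using srt by (simp add: add_pred_def)
    then obtain t where t: "ts = [t]" "sort_of Le t = Home" by auto
    have wft: "wf_tm Le t" using wf t by simp
    have fvt: "(w (s, n), w' (s, n)) \<in> H \<and> w (s, n) \<in> univ Ne s" if "(s, n) \<in> fv_tm t" for s n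
      using Rel.prems(3) that t by simp
    have "tm_val Ne w t \<in> Elt ` M"
    proof (rule home_term_in_substructure[OF elementary_M[OF lovely] wft t(2)])
      fix s n assume sn: "(s, n) \<in> fv_tm t"
      have "(w (s, n), w' (s, n)) \<in> H" "w (s, n) \<in> univ Ne s" using fvt[OF sn] by auto
      then show "w (s, n) \<in> univ Ne s \<inter> eq_set L N M"
        using small_mapD(3)[OF Rel.prems(1)] by blast
    qed
    then obtain d where d: "d \<in> M" "tm_val Ne w t = Elt d" by blast
    obtain \<theta> H' where H': "small_map M PM M' PM' \<theta> H'" "H \<subseteq> H'" "Elt d \<in> fst ` H'"
      using small_map_home[OF lovely lovely' Rel.prems(1) d(1)] by blast
    then obtain y where y: "(Elt d, y) \<in> H'" by force
    have dU: "d \<in> U" using d(1) M_U[OF lovely] by blast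
    \<comment> \<open>The image \<open>y\<close> of the value of \<open>t\<close> is the value of \<open>t\<close> on the other side, by the formula \<open>t = x\<close> with a fresh variable \<open>x\<close>.\<close>
    have "finite (snd ` fv_tm t)" by (simp add: finite_fv_tm)
    then obtain k where k: "k \<notin> snd ` fv_tm t" using ex_new_if_finite[OF infinite_UNIV_nat] by blast
    have kt: "(Home, k) \<notin> fv_tm t" using k by force
    define u u' where "u = w((Home, k) := Elt d)" and "u' = w'((Home, k) := y)"
    have val: "tm_val Ne u t = tm_val Ne w t" "tm_val Ne u' t = tm_val Ne w' t"
      by (rule tm_val_cong; use kt in \<open>auto simp: u_def u'_def\<close>)+
    have "sat Ne u (Eq t (Var Home k)) \<longleftrightarrow> sat Ne u' (Eq t (Var Home k))"
    proof (rule elem_rel_sat[OF small_map_elem_rel[OF H'(1) M_U[OF lovely]]])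
      show "wf_fm Le (Eq t (Var Home k))" using wft t(2) by (simp add: Home_sort)
      fix s n assume "(s, n) \<in> fv (Eq t (Var Home k))"
      then consider "(s, n) = (Home, k)" | "(s, n) \<noteq> (Home, k)" "(s, n) \<in> fv_tm t" by auto
      then show "(u (s, n), u' (s, n)) \<in> H' \<and> u (s, n) \<in> univ Ne s"
      proof cases
        case 1
        then show ?thesis using y dU by (simp add: u_def u'_def univ_Ne_Home)
      next
        case 2
        then have "u (s, n) = w (s, n)" "u' (s, n) = w' (s, n)" by (auto simp: u_def u'_def)
        then show ?thesis using fvt[OF 2(2)] H'(2) by auto
      qed
    qed
    then have "tm_val Ne w' t = y" using d(2) val by (simp add: u_def u'_def)
    moreover have "y \<in> Elt ` U"
      using elem_rel_sort[OF small_map_elem_rel[OF H'(1) M_U[OF lovely]] y Home_sort] dU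
      by (simp add: univ_Ne_Home)
    then obtain d' where d': "y = Elt d'" by blast
    moreover have "d \<in> PM \<longleftrightarrow> d' \<in> PM'"
      using small_mapD(3)[OF H'(1) y] d' by (simp add: Elt_in_eq_set)
    ultimately show ?thesis using None t(1) d(2) by (auto simp: rint_pair tm_val_pair)
  qed
next
  case (Neg \<phi>)
  have "sat (pair_eq_struct L N M PM) w \<phi> \<longleftrightarrow> sat (pair_eq_struct L N M' PM') w' \<phi>"
    by (rule Neg.IH[OF Neg.prems(1)]) (use Neg.prems in auto)
  then show ?case by simp
next
  case (Conj \<phi> \<psi>)
  have "sat (pair_eq_struct L N M PM) w \<phi> \<longleftrightarrow> sat (pair_eq_struct L N M' PM') w' \<phi>"
    by (rule Conj.IH(1)[OF Conj.prems(1)]) (use Conj.prems in auto)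
  moreover have "sat (pair_eq_struct L N M PM) w \<psi> \<longleftrightarrow> sat (pair_eq_struct L N M' PM') w' \<psi>"
    by (rule Conj.IH(2)[OF Conj.prems(1)]) (use Conj.prems in auto)
  ultimately show ?case by simp
next
  case (Ex s n \<phi>)
  have s: "s \<in> sorts Le" and wf: "wf_fm (add_pred Le Home) \<phi>"
    using Ex.prems(2) by (auto simp: add_pred_def)
  have step: "sat (pair_eq_struct L N M PM) (w((s, n) := x)) \<phi> \<longleftrightarrow>
      sat (pair_eq_struct L N M' PM') (w'((s, n) := y)) \<phi>"
    if H': "small_map M PM M' PM' \<theta> H'" "H \<subseteq> H'" "(x, y) \<in> H'" and x: "x \<in> univ Ne s" for \<theta> H' x y
  proof (rule Ex.IH[OF H'(1) wf])
    fix t m assume "(t, m) \<in> fv \<phi>"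
    then show "((w((s, n) := x)) (t, m), (w'((s, n) := y)) (t, m)) \<in> H' \<and> (w((s, n) := x)) (t, m) \<in> univ Ne t"
      using Ex.prems(3)[of t m] H'(2,3) x by auto
  qed
  show ?case
  proof
    assume "sat (pair_eq_struct L N M PM) w (Ex s n \<phi>)"
    then obtain x where x: "x \<in> univ Ne s" "x \<in> eq_set L N M"
      "sat (pair_eq_struct L N M PM) (w((s, n) := x)) \<phi>" by (auto simp: univ_pair)
    obtain \<theta> H' where H': "small_map M PM M' PM' \<theta> H'" "H \<subseteq> H'" "x \<in> fst ` H'"
      using small_map_forth[OF lovely lovely' Ex.prems(1) x(2)] by blast
    then obtain y where y: "(x, y) \<in> H'" by force
    have "y \<in> univ Ne s"
      using elem_rel_sort[OF small_map_elem_rel[OF H'(1) M_U[OF lovely]] y s] x(1) by simp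
    moreover have "y \<in> eq_set L N M'" using small_mapD(3)[OF H'(1) y] by blast
    moreover have "sat (pair_eq_struct L N M' PM') (w'((s, n) := y)) \<phi>"
      using step[OF H'(1,2) y x(1)] x(3) by simp
    ultimately show "sat (pair_eq_struct L N M' PM') w' (Ex s n \<phi>)" by (auto simp: univ_pair)
  next
    assume "sat (pair_eq_struct L N M' PM') w' (Ex s n \<phi>)"
    then obtain y where y: "y \<in> univ Ne s" "y \<in> eq_set L N M'"
      "sat (pair_eq_struct L N M' PM') (w'((s, n) := y)) \<phi>" by (auto simp: univ_pair)
    obtain \<tau> where "small_map M' PM' M PM \<tau> (H\<inverse>)"
      using small_map_sym[OF Ex.prems(1) M_U[OF lovely]] by blast
    then obtain \<theta> G where G: "small_map M' PM' M PM \<theta> G" "H\<inverse> \<subseteq> G" "y \<in> fst ` G"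
      using small_map_forth[OF lovely' lovely _ y(2)] by blast
    obtain \<rho> where H': "small_map M PM M' PM' \<rho> (G\<inverse>)"
      using small_map_sym[OF G(1) M_U[OF lovely']] by blast
    have HG: "H \<subseteq> G\<inverse>" using G(2) by auto
    obtain x where xy: "(x, y) \<in> G\<inverse>" using G(3) by force
    have x: "x \<in> univ Ne s"
      using elem_rel_sort[OF small_map_elem_rel[OF H' M_U[OF lovely]] xy s] y(1) by simp
    moreover have "x \<in> eq_set L N M" using small_mapD(3)[OF H' xy] by blast
    moreover have "sat (pair_eq_struct L N M PM) (w((s, n) := x)) \<phi>"
      using step[OF H' HG xy x] y(3) by simp
    ultimately show "sat (pair_eq_struct L N M PM) w (Ex s n \<phi>)" by (auto simp: univ_pair)
  qed
qed

lemma P_part_eq_set: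
  assumes "lovely_pair L N \<mu> ind \<kappa> M PM" "A \<subseteq> eq_set L N M"
  shows "P_part L N ind_eq PM A = A \<inter> eq_set L N PM"
  using P_eq_set[OF assms(1)] assms(2) by (auto simp: P_part_def)

text \<open>
  P-independence does not pass from a set \<open>A\<close> to a subset \<open>F\<close>, but it does after adding a base for
  \<open>F\<close> inside the P-part of \<open>A\<close>.
\<close>

lemma P_independent_restrict:
  assumes A: "ind_eq A (A \<inter> eq_set L N P) (Elt ` P)" "smE A" and P: "home.sm P"
    and F: "F \<subseteq> A" and E0: "E0 \<subseteq> A \<inter> eq_set L N P" "ind_eq F E0 (A \<inter> eq_set L N P)"
  shows "ind_eq (F \<union> E0) ((F \<union> E0) \<inter> eq_set L N P) (Elt ` P)"
proof -
  let ?Q = "A \<inter> eq_set L N P"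
  have sP: "smE (Elt ` P)" by (rule smE_Elt[OF P])
  have s: "smE ?Q" "smE F" "smE E0" using im.sm_subset[OF A(2)] F E0(1) by auto
  have sFE: "smE (F \<union> E0)" by (rule im.sm_Un[OF s(2,3)])
  have sQ: "smE ((F \<union> E0) \<inter> eq_set L N P)" by (rule im.sm_subset[OF sFE]) simp
  have "ind_eq F ?Q (Elt ` P)" by (rule im.mono_left[OF A(1) F A(2) s(1) sP])
  moreover have "E0 \<union> ?Q = ?Q" using E0(1) by blast
  ultimately have "ind_eq F (E0 \<union> ?Q) (Elt ` P)" by simp
  from im.trans_right[OF E0(2) this s(2,3,1) sP] have "ind_eq F E0 (?Q \<union> Elt ` P)" .
  then have "ind_eq F E0 (Elt ` P)"
    by (rule im.mono_right[OF _ _ s(2,3) im.sm_Un[OF s(1) sP]]) simp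
  then have "ind_eq (F \<union> E0) E0 (Elt ` P)" by (rule im.normality[OF _ s(2,3) sP])
  then show ?thesis
  proof (rule im.base_up[OF _ _ _ sFE sQ sP])
    have s2: "smE (E0 \<union> Elt ` P)" by (rule im.sm_Un[OF s(3) sP])
    show "(F \<union> E0) \<inter> eq_set L N P \<subseteq> clE (E0 \<union> Elt ` P)"
      using eq_set_cl[OF P] im.cl_mono[OF _ s2, of "Elt ` P"] by blast
  qed (use E0(1) in blast)
qed

end

theorem lemma5p7:
  fixes L :: "(unit, 'f, 'r) lang"
    and T :: "(unit, 'f, 'r) fm set"
    and \<CC> :: "(unit, 'f, 'r, 'a) struct"
    and \<mu> \<kappa> \<kappa>0 :: "'k rel"
    and ind :: "'a set \<Rightarrow> 'a set \<Rightarrow> 'a set \<Rightarrow> bool"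
    and ind_eq :: "('f, 'r, 'a) eq_elem set \<Rightarrow> ('f, 'r, 'a) eq_elem set \<Rightarrow>
                     ('f, 'r, 'a) eq_elem set \<Rightarrow> bool"
    and M PM M' PM' :: "'a set"
    and I :: "'i set"
    and a a' :: "'i \<Rightarrow> ('f, 'r, 'a) eq_elem"
  assumes "sorts L = {()}"
    and "complete_theory L T"
    and "monster_model L T \<mu> \<CC>"
    and "independence_relation L \<CC> \<mu> ind"
    and "is_kappa0 L \<CC> \<mu> ind \<kappa>0"
    and "Card_order \<kappa>" and "\<kappa> <o \<mu>" and "\<kappa>0 <o \<kappa>" and "|T| <o \<kappa>"
    and "independence_relation (eq_lang L \<CC>) (eq_struct \<CC>) \<mu> ind_eq"
    and "extends_to_eq L \<CC> \<mu> ind ind_eq"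
    and "lovely_pair L \<CC> \<mu> ind \<kappa> M PM"
    and "lovely_pair L \<CC> \<mu> ind \<kappa> M' PM'"
    and "|I| <o \<mu>"
    and "\<forall>i\<in>I. a i \<in> eq_set L \<CC> M"
    and "\<forall>i\<in>I. a' i \<in> eq_set L \<CC> M'"
    and "same_sorts (eq_lang L \<CC>) (eq_struct \<CC>) (eq_struct \<CC>) I a a'"
    and "P_independent L \<CC> ind_eq PM (a ` I)"
    and "P_independent L \<CC> ind_eq PM' (a' ` I)"
    and "same_type1 L \<CC> I a a'"
    and "same_P_type L \<CC> ind_eq M PM M' PM' I a a'"
  shows "same_type2 L \<CC> M PM M' PM' I a a'"
proof -
  have k0: "Cinfinite \<kappa>0" "finite_local_character L \<CC> \<mu> ind \<kappa>0" using assms(5) by (auto simp: is_kappa0_def)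
  have mu: "natLeq <o \<mu>"
    using natLeq_ordLeq_cinfinite[OF k0(1)] ordLess_transitive[OF assms(8,7)] by (rule ordLeq_ordLess_trans)
  have monster: "is_struct L \<CC>" "Card_order \<mu>" "saturated L \<CC> \<mu>" "strongly_homogeneous L \<CC> \<mu>"
    using assms(3) by (simp_all add: monster_model_def is_model_def)
  interpret lovely_pairs L \<CC> \<mu> ind ind_eq \<kappa> \<kappa>0
    by unfold_locales (fact assms monster mu k0)+
  note lovely = assms(12) and lovely' = assms(13)
  have aM: "a ` I \<subseteq> eq_set L \<CC> M" "a' ` I \<subseteq> eq_set L \<CC> M'" using assms(15,16) by auto
  have aU: "a ` I \<subseteq> Ue" "a' ` I \<subseteq> Ue"
    using aM eq_set_mono[OF M_U[OF lovely]] eq_set_mono[OF M_U[OF lovely']] by (auto simp: carrier_Le)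
  have sa: "smE (a ` I)" "smE (a' ` I)"
    using aU card_image_ordLess[OF assms(14)] by (auto simp: small_def)
  have ind_a: "ind_eq (a ` I) (a ` I \<inter> eq_set L \<CC> PM) (Elt ` PM)"
    and ind_a': "ind_eq (a' ` I) (a' ` I \<inter> eq_set L \<CC> PM') (Elt ` PM')"
    using assms(18,19) unfolding P_independent_def P_part_eq_set[OF lovely aM(1)] P_part_eq_set[OF lovely' aM(2)] .
  have P: "a i \<in> eq_set L \<CC> PM \<longleftrightarrow> a' i \<in> eq_set L \<CC> PM'" if "i \<in> I" for i
  proof -
    have "a i \<in> eq_set L \<CC> M" "a' i \<in> eq_set L \<CC> M'" using assms(15,16) that by auto
    moreover have "a i \<in> eq_set L \<CC> M \<inter> eq_set L \<CC> PM \<longleftrightarrow> a' i \<in> eq_set L \<CC> M' \<inter> eq_set L \<CC> PM'"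
      using assms(21) that unfolding same_P_type_def P_part_eq_set[OF lovely order_refl]
        P_part_eq_set[OF lovely' order_refl] by (rule bspec)
    ultimately show ?thesis by blast
  qed
  have el: "elem_rel Le Ne ((\<lambda>i. (a i, a' i)) ` I)"
    using assms(20) by (simp only: same_type1_def same_type_iff_elem_rel)
  obtain \<sigma> where \<sigma>: "automorphism L \<CC> \<sigma>" "\<forall>(x, y)\<in>(\<lambda>i. (a i, a' i)) ` I. y = eq_map \<sigma> x"
    using eq_homogeneous[OF el card_image_ordLess[OF assms(14)]] aU(1) by blast
  have \<sigma>a: "eq_map \<sigma> (a i) = a' i" if "i \<in> I" for i using \<sigma>(2) that by auto
  have \<sigma>J: "eq_map \<sigma> ` a ` J = a' ` J" if "J \<subseteq> I" for J
    unfolding image_image by (rule image_cong) (use \<sigma>a that in auto)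
  have "sat (pair_eq_struct L \<CC> M PM) (a \<circ> \<eta>) \<phi> \<longleftrightarrow> sat (pair_eq_struct L \<CC> M' PM') (a' \<circ> \<eta>) \<phi>"
    if wf: "wf_fm (add_pred Le Home) \<phi>" and
      \<eta>: "\<forall>(s, n)\<in>fv \<phi>. \<eta> (s, n) \<in> I \<and> a (\<eta> (s, n)) \<in> univ (pair_eq_struct L \<CC> M PM) s" for \<phi> \<eta>
  proof -
    \<comment> \<open>Only the finite subtuple \<open>F\<close> matters; \<open>J\<close> adds a base for it, indexed inside \<open>I\<close>.\<close>
    define F where "F = \<eta> ` fv \<phi>"
    have F: "finite F" "F \<subseteq> I" using \<eta> by (auto simp: F_def finite_fv)
    define Q where "Q = a ` I \<inter> eq_set L \<CC> PM"
    define Q' where "Q' = a' ` I \<inter> eq_set L \<CC> PM'"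
    have sQ: "smE Q" unfolding Q_def by (rule im.sm_subset[OF sa(1)]) simp
    have Fa: "finite (a ` F)" using F(1) by (rule finite_imageI)
    have FU: "a ` F \<subseteq> Ue" by (rule order_trans[OF image_mono[OF F(2)] aU(1)])
    obtain E0 where E0: "E0 \<subseteq> Q" "|E0| <o \<kappa>" "ind_eq (a ` F) E0 Q"
      using local_character_eq[OF Fa FU sQ] by blast
    have E0a: "E0 \<subseteq> a ` I" using E0(1) by (auto simp: Q_def)
    obtain J where "J \<subseteq> I \<and> inj_on a J \<and> E0 = a ` J" using E0a[unfolded subset_image_inj] ..
    then have J: "J \<subseteq> I" "E0 = a ` J" "inj_on a J" by simp_all
    have cJ: "|J| <o \<kappa>" by (rule card_inj_on_ordLess[OF _ J(3)]) (use E0(2) J(2) in simp)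
    define H where "H = (\<lambda>i. (a i, a' i)) ` (F \<union> J)"
    have cH: "|H| <o \<kappa>" unfolding H_def
      by (intro card_image_ordLess card_Un_ordLess[OF kappa_facts _ cJ] card_finite_ordLess[OF kappa_uncountable F(1)])
    have fH: "fst ` H = a ` F \<union> E0" "snd ` H = a' ` F \<union> a' ` J"
      unfolding H_def J(2) image_image by (simp_all add: image_Un)
    have \<sigma>Q: "eq_map \<sigma> ` Q = Q'"
    proof -
      have "Q = a ` {i \<in> I. a i \<in> eq_set L \<CC> PM}" "Q' = a' ` {i \<in> I. a' i \<in> eq_set L \<CC> PM'}"
        by (auto simp: Q_def Q'_def)
      moreover have "{i \<in> I. a i \<in> eq_set L \<CC> PM} = {i \<in> I. a' i \<in> eq_set L \<CC> PM'}" using P by blast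
      ultimately show ?thesis using \<sigma>J[of "{i \<in> I. a i \<in> eq_set L \<CC> PM}"] by simp
    qed
    have sF: "smE (a ` F)" and sE0: "smE E0"
      by (rule im.sm_subset[OF sa(1) image_mono[OF F(2)]], rule im.sm_subset[OF sa(1) E0a])
    have E0': "a' ` J \<subseteq> Q'" using image_mono[OF E0(1), of "eq_map \<sigma>"] by (simp add: \<sigma>Q J(2) \<sigma>J[OF J(1)])
    have i': "ind_eq (a' ` F) (a' ` J) Q'"
      using ind_eq_map[OF E0(3) \<sigma>(1) sF sE0 sQ] by (simp add: \<sigma>Q \<sigma>J[OF J(1)] \<sigma>J[OF F(2)] J(2))
    have "small_map M PM M' PM' \<sigma> H"
      unfolding small_map_def
    proof (intro conjI)
      show "ind_eq (fst ` H) (fst ` H \<inter> eq_set L \<CC> PM) (Elt ` PM)"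
        unfolding fH using ind_a sa(1) sm_PM[OF lovely] image_mono[OF F(2)] E0(1,3)
        unfolding Q_def by (rule P_independent_restrict)
      show "ind_eq (snd ` H) (snd ` H \<inter> eq_set L \<CC> PM') (Elt ` PM')"
        unfolding fH using ind_a' sa(2) sm_PM[OF lovely'] image_mono[OF F(2)] E0' i'
        unfolding Q'_def by (rule P_independent_restrict)
      show "\<forall>(x, y)\<in>H. x \<in> eq_set L \<CC> M \<and> y \<in> eq_set L \<CC> M' \<and> y = eq_map \<sigma> x \<and>
          (x \<in> eq_set L \<CC> PM \<longleftrightarrow> y \<in> eq_set L \<CC> PM')"
      proof (clarify)
        fix x y assume "(x, y) \<in> H"
        then obtain i where i: "i \<in> F \<union> J" "x = a i" "y = a' i" by (auto simp: H_def)
        then have "i \<in> I" using F(2) J(1) by blast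
        then show "x \<in> eq_set L \<CC> M \<and> y \<in> eq_set L \<CC> M' \<and> y = eq_map \<sigma> x \<and>
          (x \<in> eq_set L \<CC> PM \<longleftrightarrow> y \<in> eq_set L \<CC> PM')"
          using i(2,3) assms(15,16) \<sigma>a P by simp
      qed
    qed (use cH \<sigma>(1) in simp_all)
    then show ?thesis
    proof (rule small_map_sat[OF lovely lovely' _ wf])
      fix s n assume sn: "(s, n) \<in> fv \<phi>"
      then have "\<eta> (s, n) \<in> F" by (simp add: F_def)
      then show "((a \<circ> \<eta>) (s, n), (a' \<circ> \<eta>) (s, n)) \<in> H \<and> (a \<circ> \<eta>) (s, n) \<in> univ Ne s"
        using \<eta> sn by (auto simp: H_def univ_pair)
    qed
  qed
  moreover have "same_sorts (add_pred Le Home) (pair_eq_struct L \<CC> M PM) (pair_eq_struct L \<CC> M' PM') I a a'"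
    using assms(15-17) by (auto simp: same_sorts_def univ_pair add_pred_def)
  ultimately show ?thesis unfolding same_type2_def same_type_def by blast
qed

end
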